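(* Let $W\in\mathcal{DT}$ be an operator of diagonal type on $L^2(\mathbb T)$ with matrix $(W_{j,k})_{j,k\in\mathbb Z}$. For $a\in\mathbb T$ let $$w_l(a)=\sum_{j\in\mathbb Z}W_{l,j}e^{i(l-j)a}\quad(l\in\mathbb Z),\qquad \rho(L_a)=\limsup_{\#I\to\infty}\frac1{\#I}\sum_{l\in I}|w_l(a)|^2,$$ where $I$ ranges over finite integer intervals. Then $$\|W\|_\mu^2=\frac1{2\pi}\int_{\mathbb T}\rho(L_a)\,da .$$
   Context: $\mathbb T=\mathbb R/(2\pi\mathbb Z)$ with measure $d\mu=\frac1{2\pi}dx$, $\mathcal H=L^2(\mathbb T,\mu)$ (complex-valued). An operator $W$ on $\mathcal H$ is described by its matrix $(W_{j,k})_{j,k\in\mathbb Z}$ in the basis $e^{ikx}$: if $f=\sum_kf_ke^{ikx}$ then $Wf=\sum_{j}\big(\sum_kW_{j,k}f_k\big)e^{ijx}$. Put $c_k=\sup_{j\in\mathbb Z}|W_{k+j,j}|$. $W$ is of diagonal type, $W\in\mathcal{DT}$, if $\sum_{k\in\mathbb Z}c_k<\infty$ (such $W$ is bounded). Here $L_a$ denotes the distribution $L_a(x)=\sum_{l\in\mathbb Z}w_l(a)e^{ilx}$. An integer interval is a set $I=\{n,n+1,\dots,m\}\subset\mathbb Z$, $\#I=m-n+1$, and $\limsup_{\#I\to\infty}$ means $\lim_{N\to\infty}\sup_{\#I\ge N}$. For measurable $X\subset\mathbb T$, $\pi_Xf=\mathbf 1_Xf$. A partition is a finite family $\chi=\{Y_1,\dots,Y_J\}$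 of measurable sets with $\mu(\mathbb T\setminus\bigcup_jY_j)=0$ and $\mu(Y_j\cap Y_k)=0$ for $j\ne k$. For a bounded operator $W$ on $\mathcal H$ with operator norm $\|W\|$, $\mathcal M_\chi(W)=\sum_{j=1}^J\mu(Y_j)\|W\pi_{Y_j}\|^2$, and the $\mu$-norm is $\|W\|_\mu=\inf_\chi\sqrt{\mathcal M_\chi(W)}$, the infimum being over all partitions $\chi$. *)

theory Defs
  imports "HOL-Analysis.Analysis"
begin

text \<open>
  The circle is modelled by the fundamental domain \<open>[0, 2\<pi>)\<close>, with normalised Lebesgue measure.
\<close>

definition circle :: "real measure"
  where "circle = density (lebesgue_on {0..<2 * pi}) (\<lambda>_. ennreal (1 / (2 * pi)))"

lemma emeasure_circle_space: "emeasure circle (space circle) = 1"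
proof -
  have "emeasure circle (space circle) = ennreal (1 / (2 * pi)) * emeasure (lebesgue_on {0..<2 * pi}) {0..<2 * pi}"
    by (simp add: circle_def emeasure_density_const space_restrict_space sets_restrict_space_iff)
  also have "emeasure (lebesgue_on {0..<2 * pi}) {0..<2 * pi} = ennreal (2 * pi)"
    by (simp add: emeasure_restrict_space)
  also have "ennreal (1 / (2 * pi)) * ennreal (2 * pi) = 1"
    by (simp flip: ennreal_mult add: ennreal_1)
  finally show ?thesis .
qed

lemma finite_measure_circle: "finite_measure circle"
  by (rule finite_measureI) (simp add: emeasure_circle_space)

definition square_integrable :: "(real \<Rightarrow> complex) \<Rightarrow> bool"
  where "square_integrable f \<longleftrightarrow>
    f \<in> borel_measurable circle \<and> integrable circle (\<lambda>x. (cmod (f x))\<^sup>2)"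

lemma square_integrable_cmult:
  assumes "square_integrable f" shows "square_integrable (\<lambda>x. c * f x)"
  using assms unfolding square_integrable_def by (auto simp: norm_mult power_mult_distrib)

lemma square_integrable_scaleR:
  assumes "square_integrable f" shows "square_integrable (\<lambda>x. c *\<^sub>R f x)"
  using square_integrable_cmult[OF assms, of "of_real c"] by (simp add: scaleR_conv_of_real)

lemma integrable_inner_square_integrable:
  assumes "square_integrable f" "square_integrable g"
  shows "integrable circle (\<lambda>x. f x \<bullet> g x)"
proof (rule Bochner_Integration.integrable_bound)
  show "integrable circle (\<lambda>x. (cmod (f x))\<^sup>2 + (cmod (g x))\<^sup>2)"
    using assms by (auto simp: square_integrable_def)
  show "(\<lambda>x. f x \<bullet> g x) \<in> borel_measurable circle"
    using assms by (auto simp: square_integrable_def)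
  have "\<bar>f x \<bullet> g x\<bar> \<le> (cmod (f x))\<^sup>2 + (cmod (g x))\<^sup>2" for x
  proof -
    have "\<bar>f x \<bullet> g x\<bar> \<le> cmod (f x) * cmod (g x)" by (rule Cauchy_Schwarz_ineq2)
    also have "\<dots> \<le> (cmod (f x))\<^sup>2 + (cmod (g x))\<^sup>2"
      using sum_squares_bound[of "cmod (f x)" "cmod (g x)"]
        mult_nonneg_nonneg[OF norm_ge_zero[of "f x"] norm_ge_zero[of "g x"]] by linarith
    finally show ?thesis .
  qed
  then show "AE x in circle. norm (f x \<bullet> g x) \<le> norm ((cmod (f x))\<^sup>2 + (cmod (g x))\<^sup>2)"
    by simp
qed

lemma square_integrable_add:
  assumes "square_integrable f" "square_integrable g"
  shows "square_integrable (\<lambda>x. f x + g x)"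
proof -
  have "(\<lambda>x. (cmod (f x + g x))\<^sup>2) = (\<lambda>x. (cmod (f x))\<^sup>2 + 2 * (f x \<bullet> g x) + (cmod (g x))\<^sup>2)"
    by (auto simp: dot_square_norm[symmetric] inner_add_left inner_add_right inner_commute)
  then show ?thesis
    using assms integrable_inner_square_integrable[OF assms]
    by (auto simp: square_integrable_def)
qed

lemma square_integrable_bounded:
  assumes "f \<in> borel_measurable circle" "\<And>x. cmod (f x) \<le> B"
  shows "square_integrable f"
  unfolding square_integrable_def
proof (intro conjI assms(1))
  interpret finite_measure circle by (rule finite_measure_circle)
  show "integrable circle (\<lambda>x. (cmod (f x))\<^sup>2)"
    by (rule integrable_const_bound[where B = "B\<^sup>2"])
      (use assms in \<open>auto intro!: power_mono\<close>)
qed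

lemma square_integrable_cis: "square_integrable (\<lambda>x. cis (of_int k * x))"
proof (rule square_integrable_bounded[where B = 1])
  have "continuous_on UNIV (\<lambda>x::real. cis (of_int k * x))"
    by (intro continuous_intros)
  then have "(\<lambda>x::real. cis (of_int k * x)) \<in> borel_measurable lebesgue"
    by (intro measurable_completion) (simp add: borel_measurable_continuous_onI)
  then show "(\<lambda>x. cis (of_int k * x)) \<in> borel_measurable circle"
    by (simp add: circle_def measurable_restrict_space1)
qed simp

lemma square_integrable_indicator:
  assumes "square_integrable f"
  shows "square_integrable (\<lambda>x. if X \<in> sets circle then indicator X x *\<^sub>R f x else 0)"
proof (cases "X \<in> sets circle")
  case True
  have *: "(cmod (indicator X x *\<^sub>R f x))\<^sup>2 = indicator X x *\<^sub>R (cmod (f x))\<^sup>2" for x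
    by (simp add: indicator_def)
  show ?thesis
    using True assms integrable_mult_indicator[of X circle "\<lambda>x. (cmod (f x))\<^sup>2"]
    unfolding square_integrable_def if_P[OF True] *
    by (auto intro: borel_measurable_scaleR)
qed (simp add: square_integrable_def)

definition l2_rel :: "(real \<Rightarrow> complex) \<Rightarrow> (real \<Rightarrow> complex) \<Rightarrow> bool"
  where "l2_rel f g \<longleftrightarrow>
    square_integrable f \<and> square_integrable g \<and> (AE x in circle. f x = g x)"

quotient_type l2 = "real \<Rightarrow> complex" / partial: l2_rel
proof (rule part_equivpI)
  show "\<exists>f. l2_rel f f"
    by (rule exI[of _ "\<lambda>_. 0"]) (simp add: l2_rel_def square_integrable_def)
  show "symp l2_rel"
    by (auto simp: symp_def l2_rel_def elim: AE_mp)
  show "transp l2_rel"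
    by (auto simp: transp_def l2_rel_def elim: AE_mp)
qed

text \<open>
  The class \<open>real_inner\<close> carries the real part of the usual Hermitian inner product; the
  norm is the usual one.
\<close>

instantiation l2 :: real_inner
begin

lift_definition zero_l2 :: l2 is "\<lambda>_. 0"
  by (simp add: l2_rel_def square_integrable_def)

lift_definition plus_l2 :: "l2 \<Rightarrow> l2 \<Rightarrow> l2" is "\<lambda>f g x. f x + g x"
  by (auto simp: l2_rel_def square_integrable_add)

lift_definition uminus_l2 :: "l2 \<Rightarrow> l2" is "\<lambda>f x. - f x"
  by (auto simp: l2_rel_def square_integrable_def)

lift_definition scaleR_l2 :: "real \<Rightarrow> l2 \<Rightarrow> l2" is "\<lambda>c f x. c *\<^sub>R f x"
  by (auto simp: l2_rel_def square_integrable_scaleR)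

lift_definition inner_l2 :: "l2 \<Rightarrow> l2 \<Rightarrow> real" is "\<lambda>f g. \<integral>x. f x \<bullet> g x \<partial>circle"
  by (rule integral_cong_AE) (auto simp: l2_rel_def square_integrable_def)

definition minus_l2 :: "l2 \<Rightarrow> l2 \<Rightarrow> l2" where "minus_l2 f g = f + - g"
definition norm_l2 :: "l2 \<Rightarrow> real" where "norm_l2 f = sqrt (inner f f)"
definition sgn_l2 :: "l2 \<Rightarrow> l2" where "sgn_l2 f = scaleR (inverse (norm f)) f"
definition dist_l2 :: "l2 \<Rightarrow> l2 \<Rightarrow> real" where "dist_l2 f g = norm (f - g)"
definition uniformity_l2 :: "(l2 \<times> l2) filter"
  where "uniformity_l2 = (INF e\<in>{0<..}. principal {(x, y). dist x y < e})"
definition open_l2 :: "l2 set \<Rightarrow> bool"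
  where "open_l2 U \<longleftrightarrow> (\<forall>x\<in>U. \<forall>\<^sub>F (x', y) in uniformity. x' = x \<longrightarrow> y \<in> U)"

instance
proof
  fix f g h :: l2 and a b :: real and U :: "l2 set"
  show "f + g + h = f + (g + h)"
    by transfer (auto simp: l2_rel_def square_integrable_add add.assoc)
  show "f + g = g + f"
    by transfer (auto simp: l2_rel_def square_integrable_add add.commute)
  show "0 + f = f" by transfer (auto simp: l2_rel_def)
  show "- f + f = 0"
    by transfer (auto simp: l2_rel_def square_integrable_def)
  show "f - g = f + - g" by (rule minus_l2_def)
  show "a *\<^sub>R (f + g) = a *\<^sub>R f + a *\<^sub>R g"
    by transfer (auto simp: l2_rel_def scaleR_add_right intro!: square_integrable_add square_integrable_scaleR)
  show "(a + b) *\<^sub>R f = a *\<^sub>R f + b *\<^sub>R f"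
    by transfer (auto simp: l2_rel_def scaleR_add_left intro!: square_integrable_add square_integrable_scaleR)
  show "a *\<^sub>R b *\<^sub>R f = (a * b) *\<^sub>R f"
    by transfer (auto simp: l2_rel_def square_integrable_scaleR)
  show "1 *\<^sub>R f = f" by transfer (auto simp: l2_rel_def)
  show "sgn f = inverse (norm f) *\<^sub>R f" by (rule sgn_l2_def)
  show "dist f g = norm (f - g)" by (rule dist_l2_def)
  show "uniformity = (INF e\<in>{0<..}. principal {(x, y :: l2). dist x y < e})"
    by (rule uniformity_l2_def)
  show "open U \<longleftrightarrow> (\<forall>x\<in>U. \<forall>\<^sub>F (x', y) in uniformity. x' = x \<longrightarrow> y \<in> U)"
    by (rule open_l2_def)
  show "f \<bullet> g = g \<bullet> f" by transfer (simp add: inner_commute)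
  show "(f + g) \<bullet> h = f \<bullet> h + g \<bullet> h"
    by transfer (simp add: l2_rel_def inner_add_left integrable_inner_square_integrable)
  show "(a *\<^sub>R f) \<bullet> g = a * (f \<bullet> g)" by transfer simp
  show "0 \<le> f \<bullet> f" by transfer simp
  show "f \<bullet> f = 0 \<longleftrightarrow> f = 0"
  proof transfer
    fix f assume "l2_rel f f"
    then have f: "square_integrable f" by (simp add: l2_rel_def)
    have "(\<integral>x. f x \<bullet> f x \<partial>circle) = 0 \<longleftrightarrow> (AE x in circle. f x \<bullet> f x = 0)"
      by (rule integral_nonneg_eq_0_iff_AE) (simp_all add: f integrable_inner_square_integrable)
    then show "(\<integral>x. f x \<bullet> f x \<partial>circle) = 0 \<longleftrightarrow> l2_rel f (\<lambda>_. 0)"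
      using f by (simp add: l2_rel_def square_integrable_def)
  qed
  show "norm f = sqrt (f \<bullet> f)" by (rule norm_l2_def)
qed

end

lift_definition cscale :: "complex \<Rightarrow> l2 \<Rightarrow> l2" (infixr "*\<^sub>c" 75) is "\<lambda>c f x. c * f x"
  by (auto simp: l2_rel_def square_integrable_cmult)

lift_definition fourier_basis :: "int \<Rightarrow> l2" is "\<lambda>k x. cis (of_int k * x)"
  by (simp add: l2_rel_def square_integrable_cis)

text \<open>Multiplication by the indicator function of \<open>X\<close>; the value 0 for non-measurable \<open>X\<close> is junk.\<close>

lift_definition proj :: "real set \<Rightarrow> l2 \<Rightarrow> l2"
  is "\<lambda>X f x. if X \<in> sets circle then indicator X x *\<^sub>R f x else 0"
  using square_integrable_indicator by (auto simp: l2_rel_def)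

text \<open>
  No linearity or boundedness is required of \<open>W\<close>: every element of \<open>l2\<close> is the sum of its
  Fourier series, so \<open>W\<close> is determined by its matrix and is linear.
\<close>

definition has_matrix :: "(l2 \<Rightarrow> l2) \<Rightarrow> (int \<Rightarrow> int \<Rightarrow> complex) \<Rightarrow> bool"
  where "has_matrix W A \<longleftrightarrow>
    (\<forall>f \<phi>. ((\<lambda>k. \<phi> k *\<^sub>c fourier_basis k) has_sum f) UNIV \<longrightarrow>
      (\<forall>j. (\<lambda>k. A j k * \<phi> k) summable_on UNIV) \<and>
      ((\<lambda>j. (\<Sum>\<^sub>\<infinity>k. A j k * \<phi> k) *\<^sub>c fourier_basis j) has_sum W f) UNIV)"

definition diagonal_type :: "(int \<Rightarrow> int \<Rightarrow> complex) \<Rightarrow> bool"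
  where "diagonal_type A \<longleftrightarrow> (\<Sum>\<^sub>\<infinity>k. SUP j. ennreal (cmod (A (k + j) j))) < \<infinity>"

definition measurable_partition :: "real set set \<Rightarrow> bool"
  where "measurable_partition P \<longleftrightarrow>
    finite P \<and> P \<subseteq> sets circle \<and>
    measure circle (space circle - \<Union>P) = 0 \<and>
    (\<forall>X\<in>P. \<forall>Y\<in>P. X \<noteq> Y \<longrightarrow> measure circle (X \<inter> Y) = 0)"

definition partition_sum :: "real set set \<Rightarrow> (l2 \<Rightarrow> l2) \<Rightarrow> real"
  where "partition_sum P W = (\<Sum>Y\<in>P. measure circle Y * (onorm (W \<circ> proj Y))\<^sup>2)"

definition mu_norm :: "(l2 \<Rightarrow> l2) \<Rightarrow> real"
  where "mu_norm W = (INF P\<in>{P. measurable_partition P}. sqrt (partition_sum P W))"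

text \<open>
  The distribution with Fourier coefficients \<open>w\<close> is represented by \<open>w\<close> itself. The limit exists
  because the suprema decrease in \<open>N\<close>.
\<close>

definition rho :: "(int \<Rightarrow> complex) \<Rightarrow> ennreal"
  where "rho w =
    lim (\<lambda>N. SUP I\<in>{I. (\<exists>n m. n \<le> m \<and> I = {n..m}) \<and> N \<le> card I}.
      ennreal (1 / real (card I) * (\<Sum>l\<in>I. (cmod (w l))\<^sup>2)))"

definition L_coeff :: "(int \<Rightarrow> int \<Rightarrow> complex) \<Rightarrow> real \<Rightarrow> int \<Rightarrow> complex"
  where "L_coeff A a l = (\<Sum>\<^sub>\<infinity>j. A l j * cis (of_int (l - j) * a))"

end

(*
  With K the sum of the c_k and S_k multiplication by e^{ikx}, Cauchy-Schwarz gives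
    sum_l |(Wg)_l - w_l(a) g_l|^2 <= K sum_k c_k ||(S_k - e^{ika}) g||^2,
  so on functions concentrated near a the operator W acts as the Fourier multiplier w(a).

  Upper bound: if g lives on an arc of length d around a, its coefficients hardly change in modulus
  under N shifts (N d small), so |w_l(a)|^2 may be replaced by its means over blocks of length N.
  Hence ||W pi_Y||^2 is at most about the supremum of the block means; integrate over a, let the
  partition into arcs become finer, then N tend to infinity.

  Lower bound: for the normalised sum F of e^{il(x-a)} over l in a block I of length N,
  ||WF||^2 is about the mean of |w_l(a)|^2 over I, and |F|^2 is the Fejer kernel centred at a.
  So the block means at a are at most about ||W pi_Y||^2 + const ||pi_{Y^c} F||^2, and the integral
  of the last term over a in Y tends to 0 for every measurable Y.  Every long interval is nearly a
  union of blocks, so rho is at most the supremum of the block means.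
*)
theory Submission
  imports Defs
begin

section \<open>The Hilbert space on the circle\<close>

text \<open>Everything rests on the identity (Wg)_l - w_l(a) g_l = sum_k W_{l,l-k} ((S_k - e^{ika})
  g)_l, which sorts the matrix by diagonals. Only the sum of the c_k is known to be finite, so no
  rate in k is available: (S_k - e^{ika}) g is small for each fixed k and bounded for all k, and the
  errors vanish by dominated convergence with the weights c_k. In the lower bound a measurable Y
  need not contain an arc, so the trial functions cannot be supported in Y. The way out is that the
  functions F of two blocks of the same length differ by a factor of modulus one: the mass of F
  outside Y depends on N and a only, and the supremum over blocks can be taken at fixed a before
  integrating over Y. The integral over a \<in> Y of the mass inside Y is the mean over i, j < N of
  |b_{i-j}|^2, with b the Fourier coefficients of the indicator of Y, and tends to mu(Y) by
  Parseval. Sums are squared with weights 1 + \<eta> and 1 + 1/\<eta>, so that main terms keep a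
  factor close to one; \<eta> tends to 0 only after the errors have vanished.\<close>

lemma space_circle [simp]: "space circle = {0..<2 * pi}"
  by (simp add: circle_def)

lemma sets_circle: "sets circle = sets (lebesgue_on {0..<2 * pi})"
  by (simp add: circle_def)

interpretation circle: finite_measure circle
  by (rule finite_measure_circle)

lemma measure_circle_space: "measure circle {0..<2 * pi} = 1"
  using emeasure_circle_space by (simp add: measure_def)

lemma borel_measurable_circleI:
  "f \<in> borel_measurable borel \<Longrightarrow> f \<in> borel_measurable circle"
  by (simp add: circle_def measurable_restrict_space1 measurable_completion)

text \<open>The theorem integrates against \<open>lborel\<close>, while \<open>circle\<close> lives
  on the completed sigma-algebra; on Borel integrands the two integrals agree up to
  normalisation.\<close>

lemma nn_integral_circle:
  assumes "f \<in> borel_measurable borel"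
  shows "(\<integral>\<^sup>+x. f x \<partial>circle) = ennreal (1 / (2 * pi)) * (\<integral>\<^sup>+x\<in>{0..<2 * pi}. f x \<partial>lborel)"
proof -
  have [measurable]: "f \<in> borel_measurable (lebesgue_on {0..<2*pi})"
    using assms by (simp add: measurable_restrict_space1 measurable_completion)
  have "(\<integral>\<^sup>+x. f x \<partial>circle) = (\<integral>\<^sup>+x. ennreal (1 / (2 * pi)) * f x \<partial>lebesgue_on {0..<2*pi})"
    unfolding circle_def by (subst nn_integral_density) auto
  also have "\<dots> = ennreal (1 / (2 * pi)) * (\<integral>\<^sup>+x. f x \<partial>lebesgue_on {0..<2*pi})"
    by (rule nn_integral_cmult) simp
  also have "(\<integral>\<^sup>+x. f x \<partial>lebesgue_on {0..<2*pi}) = (\<integral>\<^sup>+x\<in>{0..<2 * pi}. f x \<partial>lebesgue)"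
    by (subst nn_integral_restrict_space) auto
  also have "\<dots> = (\<integral>\<^sup>+x\<in>{0..<2 * pi}. f x \<partial>lborel)"
    using assms by (intro nn_integral_completion)
  finally show ?thesis .
qed

lemma square_integrable_diff:
  "square_integrable f \<Longrightarrow> square_integrable g \<Longrightarrow> square_integrable (\<lambda>x. f x - g x)"
  using square_integrable_add[of f "\<lambda>x. (-1) * g x"] square_integrable_cmult[of g "-1"] by simp

text \<open>The quotient is by a partial equivalence, so \<open>abs_l2\<close> is meaningful only on
  square integrable functions. Norms and identities in \<open>l2\<close> are computed on a
  representative obtained here.\<close>

lemma l2_exhaust:
  obtains g where "square_integrable g" "f = abs_l2 g"
proof -
  have "l2_rel (rep_l2 f) (rep_l2 f)" "abs_l2 (rep_l2 f) = f"
    by (rule Quotient3_rep_reflp[OF Quotient3_l2] Quotient3_abs_rep[OF Quotient3_l2])+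
  then show thesis using that by (auto simp: l2_rel_def)
qed

lemma l2_rel_refl: "square_integrable f \<Longrightarrow> l2_rel f f"
  by (simp add: l2_rel_def)

lemma inner_abs_l2:
  "square_integrable f \<Longrightarrow> square_integrable g \<Longrightarrow> abs_l2 f \<bullet> abs_l2 g = (\<integral>x. f x \<bullet> g x \<partial>circle)"
  by (rule inner_l2.abs_eq) (auto intro: l2_rel_refl)

lemma norm_abs_l2:
  "square_integrable f \<Longrightarrow> (norm (abs_l2 f))\<^sup>2 = (\<integral>x. (cmod (f x))\<^sup>2 \<partial>circle)"
  by (simp add: power2_norm_eq_inner inner_abs_l2)

lemma abs_l2_add:
  "square_integrable f \<Longrightarrow> square_integrable g \<Longrightarrow> abs_l2 f + abs_l2 g = abs_l2 (\<lambda>x. f x + g x)"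
  by (rule plus_l2.abs_eq) (auto intro: l2_rel_refl)

lemma abs_l2_cscale:
  "square_integrable f \<Longrightarrow> c *\<^sub>c abs_l2 f = abs_l2 (\<lambda>x. c * f x)"
  by (rule cscale.abs_eq) (auto intro: l2_rel_refl)

lemma abs_l2_zero: "abs_l2 (\<lambda>x. 0) = 0"
  by (simp add: zero_l2_def)

lemma abs_l2_diff:
  "square_integrable f \<Longrightarrow> square_integrable g \<Longrightarrow> abs_l2 f - abs_l2 g = abs_l2 (\<lambda>x. f x - g x)"
  using abs_l2_add[of "\<lambda>x. f x - g x" g] by (simp add: square_integrable_diff algebra_simps)

lemma fourier_basis_abs: "fourier_basis k = abs_l2 (\<lambda>x. cis (of_int k * x))"
  by (simp add: fourier_basis_def)

section \<open>Complex scalars on a real inner product space\<close>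

lemma cscale_add_right: "c *\<^sub>c (f + g) = c *\<^sub>c f + c *\<^sub>c g"
  by transfer (auto simp: l2_rel_def algebra_simps intro!: square_integrable_cmult square_integrable_add)

lemma cscale_add_left: "(c + d) *\<^sub>c f = c *\<^sub>c f + d *\<^sub>c f"
  by transfer (auto simp: l2_rel_def algebra_simps intro!: square_integrable_cmult square_integrable_add)

lemma cscale_cscale: "c *\<^sub>c d *\<^sub>c f = (c * d) *\<^sub>c f"
  by transfer (auto simp: l2_rel_def mult.assoc intro!: square_integrable_cmult)

lemma cscale_of_real: "of_real r *\<^sub>c f = r *\<^sub>R f"
  by transfer (auto simp: l2_rel_def scaleR_conv_of_real intro!: square_integrable_cmult)

lemma inner_mult_left_complex:
  fixes c z w :: complex shows "(c * z) \<bullet> (c * w) = (cmod c)\<^sup>2 * (z \<bullet> w)"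
  unfolding cmod_power2 inner_complex_def by (simp add: power2_eq_square algebra_simps)

lemma inner_cscale: "(c *\<^sub>c f) \<bullet> (c *\<^sub>c g) = (cmod c)\<^sup>2 * (f \<bullet> g)"
  by transfer (simp add: inner_mult_left_complex)

lemma norm_cscale: "norm (c *\<^sub>c f) = cmod c * norm f"
  by (simp add: norm_eq_sqrt_inner inner_cscale real_sqrt_mult)

lemma cscale_one [simp]: "1 *\<^sub>c f = f"
  using cscale_of_real[of 1 f] by simp

lemma cscale_zero_left [simp]: "0 *\<^sub>c f = 0"
  using cscale_of_real[of 0 f] by simp

lemma cscale_minus_left: "(- c) *\<^sub>c f = - (c *\<^sub>c f)"
  using cscale_add_left[of c "-c" f] by (simp add: eq_neg_iff_add_eq_0 add.commute)

lemma bounded_linear_cscale: "bounded_linear (\<lambda>f. c *\<^sub>c f)"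
proof (rule bounded_linear_intro[where K = "cmod c"])
  show "c *\<^sub>c r *\<^sub>R f = r *\<^sub>R c *\<^sub>c f" for r f
    by (simp add: cscale_cscale mult.commute flip: cscale_of_real)
qed (simp_all add: cscale_add_right norm_cscale mult.commute)

section \<open>Orthonormality of the exponentials and Fourier coefficients\<close>

lemma integrable_circle_cis: "integrable circle (\<lambda>x. cis (of_int k * x))"
  by (rule circle.integrable_const_bound[where B = 1])
     (use square_integrable_cis in \<open>auto simp: square_integrable_def\<close>)

lemma integral_circle_cis: "(\<integral>x. cis (of_int k * x) \<partial>circle) = (if k = 0 then 1 else 0)"
proof (cases "k = 0")
  case True
  then show ?thesis using measure_circle_space by simp
next
  case False
  have hi: "((\<lambda>x. cis (of_int k * x)) has_integral (cis (of_int k * (2 * pi)) / (\<i> * of_int k) - cis (of_int k * 0) / (\<i> * of_int k))) {0..2*pi}"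
  proof (rule fundamental_theorem_of_calculus)
    show "((\<lambda>x. cis (of_int k * x) / (\<i> * of_int k)) has_vector_derivative cis (of_int k * x)) (at x within {0..2 * pi})" for x
    proof -
      have "((\<lambda>z. exp (\<i> * of_int k * z) / (\<i> * of_int k)) has_field_derivative exp (\<i> * of_int k * of_real x)) (at (of_real x))"
        using False by (auto intro!: derivative_eq_intros)
      from has_vector_derivative_real_field[OF this] show ?thesis
        by (simp add: cis_conv_exp mult.assoc)
    qed
  qed simp
  have eq: "cis (of_int k * (2 * pi)) = 1"
    using cis_multiple_2pi[of "of_int k"] by (simp add: mult.commute mult.left_commute)
  have m: "(\<lambda>x::real. cis (of_int k * x)) \<in> borel_measurable borel"
    by (intro borel_measurable_continuous_onI continuous_intros)
  have ai: "set_integrable lebesgue {0..2*pi} (\<lambda>x. cis (of_int k * x))"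
    by (rule absolutely_integrable_continuous_real) (intro continuous_intros)
  have "set_integrable lebesgue {0..<2*pi} (\<lambda>x. cis (of_int k * x))"
    by (rule set_integrable_subset[OF ai]) auto
  then have il: "integrable (lebesgue_on {0..<2*pi}) (\<lambda>x. cis (of_int k * x))"
    unfolding set_integrable_def by (subst integrable_restrict_space) auto
  have "(\<integral>x. cis (of_int k * x) \<partial>circle) = (\<integral>x. (1/(2*pi)) *\<^sub>R cis (of_int k * x) \<partial>lebesgue_on {0..<2*pi})"
    unfolding circle_def
    by (rule integral_density) (use m in \<open>auto simp: measurable_restrict_space1 measurable_completion\<close>)
  also have "\<dots> = (1/(2*pi)) *\<^sub>R (\<integral>x. cis (of_int k * x) \<partial>lebesgue_on {0..<2*pi})"
    by simp
  also have "(\<integral>x. cis (of_int k * x) \<partial>lebesgue_on {0..<2*pi}) = integral {0..<2*pi} (\<lambda>x. cis (of_int k * x))"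
    by (rule lebesgue_integral_eq_integral[OF il]) simp
  also have "\<dots> = integral {0..2*pi} (\<lambda>x. cis (of_int k * x))"
    by (rule integral_spike_set; rule negligible_subset[OF negligible_sing[of "2 * pi"]]) auto
  also have "\<dots> = 0" using integral_unique[OF hi] eq by simp
  finally show ?thesis using False by simp
qed

lemma inner_cis_eq_Re: "(c * cis a) \<bullet> (d * cis b) = Re (c * cnj d * cis (a - b))"
  by (simp add: inner_complex_def cos_diff sin_diff algebra_simps)

lemma inner_fourier_basis:
  "(c *\<^sub>c fourier_basis j) \<bullet> (d *\<^sub>c fourier_basis k) = (if j = k then Re (c * cnj d) else 0)"
proof -
  have "(c *\<^sub>c fourier_basis j) \<bullet> (d *\<^sub>c fourier_basis k)
     = (\<integral>x. (c * cis (of_int j * x)) \<bullet> (d * cis (of_int k * x)) \<partial>circle)"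
    by (simp add: fourier_basis_abs abs_l2_cscale inner_abs_l2 square_integrable_cmult square_integrable_cis)
  also have "\<dots> = (\<integral>x. Re (c * cnj d * cis (of_int (j-k) * x)) \<partial>circle)"
    by (simp only: inner_cis_eq_Re) (simp add: algebra_simps)
  also have "\<dots> = Re (\<integral>x. (c * cnj d * cis (of_int (j-k) * x)) \<partial>circle)"
    by (rule integral_Re) (intro integrable_mult_right integrable_circle_cis)
  also have "(\<integral>x. (c * cnj d * cis (of_int (j-k) * x)) \<partial>circle) = c * cnj d * (\<integral>x. cis (of_int (j-k) * x) \<partial>circle)"
    by (rule integral_mult_right_zero)
  finally show ?thesis by (simp only: integral_circle_cis) simp
qed

text \<open>The instance provides only the real part of the Hermitian product. Its imaginary part is
  recovered by pairing with \<i> times the basis vector, because Re <f, ie> = Im <f, e>.\<close>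

definition fourier_coeff :: "l2 \<Rightarrow> int \<Rightarrow> complex"
  where "fourier_coeff f k = Complex (f \<bullet> fourier_basis k) (f \<bullet> (\<i> *\<^sub>c fourier_basis k))"

lemma cscale_Complex: "c *\<^sub>c f = Re c *\<^sub>R f + Im c *\<^sub>R (\<i> *\<^sub>c f)"
  using cscale_add_left[of "of_real (Re c)" "of_real (Im c) * \<i>" f]
  by (simp add: cscale_cscale mult.commute flip: cscale_of_real complex_eq)

lemma inner_cscale_fourier_basis:
  "f \<bullet> (c *\<^sub>c fourier_basis k) = Re (cnj c * fourier_coeff f k)"
  by (subst cscale_Complex) (simp add: inner_add_right fourier_coeff_def)

lemma fourier_coeff_basis:
  "fourier_coeff (c *\<^sub>c fourier_basis j) k = (if j = k then c else 0)"
  using inner_fourier_basis[of c j 1 k] inner_fourier_basis[of c j \<i> k]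
  by (simp add: fourier_coeff_def complex_eq_iff)

lemma fourier_coeff_add: "fourier_coeff (f + g) k = fourier_coeff f k + fourier_coeff g k"
  by (simp add: fourier_coeff_def inner_add_left complex_eq_iff)

lemma fourier_coeff_diff: "fourier_coeff (f - g) k = fourier_coeff f k - fourier_coeff g k"
  by (simp add: fourier_coeff_def inner_diff_left complex_eq_iff)

lemma fourier_coeff_zero [simp]: "fourier_coeff 0 k = 0"
  by (simp add: fourier_coeff_def complex_eq_iff)

lemma fourier_coeff_sum: "fourier_coeff (sum f G) k = (\<Sum>i\<in>G. fourier_coeff (f i) k)"
  by (induction G rule: infinite_finite_induct) (auto simp: fourier_coeff_add)

lemma fourier_coeff_scaleR: "fourier_coeff (r *\<^sub>R f) k = r *\<^sub>R fourier_coeff f k"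
  by (simp add: fourier_coeff_def complex_eq_iff)

text \<open>Multiplication by \<i> is an isometry with square -1, hence skew for the real inner
  product; this gives the case c = \<i>, and real linearity the rest.\<close>

lemma fourier_coeff_cscale: "fourier_coeff (c *\<^sub>c f) k = c * fourier_coeff f k"
proof -
  have *: "(\<i> *\<^sub>c f) \<bullet> (\<i> *\<^sub>c g) = f \<bullet> g" for f g
    by (simp add: inner_cscale)
  have "(\<i> *\<^sub>c f) \<bullet> g = - (f \<bullet> (\<i> *\<^sub>c g))" for f g
    using *[of f "\<i> *\<^sub>c g"] by (simp add: cscale_cscale cscale_minus_left)
  then have "fourier_coeff (\<i> *\<^sub>c f) k = \<i> * fourier_coeff f k"
    using * by (simp add: fourier_coeff_def complex_eq_iff)
  then show ?thesis
    by (subst cscale_Complex) (simp add: fourier_coeff_add fourier_coeff_scaleR complex_eq_iff)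
qed

lemma bounded_linear_fourier_coeff: "bounded_linear (\<lambda>f. fourier_coeff f k)"
proof (rule bounded_linear_intro[where K = 2])
  fix f
  have n: "norm (fourier_basis k) = 1"
    using inner_fourier_basis[of 1 k 1 k] by (simp add: norm_eq_sqrt_inner)
  have "norm (fourier_coeff f k) \<le> \<bar>f \<bullet> fourier_basis k\<bar> + \<bar>f \<bullet> (\<i> *\<^sub>c fourier_basis k)\<bar>"
    using cmod_le[of "fourier_coeff f k"] by (simp add: fourier_coeff_def)
  also have "\<dots> \<le> norm f * norm (fourier_basis k) + norm f * norm (\<i> *\<^sub>c fourier_basis k)"
    by (intro add_mono Cauchy_Schwarz_ineq2)
  finally show "norm (fourier_coeff f k) \<le> norm f * 2"
    by (simp add: norm_cscale n)
qed (simp_all add: fourier_coeff_add fourier_coeff_scaleR)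

section \<open>Density of trigonometric polynomials\<close>

text \<open>A predicate on functions and not on classes in \<open>l2\<close>, because the
  Stone-Weierstrass argument needs pointwise products.\<close>

inductive trig_poly :: "(real \<Rightarrow> complex) \<Rightarrow> bool" where
  basis: "trig_poly (\<lambda>x. c * cis (of_int k * x))"
| add: "trig_poly f \<Longrightarrow> trig_poly g \<Longrightarrow> trig_poly (\<lambda>x. f x + g x)"

lemma trig_poly_mult:
  assumes "trig_poly f" "trig_poly g"
  shows "trig_poly (\<lambda>x. f x * g x)"
  using assms
proof (induction f)
  case (basis c k)
  from basis show ?case
  proof (induction g)
    case (basis d j)
    have "(\<lambda>x. c * cis (of_int k * x) * (d * cis (of_int j * x))) = (\<lambda>x. (c * d) * cis (of_int (k + j) * x))"
      by (simp add: cis_mult algebra_simps)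
    then show ?case using trig_poly.basis[of "c * d" "k + j"] by simp
  next
    case (add f g)
    then show ?case unfolding distrib_left by (intro trig_poly.add)
  qed
next
  case (add f g)
  then show ?case unfolding distrib_right by (intro trig_poly.add)
qed

text \<open>\<open>span\<close> is the real span; all complex multiples of the basis vectors are
  generators, which makes the set stable under complex scalars.\<close>

definition trig_span :: "l2 set"
  where "trig_span = span (range (\<lambda>(c, k). c *\<^sub>c fourier_basis k))"

lemma trig_poly_in_trig_span:
  assumes "trig_poly f"
  shows "square_integrable f \<and> abs_l2 f \<in> trig_span"
  using assms
proof induction
  case (basis c k)
  have "c *\<^sub>c fourier_basis k \<in> trig_span"
    unfolding trig_span_def by (rule span_base) auto
  then show ?case
    by (simp add: fourier_basis_abs abs_l2_cscale square_integrable_cis square_integrable_cmult)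
next
  case (add f g)
  then show ?case
    using square_integrable_add[of f g] abs_l2_add[of f g] span_add[of "abs_l2 f" _ "abs_l2 g"]
    unfolding trig_span_def by metis
qed

text \<open>On the unit circle a real polynomial in the two coordinates is a polynomial in cos and
  sin. Only the linear case is a computation: p(e^{ix}) = p(1) cos x + p(\<i>) sin x, with cos and
  sin written through e^{ix} and e^{-ix}.\<close>

lemma trig_poly_real_polynomial_function:
  fixes p :: "complex \<Rightarrow> real"
  assumes "real_polynomial_function p"
  shows "trig_poly (\<lambda>x. of_real (p (cis x)))"
  using assms
proof induction
  case (linear p)
  interpret bounded_linear p by fact
  have "of_real (p (cis x)) = (of_real (p 1) / 2 - \<i> * of_real (p \<i>) / 2) * cis (of_int 1 * x)
     + (of_real (p 1) / 2 + \<i> * of_real (p \<i>) / 2) * cis (of_int (-1) * x)" for x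
  proof -
    have "cis x = cos x *\<^sub>R 1 + sin x *\<^sub>R \<i>" by (simp add: complex_eq_iff)
    then have "p (cis x) = cos x * p 1 + sin x * p \<i>"
      by (simp add: add scaleR)
    then show ?thesis by (simp add: complex_eq_iff algebra_simps)
  qed
  then have *: "(\<lambda>x. of_real (p (cis x))) = (\<lambda>x. (of_real (p 1) / 2 - \<i> * of_real (p \<i>) / 2) * cis (of_int 1 * x)
     + (of_real (p 1) / 2 + \<i> * of_real (p \<i>) / 2) * cis (of_int (-1) * x))" by blast
  show ?case unfolding * by (intro trig_poly.intros)
next
  case (const c)
  show ?case using trig_poly.basis[of "of_real c" 0] by simp
next
  case (add f g)
  then show ?case unfolding of_real_add by (intro trig_poly.add)
next
  case (mult f g)
  then show ?case unfolding of_real_mult by (intro trig_poly_mult)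
qed

lemma emeasure_circle:
  assumes "X \<in> sets lebesgue" "X \<subseteq> {0..<2 * pi}"
  shows "emeasure circle X = ennreal (1 / (2 * pi)) * emeasure lebesgue X"
proof -
  have "X \<in> sets (lebesgue_on {0..<2 * pi})"
    using assms by (auto simp: sets_restrict_space_iff)
  then show ?thesis
    using assms by (simp add: circle_def emeasure_density_const emeasure_restrict_space)
qed

lemma sets_circle_iff: "X \<in> sets circle \<longleftrightarrow> X \<in> sets lebesgue \<and> X \<subseteq> {0..<2 * pi}"
  by (auto simp: sets_circle sets_restrict_space_iff)

text \<open>Only \<open>s\<close> is kept off the end points, so that \<open>t\<close> may be 0 or
  2\<pi>, two points with the same image.\<close>

lemma cis_eq_cis_imp_eq:
  assumes "cis s = cis t" "0 < s" "s < 2 * pi" "0 \<le> t" "t \<le> 2 * pi"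
  shows "s = t"
proof -
  from assms(1) have "sin s = sin t \<and> cos s = cos t"
    by (simp add: complex_eq_iff)
  then obtain n :: int where n: "s = t + 2 * pi * n"
    using sin_cos_eq_iff by blast
  then have "\<bar>2 * pi * n\<bar> < 2 * pi" using assms by linarith
  then have "\<bar>real_of_int n\<bar> < 1" by (simp add: abs_mult)
  then have "n = 0" by linarith
  then show ?thesis using n by simp
qed

text \<open>Regularity of Lebesgue measure, Urysohn and Stone-Weierstrass. The last two are applied
  on the unit circle in the plane and not on the interval: the approximants must be periodic, so the
  sets to be separated must have disjoint images under \<open>cis\<close>.\<close>

lemma indicator_trig_poly_approx:
  assumes X: "X \<in> sets circle" and e: "e > 0"
  obtains p where "trig_poly p" "(\<integral>x. (cmod (of_real (indicator X x) - p x))\<^sup>2 \<partial>circle) < e"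
proof -
  \<comment> \<open>The final bound is 2 mu(N) + 2d with mu(N) \<le> 2d, hence at most 6d < e; d
    \<le> 1 is used for d^2 \<le> d.\<close>
  define d where "d = min 1 (e / 8)"
  have d: "0 < d" "d \<le> 1" "d \<le> e / 8" using e by (auto simp: d_def)
  \<comment> \<open>Removing the null set {0} puts X' inside the open interval, where
    \<open>cis\<close> is injective even against the end points.\<close>
  define X' where "X' = X - {0}"
  have X': "X' \<in> sets lebesgue" "X' \<subseteq> {0<..<2*pi}"
    using X by (auto simp: X'_def sets_circle_iff order_less_le)
  obtain T where T: "closed T" "T \<subseteq> X'" "X' - T \<in> lmeasurable" "emeasure lebesgue (X' - T) < ennreal d"
    using sets_lebesgue_inner_closed[OF X'(1) d(1)] by blast
  obtain U where U: "open U" "X' \<subseteq> U" "U - X' \<in> lmeasurable" "emeasure lebesgue (U - X') < ennreal d"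
    using sets_lebesgue_outer_open[OF X'(1) d(1)] by blast
  have Tm: "T \<in> sets lebesgue" and Um: "U \<in> sets lebesgue"
    using T(1) U(1) by (auto simp: borel_closed borel_open sets_completionI_sets)
  have "T \<subseteq> {0..2*pi}" using T(2) X'(2) by force
  then have cT: "compact T"
    using compact_Int_closed[OF compact_Icc T(1), of 0 "2 * pi"] by (simp add: inf.absorb2)
  \<comment> \<open>Both end points belong to V. So V is compact, and its image is disjoint from
    that of T, although 0 and 2\<pi> are glued together.\<close>
  define V where "V = {0..2*pi} - (U \<inter> {0<..<2*pi})"
  have cV: "compact V" unfolding V_def using U(1) by (intro compact_diff) auto
  have clo: "closed (cis ` V)" "closed (cis ` T)"
    by (intro compact_imp_closed compact_continuous_image cV cT continuous_intros)+
  have "cis ` V \<inter> cis ` T = {}"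
  proof (rule ccontr)
    assume "cis ` V \<inter> cis ` T \<noteq> {}"
    then obtain v t where vt: "v \<in> V" "t \<in> T" "cis t = cis v" by force
    have "t = v" using cis_eq_cis_imp_eq[OF vt(3)] vt T(2) X'(2) unfolding V_def by force
    then show False using vt T(2) X'(2) U(2) unfolding V_def by auto
  qed
  then obtain h :: "complex \<Rightarrow> real" where h: "continuous_on UNIV h" "\<And>z. h z \<in> closed_segment 0 1"
     "\<And>z. z \<in> cis ` V \<Longrightarrow> h z = 0" "\<And>z. z \<in> cis ` T \<Longrightarrow> h z = 1"
    using Urysohn[OF clo, of 0 1] by blast
  obtain g where g: "real_polynomial_function g" "\<And>z. z \<in> sphere 0 1 \<Longrightarrow> \<bar>h z - g z\<bar> < d"
    using Stone_Weierstrass_real_polynomial_function[OF compact_sphere continuous_on_subset[OF h(1)] d(1)]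
    by blast
  define p :: "real \<Rightarrow> complex" where "p x = of_real (g (cis x))" for x
  have p: "trig_poly p" unfolding p_def by (rule trig_poly_real_polynomial_function[OF g(1)])
  \<comment> \<open>Outside N, and away from the point 0, the Urysohn function agrees with the
    indicator of X: it is 1 on T and 0 off U.\<close>
  define N where "N = (U - T) \<inter> {0..<2*pi}"
  have Nm: "N \<in> sets lebesgue" unfolding N_def using Tm Um by auto
  then have Nc: "N \<in> sets circle" by (auto simp: sets_circle_iff N_def)
  have "emeasure circle N \<le> emeasure lebesgue N"
  proof -
    have "ennreal (1 / (2 * pi)) \<le> 1" using pi_gt3 by (simp add: ennreal_le_1)
    then have "ennreal (1 / (2 * pi)) * emeasure lebesgue N \<le> 1 * emeasure lebesgue N"
      by (rule mult_right_mono) simp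
    then show ?thesis using Nm by (subst emeasure_circle) (auto simp: N_def)
  qed
  also have "\<dots> \<le> emeasure lebesgue ((X' - T) \<union> (U - X'))"
    by (rule emeasure_mono) (use T U in \<open>auto simp: N_def fmeasurableD\<close>)
  also have "\<dots> \<le> emeasure lebesgue (X' - T) + emeasure lebesgue (U - X')"
    using T(3) U(3) by (intro emeasure_subadditive) auto
  also have "\<dots> \<le> ennreal d + ennreal d"
    using T(4) U(4) by (intro add_mono) auto
  also have "\<dots> = ennreal (2 * d)" using d by (simp flip: ennreal_plus)
  finally have mN: "measure circle N \<le> 2 * d"
    using d by (simp add: circle.emeasure_eq_measure)
  have bound: "(cmod (of_real (indicator X x) - p x))\<^sup>2 \<le> 2 * indicator N x + 2 * d"
    if "x \<in> space circle" "x \<noteq> 0" for x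
  proof -
    have "cmod (of_real (indicator X x) - p x) = \<bar>(indicator X x - h (cis x)) + (h (cis x) - g (cis x))\<bar>"
      unfolding p_def by (simp flip: of_real_diff)
    then have "(cmod (of_real (indicator X x) - p x))\<^sup>2 \<le> 2 * (indicator X x - h (cis x))\<^sup>2 + 2 * (h (cis x) - g (cis x))\<^sup>2"
      using sum_squares_bound[of "indicator X x - h (cis x)" "h (cis x) - g (cis x)"]
      by (simp only: power2_abs power2_sum)
    moreover have "(h (cis x) - g (cis x))\<^sup>2 \<le> d"
    proof -
      have "\<bar>h (cis x) - g (cis x)\<bar> < d" using g(2) by simp
      then have "\<bar>h (cis x) - g (cis x)\<bar>\<^sup>2 \<le> d\<^sup>2" by (intro power_mono) auto
      also have "d\<^sup>2 \<le> d" using d by (simp add: power2_eq_square mult_left_le)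
      finally show ?thesis by simp
    qed
    moreover have "(indicator X x - h (cis x))\<^sup>2 \<le> indicator N x"
    proof -
      have h01: "0 \<le> h (cis x)" "h (cis x) \<le> 1"
        using h(2)[of "cis x"] by (auto simp: closed_segment_eq_real_ivl)
      then have le1: "(indicator X x - h (cis x))\<^sup>2 \<le> 1"
        by (auto simp: indicator_def abs_square_le_1)
      consider "x \<in> T" | "x \<notin> U" | "x \<in> N" using \<open>x \<in> space circle\<close> unfolding N_def space_circle by blast
      then show ?thesis
      proof cases
        case 1
        then have "x \<in> X" "h (cis x) = 1" using T(2) h(4) by (auto simp: X'_def)
        then show ?thesis by simp
      next
        case 2
        then have "x \<notin> X" using U(2) that by (auto simp: X'_def)
        moreover have "h (cis x) = 0" using h(3) that 2 by (auto simp: V_def)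
        ultimately show ?thesis by simp
      next
        case 3
        then show ?thesis using le1 by simp
      qed
    qed
    ultimately show ?thesis by linarith
  qed
  have ae: "AE x in circle. (cmod (of_real (indicator X x) - p x))\<^sup>2 \<le> 2 * indicator N x + 2 * d"
  proof (rule AE_I')
    show "{0} \<in> null_sets circle"
      by (rule null_setsI) (auto simp: emeasure_circle sets_circle_iff)
  qed (use bound in auto)
  have sq: "square_integrable (\<lambda>x. of_real (indicator X x) - p x)"
    by (intro square_integrable_diff square_integrable_bounded[where B=1] conjunct1[OF trig_poly_in_trig_span[OF p]])
       (use X in \<open>auto simp: indicator_def\<close>)
  have NI: "N \<inter> {0..<2 * pi} = N" by (auto simp: N_def)
  have iN: "integrable circle (\<lambda>x. indicator N x :: real)"
    using Nc NI by (simp add: integrable_indicator_iff circle.emeasure_finite less_top[symmetric])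
  have "(\<integral>x. (cmod (of_real (indicator X x) - p x))\<^sup>2 \<partial>circle) \<le> (\<integral>x. 2 * indicator N x + 2 * d \<partial>circle)"
    using sq iN ae by (intro integral_mono_AE) (auto simp: square_integrable_def)
  also have "\<dots> = 2 * measure circle N + 2 * d"
    using Nc NI iN measure_circle_space by simp
  also have "\<dots> < e" using mN d e by linarith
  finally show thesis using p that by blast
qed

lemma abs_l2_eqI:
  assumes "square_integrable f" "square_integrable g" "AE x in circle. f x = g x"
  shows "abs_l2 f = abs_l2 g"
  using Quotient3_rel_abs[OF Quotient3_l2] assms by (simp add: l2_rel_def)

lemma subspace_trig_closure: "subspace (closure trig_span)"
proof (rule subspaceI)
  have s: "subspace trig_span" unfolding trig_span_def by (rule subspace_span)
  show "0 \<in> closure trig_span" using subspace_0[OF s] closure_subset by blast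
  show "x + y \<in> closure trig_span" if xy: "x \<in> closure trig_span" "y \<in> closure trig_span" for x y
  proof -
    obtain u v where "\<forall>n. u n \<in> trig_span" "u \<longlonglongrightarrow> x" "\<forall>n. v n \<in> trig_span" "v \<longlonglongrightarrow> y"
      using xy unfolding closure_sequential by blast
    then show ?thesis unfolding closure_sequential
      by (intro exI[of _ "\<lambda>n. u n + v n"]) (auto intro!: tendsto_add subspace_add[OF s])
  qed
  show "c *\<^sub>R x \<in> closure trig_span" if x: "x \<in> closure trig_span" for c x
  proof -
    obtain u where "\<forall>n. u n \<in> trig_span" "u \<longlonglongrightarrow> x"
      using x unfolding closure_sequential by blast
    then show ?thesis unfolding closure_sequential
      by (intro exI[of _ "\<lambda>n. c *\<^sub>R u n"]) (auto intro!: tendsto_scaleR subspace_scale[OF s])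
  qed
qed

lemma cscale_trig_span:
  assumes "f \<in> trig_span" shows "c *\<^sub>c f \<in> trig_span"
proof -
  interpret bounded_linear "\<lambda>f. c *\<^sub>c f" by (rule bounded_linear_cscale)
  have "trig_span \<subseteq> {f. c *\<^sub>c f \<in> trig_span}"
    unfolding trig_span_def
  proof (rule span_minimal)
    show "range (\<lambda>(c, k). c *\<^sub>c fourier_basis k) \<subseteq> {f. c *\<^sub>c f \<in> span (range (\<lambda>(c, k). c *\<^sub>c fourier_basis k))}"
      by (auto simp: cscale_cscale intro!: span_base range_eqI[of _ _ "(c * _, _)"])
    show "subspace {f. c *\<^sub>c f \<in> span (range (\<lambda>(c, k). c *\<^sub>c fourier_basis k))}"
      by (auto simp: subspace_def zero add scaleR span_zero intro: span_add span_scale)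
  qed
  then show ?thesis using assms by auto
qed

lemma cscale_trig_closure:
  assumes "f \<in> closure trig_span" shows "c *\<^sub>c f \<in> closure trig_span"
proof -
  interpret bounded_linear "\<lambda>f. c *\<^sub>c f" by (rule bounded_linear_cscale)
  obtain u where "\<forall>n. u n \<in> trig_span" "u \<longlonglongrightarrow> f"
    using assms unfolding closure_sequential by blast
  then show ?thesis unfolding closure_sequential
    by (intro exI[of _ "\<lambda>n. c *\<^sub>c u n"]) (auto intro!: tendsto cscale_trig_span)
qed

lemma square_integrable_of_real_indicator:
  "X \<in> sets circle \<Longrightarrow> square_integrable (\<lambda>x. of_real (indicator X x))"
  by (rule square_integrable_bounded[where B=1]) (auto simp: indicator_def)

lemma indicator_in_trig_closure:
  assumes X: "X \<in> sets circle"
  shows "abs_l2 (\<lambda>x. of_real (indicator X x)) \<in> closure trig_span"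
  unfolding closure_approachable
proof safe
  fix e :: real assume e: "e > 0"
  obtain p where p: "trig_poly p" "(\<integral>x. (cmod (of_real (indicator X x) - p x))\<^sup>2 \<partial>circle) < e\<^sup>2"
    using indicator_trig_poly_approx[OF X, of "e\<^sup>2"] e by auto
  have p': "square_integrable p" "abs_l2 p \<in> trig_span"
    using trig_poly_in_trig_span[OF p(1)] by auto
  have "(norm (abs_l2 (\<lambda>x. of_real (indicator X x)) - abs_l2 p))\<^sup>2 < e\<^sup>2"
    using p' p X by (simp add: abs_l2_diff norm_abs_l2 square_integrable_diff square_integrable_of_real_indicator)
  then have "dist (abs_l2 p) (abs_l2 (\<lambda>x. of_real (indicator X x))) < e"
    using e by (simp add: dist_norm norm_minus_commute power2_less_imp_less)
  then show "\<exists>y\<in>trig_span. dist y (abs_l2 (\<lambda>x. complex_of_real (indicator X x))) < e"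
    using p' by auto
qed

lemma simple_function_in_trig_closure:
  assumes f: "simple_function circle f" and sq: "square_integrable f"
  shows "abs_l2 f \<in> closure trig_span"
proof -
  define S where "S y = f -` {y} \<inter> space circle" for y
  have S: "S y \<in> sets circle" for y
    unfolding S_def using f by (rule simple_functionD)
  have *: "square_integrable (\<lambda>x. \<Sum>y\<in>G. y * of_real (indicator (S y) x)) \<and>
      abs_l2 (\<lambda>x. \<Sum>y\<in>G. y * of_real (indicator (S y) x)) \<in> closure trig_span" if "finite G" for G
    using that
  proof induction
    case empty
    then show ?case using subspace_0[OF subspace_trig_closure]
      by (simp add: abs_l2_zero square_integrable_def)
  next
    case (insert y G)
    have "square_integrable (\<lambda>x. y * of_real (indicator (S y) x))"
      using S by (intro square_integrable_cmult square_integrable_of_real_indicator)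
    moreover have "abs_l2 (\<lambda>x. y * of_real (indicator (S y) x)) \<in> closure trig_span"
      using S indicator_in_trig_closure cscale_trig_closure
      by (metis abs_l2_cscale square_integrable_of_real_indicator)
    ultimately show ?case
      using insert subspace_add[OF subspace_trig_closure]
      by (auto simp: square_integrable_add simp flip: abs_l2_add)
  qed
  have fin: "finite (f ` space circle)" using f by (simp add: simple_function_def)
  have "f x = (\<Sum>y\<in>f ` space circle. y * of_real (indicator (S y) x))" if "x \<in> space circle" for x
  proof -
    have "(\<Sum>y\<in>f ` space circle. y * of_real (indicator (S y) x)) = (\<Sum>y\<in>f ` space circle. if y = f x then f x else 0)"
      using that by (intro sum.cong) (auto simp: S_def)
    also have "\<dots> = f x" using fin that by simp
    finally show ?thesis by simp
  qed
  then have "AE x in circle. f x = (\<Sum>y\<in>f ` space circle. y * of_real (indicator (S y) x))"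
    by (rule AE_I2)
  then have "abs_l2 f = abs_l2 (\<lambda>x. \<Sum>y\<in>f ` space circle. y * of_real (indicator (S y) x))"
    using sq conjunct1[OF *[OF fin]] by (intro abs_l2_eqI)
  then show ?thesis using *[OF fin] by simp
qed

text \<open>Simple functions converge pointwise to f and stay below 2|f|, so they converge in the
  norm by dominated convergence; each of them is a finite combination of indicators.\<close>

lemma closure_trig_span: "closure trig_span = UNIV"
proof -
  have "h \<in> closure trig_span" for h
  proof -
    obtain f where f: "square_integrable f" "h = abs_l2 f" by (rule l2_exhaust)
    then have fm: "f \<in> borel_measurable circle" and fi: "integrable circle (\<lambda>x. (cmod (f x))\<^sup>2)"
      by (auto simp: square_integrable_def)
    obtain F where F: "\<And>i. simple_function circle (F i)" "\<And>x. x \<in> space circle \<Longrightarrow> (\<lambda>i. F i x) \<longlonglongrightarrow> f x"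
        "\<And>i x. x \<in> space circle \<Longrightarrow> dist (F i x) 0 \<le> 2 * dist (f x) 0"
      using borel_measurable_implies_sequence_metric[OF fm, of 0] by blast
    have Fm: "F i \<in> borel_measurable circle" for i
      using F(1) by (rule borel_measurable_simple_function)
    have Fb: "cmod (F i x) \<le> 2 * cmod (f x)" if "x \<in> space circle" for i x
      using F(3)[OF that] by simp
    have Fs: "square_integrable (F i)" for i
      unfolding square_integrable_def
    proof (rule conjI[OF Fm Bochner_Integration.integrable_bound])
      show "integrable circle (\<lambda>x. 4 * (cmod (f x))\<^sup>2)" using fi by simp
      have "(cmod (F i x))\<^sup>2 \<le> 4 * (cmod (f x))\<^sup>2" if "x \<in> space circle" for x
        using power_mono[OF Fb[OF that, of i], of 2] by (simp add: power_mult_distrib)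
      then show "AE x in circle. norm ((cmod (F i x))\<^sup>2) \<le> norm (4 * (cmod (f x))\<^sup>2)" by (intro AE_I2) (simp del: space_circle)
    qed (use Fm in measurable)
    have "(\<lambda>i. \<integral>x. (cmod (F i x - f x))\<^sup>2 \<partial>circle) \<longlonglongrightarrow> (\<integral>x. 0 \<partial>circle)"
    \<comment> \<open>From |F_i - f| \<le> 2|f| + |f|, squared.\<close>
    proof (rule integral_dominated_convergence[where w = "\<lambda>x. 9 * (cmod (f x))\<^sup>2"])
      show "AE x in circle. (\<lambda>i. (cmod (F i x - f x))\<^sup>2) \<longlonglongrightarrow> 0"
      proof (rule AE_I2)
        fix x assume "x \<in> space circle"
        then have "(\<lambda>i. (cmod (F i x - f x))\<^sup>2) \<longlonglongrightarrow> (cmod (f x - f x))\<^sup>2"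
          by (intro tendsto_intros F(2))
        then show "(\<lambda>i. (cmod (F i x - f x))\<^sup>2) \<longlonglongrightarrow> 0" by simp
      qed
      show "AE x in circle. norm ((cmod (F i x - f x))\<^sup>2) \<le> 9 * (cmod (f x))\<^sup>2" for i
      proof (rule AE_I2)
        fix x assume x: "x \<in> space circle"
        have "cmod (F i x - f x) \<le> 3 * cmod (f x)"
          using norm_triangle_ineq4[of "F i x" "f x"] Fb[OF x, of i] by linarith
        from power_mono[OF this, of 2] show "norm ((cmod (F i x - f x))\<^sup>2) \<le> 9 * (cmod (f x))\<^sup>2"
          by (simp add: power_mult_distrib)
      qed
    qed (use fi fm Fm in \<open>auto\<close>)
    then have "(\<lambda>i. (norm (abs_l2 (F i) - h))\<^sup>2) \<longlonglongrightarrow> 0"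
      by (simp add: f abs_l2_diff Fs norm_abs_l2 square_integrable_diff)
    then have "(\<lambda>i. norm (abs_l2 (F i) - h)) \<longlonglongrightarrow> 0"
      using tendsto_real_sqrt by fastforce
    then have "(\<lambda>i. abs_l2 (F i)) \<longlonglongrightarrow> h"
      using LIM_zero_cancel tendsto_norm_zero_iff by blast
    then show ?thesis
      using closed_sequentially[OF closed_closure, of "\<lambda>i. abs_l2 (F i)" trig_span h]
        simple_function_in_trig_closure F(1) Fs by auto
  qed
  then show ?thesis by auto
qed

section \<open>Fourier series, modulation and restriction\<close>

definition fourier_sum :: "int set \<Rightarrow> l2 \<Rightarrow> l2"
  where "fourier_sum G f = (\<Sum>k\<in>G. fourier_coeff f k *\<^sub>c fourier_basis k)"

lemma fourier_sum_add: "fourier_sum G (f + g) = fourier_sum G f + fourier_sum G g"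
  by (simp add: fourier_sum_def fourier_coeff_add cscale_add_left sum.distrib)

lemma fourier_sum_scaleR: "fourier_sum G (r *\<^sub>R f) = r *\<^sub>R fourier_sum G f"
proof -
  have "(r *\<^sub>R z) *\<^sub>c h = r *\<^sub>R (z *\<^sub>c h)" for z h
    unfolding scaleR_conv_of_real cscale_cscale[symmetric] cscale_of_real ..
  then show ?thesis
    by (simp only: fourier_sum_def fourier_coeff_scaleR scaleR_sum_right)
qed

lemma fourier_sum_diff: "fourier_sum G (f - g) = fourier_sum G f - fourier_sum G g"
  using fourier_sum_add[of G "f - g" g] by simp

lemma fourier_coeff_fourier_sum:
  "finite G \<Longrightarrow> fourier_coeff (fourier_sum G f) k = (if k \<in> G then fourier_coeff f k else 0)"
  by (simp add: fourier_sum_def fourier_coeff_sum fourier_coeff_basis)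

lemma inner_fourier_sum: "g \<bullet> fourier_sum G f = (\<Sum>k\<in>G. Re (cnj (fourier_coeff f k) * fourier_coeff g k))"
  by (simp add: fourier_sum_def inner_sum_right inner_cscale_fourier_basis)

lemma Re_cnj_mult_self: "Re (cnj z * z) = (cmod z)\<^sup>2"
  by (simp only: cmod_power2) (simp add: power2_eq_square)

lemma norm_fourier_sum_sq:
  assumes "finite G"
  shows "(norm (fourier_sum G f))\<^sup>2 = (\<Sum>k\<in>G. (cmod (fourier_coeff f k))\<^sup>2)"
  unfolding power2_norm_eq_inner[of "fourier_sum G f"] inner_fourier_sum
  using assms by (intro sum.cong) (auto simp only: fourier_coeff_fourier_sum Re_cnj_mult_self if_True)

text \<open>Pythagoras: \<open>fourier_sum G f\<close> is the orthogonal projection of f, so the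
  complementary projection is a contraction.\<close>

lemma norm_diff_fourier_sum_le:
  assumes "finite G"
  shows "norm (f - fourier_sum G f) \<le> norm f"
proof -
  have "f \<bullet> fourier_sum G f = (norm (fourier_sum G f))\<^sup>2"
    unfolding inner_fourier_sum norm_fourier_sum_sq[OF assms] Re_cnj_mult_self ..
  then have "(norm (f - fourier_sum G f))\<^sup>2 = (norm f)\<^sup>2 - (norm (fourier_sum G f))\<^sup>2"
    by (simp add: power2_norm_eq_inner inner_diff_left inner_diff_right inner_commute)
  then have "(norm (f - fourier_sum G f))\<^sup>2 \<le> (norm f)\<^sup>2" by simp
  then show ?thesis by (rule power2_le_imp_le) simp
qed

lemma trig_span_fourier_sum:
  assumes "p \<in> trig_span"
  shows "\<exists>F. finite F \<and> (\<forall>G. finite G \<longrightarrow> F \<subseteq> G \<longrightarrow> fourier_sum G p = p)"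
proof -
  define P where "P = {p. \<exists>F. finite F \<and> (\<forall>G. finite G \<longrightarrow> F \<subseteq> G \<longrightarrow> fourier_sum G p = p)}"
  have "trig_span \<subseteq> P"
    unfolding trig_span_def
  proof (rule span_minimal)
    show "range (\<lambda>(c, k). c *\<^sub>c fourier_basis k) \<subseteq> P"
    proof safe
      fix c k
      have "fourier_sum G (c *\<^sub>c fourier_basis k) = c *\<^sub>c fourier_basis k" if "finite G" "{k} \<subseteq> G" for G
      proof -
        have "fourier_sum G (c *\<^sub>c fourier_basis k) = (\<Sum>j\<in>G. if j = k then c *\<^sub>c fourier_basis k else 0)"
          unfolding fourier_sum_def by (intro sum.cong) (auto simp: fourier_coeff_basis)
        then show ?thesis using that by simp
      qed
      then show "c *\<^sub>c fourier_basis k \<in> P" unfolding P_def by blast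
    qed
    show "subspace P"
    proof (rule subspaceI)
      show "0 \<in> P" unfolding P_def by (auto simp: fourier_sum_def)
      show "x + y \<in> P" if xy: "x \<in> P" "y \<in> P" for x y
      proof -
        obtain F F' where F: "finite F" "\<forall>G. finite G \<longrightarrow> F \<subseteq> G \<longrightarrow> fourier_sum G x = x"
          "finite F'" "\<forall>G. finite G \<longrightarrow> F' \<subseteq> G \<longrightarrow> fourier_sum G y = y" using xy unfolding P_def by blast
        then have "fourier_sum G (x + y) = x + y" if "finite G" "F \<union> F' \<subseteq> G" for G
          using that unfolding fourier_sum_add by (metis le_sup_iff)
        then show ?thesis unfolding P_def using F(1,3) finite_UnI by blast
      qed
      show "c *\<^sub>R x \<in> P" if "x \<in> P" for c x
        using that unfolding P_def mem_Collect_eq fourier_sum_scaleR by metis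
    qed
  qed
  then show ?thesis using assms unfolding P_def by blast
qed

text \<open>The map f - \<open>fourier_sum G f\<close> is a contraction that kills a trigonometric
  polynomial p once G contains its frequencies, so the error for f is at most the distance from f to
  p. This makes the premise of \<open>has_matrix\<close> available for every f.\<close>

lemma fourier_series_has_sum:
  "((\<lambda>k. fourier_coeff f k *\<^sub>c fourier_basis k) has_sum f) UNIV"
  unfolding has_sum_def
proof (rule tendstoI)
  fix e :: real assume "e > 0"
  then obtain p where p: "p \<in> trig_span" "dist p f < e"
    using closure_trig_span closure_approachable by blast
  obtain F where F: "finite F" "\<And>G. finite G \<Longrightarrow> F \<subseteq> G \<Longrightarrow> fourier_sum G p = p"
    using trig_span_fourier_sum[OF p(1)] by blast
  have "dist (fourier_sum G f) f < e" if "finite G" "F \<subseteq> G" for G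
  proof -
    have "(f - p) - fourier_sum G (f - p) = f - fourier_sum G f"
      using F(2)[OF that] by (simp add: fourier_sum_diff)
    then have "norm (f - fourier_sum G f) \<le> norm (f - p)"
      using norm_diff_fourier_sum_le[OF that(1), of "f - p"] by metis
    then show ?thesis using p(2) by (simp add: dist_norm norm_minus_commute)
  qed
  then show "\<forall>\<^sub>F G in finite_subsets_at_top UNIV.
      dist (\<Sum>k\<in>G. fourier_coeff f k *\<^sub>c fourier_basis k) f < e"
    unfolding eventually_finite_subsets_at_top fourier_sum_def using F(1) by blast
qed

lemma parseval_has_sum: "((\<lambda>k. (cmod (fourier_coeff f k))\<^sup>2) has_sum (norm f)\<^sup>2) UNIV"
  using has_sum_bounded_linear[OF bounded_linear_inner_right[of f] fourier_series_has_sum[of f]]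
  by (simp only: o_def inner_cscale_fourier_basis Re_cnj_mult_self power2_norm_eq_inner)

lemma fourier_coeff_unique:
  assumes "((\<lambda>k. \<phi> k *\<^sub>c fourier_basis k) has_sum h) UNIV"
  shows "fourier_coeff h j = \<phi> j"
proof -
  have "((\<lambda>k. if k = j then \<phi> k else 0) has_sum fourier_coeff h j) UNIV"
    using has_sum_bounded_linear[OF bounded_linear_fourier_coeff[of j] assms]
    by (simp only: o_def fourier_coeff_basis)
  moreover have "((\<lambda>k. if k = j then \<phi> k else 0) has_sum \<phi> j) UNIV"
    by (rule has_sum_finite_neutralI[of "{j}"]) auto
  ultimately show ?thesis by (rule has_sum_unique)
qed

lemma fourier_coeff_inject:
  assumes "\<And>k. fourier_coeff f k = fourier_coeff g k" shows "f = g"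
  using has_sum_unique[OF fourier_series_has_sum[of f]] fourier_series_has_sum[of g] assms
  by simp

text \<open>Sums over the integers are moved to integrals against counting measure, where Tonelli,
  Cauchy-Schwarz and dominated convergence can be applied with infinite values allowed.\<close>

lemma nn_integral_has_sum:
  fixes f :: "'a \<Rightarrow> real"
  assumes "(f has_sum s) UNIV" "\<And>x. 0 \<le> f x"
  shows "(\<integral>\<^sup>+x. ennreal (f x) \<partial>count_space UNIV) = ennreal s"
proof -
  have "f summable_on UNIV" using assms(1) by (rule has_sum_imp_summable)
  then have "(\<lambda>x. norm (f x)) summable_on UNIV" using assms(2) by simp
  then have i: "integrable (count_space UNIV) f"
    using abs_summable_equivalent[of f UNIV] by (simp add: Infinite_Set_Sum.abs_summable_on_def)
  have "(\<integral>\<^sup>+x. ennreal (f x) \<partial>count_space UNIV) = ennreal (infsetsum f UNIV)"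
    unfolding infsetsum_def using i assms(2) by (intro nn_integral_eq_integral) auto
  also have "infsetsum f UNIV = infsum f UNIV"
    by (rule infsetsum_infsum) (use i in \<open>simp add: Infinite_Set_Sum.abs_summable_on_def\<close>)
  also have "\<dots> = s" using assms(1) by (rule infsumI)
  finally show ?thesis .
qed

lemma nn_integral_norm_finite_imp_abs_summable:
  fixes f :: "'a \<Rightarrow> 'b::{banach, second_countable_topology}"
  assumes "(\<integral>\<^sup>+x. ennreal (norm (f x)) \<partial>count_space UNIV) < \<infinity>"
  shows "(\<lambda>x. norm (f x)) summable_on UNIV"
proof -
  have "integrable (count_space UNIV) f"
    using assms by (intro integrableI_bounded) auto
  then show ?thesis
    using abs_summable_equivalent[of f UNIV] by (simp add: Infinite_Set_Sum.abs_summable_on_def)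
qed

text \<open>If the right-hand side is infinite the bound is trivial; otherwise f is absolutely
  summable and this is the triangle inequality.\<close>

lemma norm_infsum_le_nn_integral:
  fixes f :: "'a \<Rightarrow> 'b::{banach, second_countable_topology}"
  shows "ennreal (norm (infsum f UNIV)) \<le> (\<integral>\<^sup>+x. ennreal (norm (f x)) \<partial>count_space UNIV)"
proof (cases "(\<integral>\<^sup>+x. ennreal (norm (f x)) \<partial>count_space UNIV) < \<infinity>")
  case True
  then have s: "(\<lambda>x. norm (f x)) summable_on UNIV"
    by (rule nn_integral_norm_finite_imp_abs_summable)
  then have "(\<integral>\<^sup>+x. ennreal (norm (f x)) \<partial>count_space UNIV) = ennreal (infsum (\<lambda>x. norm (f x)) UNIV)"
    by (intro nn_integral_has_sum) (auto intro: has_sum_infsum)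
  then show ?thesis using norm_infsum_bound[OF s] by (simp add: ennreal_leI)
next
  case False
  then show ?thesis by (simp add: not_less top_unique)
qed

lemma parseval:
  "(\<integral>\<^sup>+k. ennreal ((cmod (fourier_coeff f k))\<^sup>2) \<partial>count_space UNIV) = ennreal ((norm f)\<^sup>2)"
  by (intro nn_integral_has_sum parseval_has_sum) simp

section \<open>Modulation as a shift of the Fourier coefficients\<close>

lemma square_integrable_modulate:
  assumes "square_integrable f" shows "square_integrable (\<lambda>x. cis (of_int k * x) * f x)"
  using assms square_integrable_cis[of k] by (auto simp: square_integrable_def norm_mult)

lift_definition modulate :: "int \<Rightarrow> l2 \<Rightarrow> l2" is "\<lambda>k f x. cis (of_int k * x) * f x"
  by (auto simp: l2_rel_def square_integrable_modulate)

lemma modulate_abs_l2: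
  "square_integrable f \<Longrightarrow> modulate k (abs_l2 f) = abs_l2 (\<lambda>x. cis (of_int k * x) * f x)"
  by (rule modulate.abs_eq) (auto intro: l2_rel_refl)

lemma inner_modulate: "modulate k f \<bullet> modulate k g = f \<bullet> g"
proof -
  have "(cis t * z) \<bullet> (cis t * w) = z \<bullet> w" for t z w
    by (simp add: inner_mult_left_complex)
  then show ?thesis by transfer simp
qed

lemma modulate_fourier_basis: "modulate k (c *\<^sub>c fourier_basis j) = c *\<^sub>c fourier_basis (k + j)"
proof -
  have "cis (of_int k * x) * (c * cis (of_int j * x)) = c * cis (of_int (k + j) * x)" for x
    by (simp add: cis_mult distrib_right mult.left_commute)
  then show ?thesis
    by (simp only: fourier_basis_abs abs_l2_cscale modulate_abs_l2 square_integrable_cis square_integrable_cmult)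
qed

text \<open>Unitarity: pairing S_k f with e_l = S_k e_{l-k} is pairing f with e_{l-k}.\<close>

lemma fourier_coeff_modulate: "fourier_coeff (modulate k f) l = fourier_coeff f (l - k)"
  using inner_modulate[of k f "1 *\<^sub>c fourier_basis (l - k)"] inner_modulate[of k f "\<i> *\<^sub>c fourier_basis (l - k)"]
  unfolding modulate_fourier_basis by (simp add: fourier_coeff_def)

section \<open>Restriction to measurable sets\<close>

lemma square_integrable_indicator_scaleR:
  assumes "Y \<in> sets circle" "square_integrable f"
  shows "square_integrable (\<lambda>x. indicator Y x *\<^sub>R f x)"
  using square_integrable_indicator[OF assms(2), of Y] assms(1) by simp

lemma proj_abs_l2:
  "Y \<in> sets circle \<Longrightarrow> square_integrable f \<Longrightarrow> proj Y (abs_l2 f) = abs_l2 (\<lambda>x. indicator Y x *\<^sub>R f x)"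
  using proj.abs_eq[of f Y] by (simp add: l2_rel_refl)

lemma norm_proj_le:
  assumes Y: "Y \<in> sets circle" shows "norm (proj Y f) \<le> norm f"
proof -
  obtain g where g: "square_integrable g" "f = abs_l2 g" by (rule l2_exhaust)
  have "(norm (proj Y f))\<^sup>2 \<le> (norm f)\<^sup>2"
    using square_integrable_indicator_scaleR[OF Y g(1)] g(1)
    by (simp only: g(2) proj_abs_l2[OF Y g(1)] norm_abs_l2)
       (intro integral_mono, auto simp: square_integrable_def indicator_def)
  then show ?thesis by (rule power2_le_imp_le) simp
qed

lemma proj_add_compl:
  assumes Y: "Y \<in> sets circle"
  shows "proj Y f + proj (space circle - Y) f = f"
proof -
  have Y': "space circle - Y \<in> sets circle" using Y by (rule sets.compl_sets)
  obtain g where g: "square_integrable g" "f = abs_l2 g" by (rule l2_exhaust)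
  note s = square_integrable_indicator_scaleR[OF Y g(1)] square_integrable_indicator_scaleR[OF Y' g(1)]
  show ?thesis
    unfolding g(2) proj_abs_l2[OF Y g(1)] proj_abs_l2[OF Y' g(1)] abs_l2_add[OF s]
    by (rule abs_l2_eqI[OF square_integrable_add[OF s] g(1) AE_I2])
       (auto simp: indicator_def)
qed

lemma norm_proj_compl_sq:
  assumes Y: "Y \<in> sets circle"
  shows "(norm (proj Y f))\<^sup>2 + (norm (proj (space circle - Y) f))\<^sup>2 = (norm f)\<^sup>2"
proof -
  have Y': "space circle - Y \<in> sets circle" using Y by (rule sets.compl_sets)
  obtain g where g: "square_integrable g" "f = abs_l2 g" by (rule l2_exhaust)
  note s = square_integrable_indicator_scaleR[OF Y g(1)] square_integrable_indicator_scaleR[OF Y' g(1)]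
  have "proj Y f \<bullet> proj (space circle - Y) f = (\<integral>x. 0 \<partial>circle)"
    unfolding g(2) proj_abs_l2[OF Y g(1)] proj_abs_l2[OF Y' g(1)] inner_abs_l2[OF s]
    by (intro Bochner_Integration.integral_cong) (auto simp: indicator_def)
  then have "(norm (proj Y f + proj (space circle - Y) f))\<^sup>2 = (norm (proj Y f))\<^sup>2 + (norm (proj (space circle - Y) f))\<^sup>2"
    by (simp add: power2_norm_eq_inner inner_add_left inner_add_right
        inner_commute[of "proj (space circle - Y) f" "proj Y f"] del: space_circle)
  then show ?thesis using proj_add_compl[OF Y] by simp
qed

lemma bounded_linear_proj:
  assumes Y: "Y \<in> sets circle" shows "bounded_linear (proj Y)"
proof (rule bounded_linear_intro[where K = 1])
  show "norm (proj Y f) \<le> norm f * 1" for f using norm_proj_le[OF Y] by simp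
  show "proj Y (f + g) = proj Y f + proj Y g" for f g
    using Y by transfer (auto simp: l2_rel_def scaleR_add_right
        intro!: square_integrable_add square_integrable_indicator_scaleR)
  show "proj Y (c *\<^sub>R f) = c *\<^sub>R proj Y f" for c f
  proof -
    obtain g where g: "square_integrable g" "f = abs_l2 g" by (rule l2_exhaust)
    have "indicator Y x *\<^sub>R (of_real c * g x) = of_real c * (indicator Y x *\<^sub>R g x)" for x by simp
    then show ?thesis
      by (simp only: g(2) cscale_of_real[symmetric] abs_l2_cscale[OF g(1)] proj_abs_l2[OF Y g(1)]
          proj_abs_l2[OF Y square_integrable_cmult[OF g(1)]]
          abs_l2_cscale[OF square_integrable_indicator_scaleR[OF Y g(1)]])
  qed
qed

text \<open>The operator in question multiplies by e^{ikx} - c on Y. It is applied with c = e^{ika}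
  and Y a short arc containing a, where the multiplier is small.\<close>

lemma norm_modulate_proj_diff_le:
  assumes Y: "Y \<in> sets circle" and B: "\<And>x. x \<in> Y \<Longrightarrow> cmod (cis (of_int k * x) - c) \<le> B"
  shows "(norm (modulate k (proj Y f) - c *\<^sub>c proj Y f))\<^sup>2 \<le> B\<^sup>2 * (norm f)\<^sup>2"
proof -
  obtain g where g: "square_integrable g" "f = abs_l2 g" by (rule l2_exhaust)
  note s = square_integrable_indicator_scaleR[OF Y g(1)]
  note s1 = square_integrable_modulate[OF s, of k] and s2 = square_integrable_cmult[OF s, of c]
  have "(norm (modulate k (proj Y f) - c *\<^sub>c proj Y f))\<^sup>2 =
      (\<integral>x. (cmod (cis (of_int k * x) * (indicator Y x *\<^sub>R g x) - c * (indicator Y x *\<^sub>R g x)))\<^sup>2 \<partial>circle)"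
    unfolding g(2) proj_abs_l2[OF Y g(1)] modulate_abs_l2[OF s] abs_l2_cscale[OF s] abs_l2_diff[OF s1 s2]
    by (rule norm_abs_l2[OF square_integrable_diff[OF s1 s2]])
  also have "\<dots> \<le> (\<integral>x. B\<^sup>2 * (cmod (g x))\<^sup>2 \<partial>circle)"
  proof (rule integral_mono)
    show "integrable circle (\<lambda>x. (cmod (cis (of_int k * x) * (indicator Y x *\<^sub>R g x) - c * (indicator Y x *\<^sub>R g x)))\<^sup>2)"
      using square_integrable_diff[OF s1 s2] by (simp add: square_integrable_def)
    show "integrable circle (\<lambda>x. B\<^sup>2 * (cmod (g x))\<^sup>2)"
      using g(1) by (simp add: square_integrable_def)
    fix x
    show "(cmod (cis (of_int k * x) * (indicator Y x *\<^sub>R g x) - c * (indicator Y x *\<^sub>R g x)))\<^sup>2 \<le> B\<^sup>2 * (cmod (g x))\<^sup>2"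
    proof (cases "x \<in> Y")
      case True
      have "(cmod (cis (of_int k * x) * g x - c * g x))\<^sup>2 = (cmod (cis (of_int k * x) - c))\<^sup>2 * (cmod (g x))\<^sup>2"
        by (simp add: norm_mult power_mult_distrib flip: left_diff_distrib)
      also have "\<dots> \<le> B\<^sup>2 * (cmod (g x))\<^sup>2"
        by (intro mult_right_mono power_mono B True) auto
      finally show ?thesis using True by simp
    qed simp
  qed
  also have "\<dots> = B\<^sup>2 * (norm f)\<^sup>2" by (simp add: g norm_abs_l2)
  finally show ?thesis .
qed

section \<open>Operators of diagonal type\<close>

lemma norm_modulate: "norm (modulate k f) = norm f"
  by (simp add: norm_eq_sqrt_inner inner_modulate)

locale diagonal_operator =
  fixes W :: "l2 \<Rightarrow> l2" and A :: "int \<Rightarrow> int \<Rightarrow> complex"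
  assumes has_matrix: "has_matrix W A" and diagonal_type: "diagonal_type A"
begin

text \<open>The number c_k. The supremum is taken in \<open>ennreal\<close>, and
  \<open>enn2real\<close> would send an infinite one to 0; \<open>ennreal_diag_sup\<close> derives
  from the diagonal type that this does not happen.\<close>

definition diag_sup :: "int \<Rightarrow> real"
  where "diag_sup k = enn2real (SUP j. ennreal (cmod (A (k + j) j)))"

definition diag_norm :: real
  where "diag_norm = (\<Sum>\<^sub>\<infinity>k. diag_sup k)"

lemma diag_sup_nonneg [simp]: "0 \<le> diag_sup k"
  by (simp add: diag_sup_def)

lemma sum_ennreal_diag_sup_le:
  assumes "finite F"
  shows "(\<Sum>k\<in>F. SUP j. ennreal (cmod (A (k + j) j))) \<le> (\<Sum>\<^sub>\<infinity>k. SUP j. ennreal (cmod (A (k + j) j)))"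
  by (subst infsum_finite[OF assms, symmetric], rule infsum_mono_neutral[OF nonneg_summable_on_complete nonneg_summable_on_complete]) auto

lemma ennreal_diag_sup: "ennreal (diag_sup k) = (SUP j. ennreal (cmod (A (k + j) j)))"
  using sum_ennreal_diag_sup_le[of "{k}"] diagonal_type
  unfolding diagonal_type_def diag_sup_def by (simp add: less_top)

lemma norm_matrix_le: "cmod (A l (l - k)) \<le> diag_sup k"
proof -
  have "ennreal (cmod (A (k + (l - k)) (l - k))) \<le> ennreal (diag_sup k)"
    unfolding ennreal_diag_sup by (rule SUP_upper) simp
  then show ?thesis by simp
qed

lemma diag_sup_summable: "diag_sup summable_on UNIV"
proof (rule nonneg_bdd_above_summable_on)
  define B where "B = (\<Sum>\<^sub>\<infinity>k. SUP j. ennreal (cmod (A (k + j) j)))"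
  have B: "B < \<infinity>" using diagonal_type unfolding diagonal_type_def B_def .
  have "sum diag_sup F \<le> enn2real B" if "finite F" for F
  proof -
    have "ennreal (sum diag_sup F) \<le> ennreal (enn2real B)"
      using sum_ennreal_diag_sup_le[OF that] B
      by (simp add: B_def ennreal_diag_sup less_top flip: sum_ennreal)
    then show ?thesis by (simp add: ennreal_le_iff)
  qed
  then show "bdd_above (sum diag_sup ` {F. F \<subseteq> UNIV \<and> finite F})"
    by (auto intro!: bdd_aboveI)
qed simp

lemma diag_norm_nonneg [simp]: "0 \<le> diag_norm"
  unfolding diag_norm_def by (rule infsum_nonneg) simp

lemma nn_integral_diag_sup: "(\<integral>\<^sup>+k. ennreal (diag_sup k) \<partial>count_space UNIV) = ennreal diag_norm"
  unfolding diag_norm_def by (intro nn_integral_has_sum has_sum_infsum diag_sup_summable) simp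

lemma norm_diag_infsum_le:
  "ennreal (cmod (\<Sum>\<^sub>\<infinity>k. A l (l - k) * d k)) \<le> (\<integral>\<^sup>+k. ennreal (diag_sup k) * ennreal (cmod (d k)) \<partial>count_space UNIV)"
proof -
  have "ennreal (cmod (\<Sum>\<^sub>\<infinity>k. A l (l - k) * d k)) \<le> (\<integral>\<^sup>+k. ennreal (cmod (A l (l - k) * d k)) \<partial>count_space UNIV)"
    by (rule norm_infsum_le_nn_integral)
  also have "\<dots> \<le> (\<integral>\<^sup>+k. ennreal (diag_sup k) * ennreal (cmod (d k)) \<partial>count_space UNIV)"
    by (intro nn_integral_mono)
       (simp add: norm_mult norm_matrix_le mult_right_mono flip: ennreal_mult)
  finally show ?thesis .
qed

text \<open>Cauchy-Schwarz for the measure on the integers with weights c_k, whose total mass is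
  \<open>diag_norm\<close>. The weight stays inside the sum, so the right-hand side can still be
  summed over l for fixed k.\<close>

lemma norm_diag_infsum_sq_le:
  "ennreal ((cmod (\<Sum>\<^sub>\<infinity>k. A l (l - k) * d k))\<^sup>2)
    \<le> ennreal diag_norm * (\<integral>\<^sup>+k. ennreal (diag_sup k) * ennreal ((cmod (d k))\<^sup>2) \<partial>count_space UNIV)"
proof -
  define M where "M = density (count_space UNIV) (\<lambda>k::int. ennreal (diag_sup k))"
  have M: "(\<integral>\<^sup>+k. f k \<partial>M) = (\<integral>\<^sup>+k. ennreal (diag_sup k) * f k \<partial>count_space UNIV)" for f
    unfolding M_def by (intro nn_integral_density) auto
  have "(\<integral>\<^sup>+k. ennreal (cmod (d k)) * 1 \<partial>M)\<^sup>2 \<le> (\<integral>\<^sup>+k. ennreal (cmod (d k)) ^ 2 \<partial>M) * (\<integral>\<^sup>+k. 1 ^ 2 \<partial>M)"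
    by (rule Cauchy_Schwarz_nn_integral) (auto simp: M_def)
  then have "(\<integral>\<^sup>+k. ennreal (cmod (d k)) \<partial>M)\<^sup>2 \<le> ennreal diag_norm * (\<integral>\<^sup>+k. ennreal ((cmod (d k))\<^sup>2) \<partial>M)"
    using M[of "\<lambda>_. 1"] by (simp add: nn_integral_diag_sup ennreal_power mult.commute)
  moreover have "(ennreal (cmod (\<Sum>\<^sub>\<infinity>k. A l (l - k) * d k)))\<^sup>2 \<le> (\<integral>\<^sup>+k. ennreal (cmod (d k)) \<partial>M)\<^sup>2"
    unfolding M by (intro power_mono norm_diag_infsum_le) simp
  ultimately show ?thesis unfolding M by (simp add: ennreal_power)
qed

lemma diag_summable:
  assumes "\<And>k. cmod (d k) \<le> B"
  shows "(\<lambda>k. A l (l - k) * d k) summable_on UNIV"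
proof (rule abs_summable_summable, rule summable_on_comparison_test)
  show "(\<lambda>k. diag_sup k * B) summable_on UNIV"
    by (intro summable_on_cmult_left diag_sup_summable)
  show "norm (A l (l - k) * d k) \<le> diag_sup k * B" for k
    unfolding norm_mult by (intro mult_mono norm_matrix_le assms) auto
qed simp

lemma bij_diff_int: "bij (\<lambda>k::int. l - k)"
  by (rule bij_betw_byWitness[where f' = "\<lambda>k. l - k"]) auto

text \<open>The row sum is reindexed by the diagonal k = l - j, on which every entry is bounded by
  c_k; \<open>L_coeff_altdef\<close> does the same for w_l(a), so that the two sums can be
  subtracted term by term.\<close>

lemma fourier_coeff_operator:
  "fourier_coeff (W f) l = (\<Sum>\<^sub>\<infinity>k. A l (l - k) * fourier_coeff f (l - k))"
proof -
  have "((\<lambda>j. (\<Sum>\<^sub>\<infinity>k. A j k * fourier_coeff f k) *\<^sub>c fourier_basis j) has_sum W f) UNIV"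
    using has_matrix fourier_series_has_sum[of f] unfolding has_matrix_def by blast
  from fourier_coeff_unique[OF this] show ?thesis
    using infsum_reindex_bij_betw[OF bij_diff_int[of l], of "\<lambda>k. A l k * fourier_coeff f k"] by simp
qed

lemma L_coeff_altdef: "L_coeff A a l = (\<Sum>\<^sub>\<infinity>k. A l (l - k) * cis (of_int k * a))"
  unfolding L_coeff_def
  using infsum_reindex_bij_betw[OF bij_diff_int[of l], of "\<lambda>k. A l k * cis (of_int (l - k) * a)"] by simp

lemma norm_L_coeff_le: "cmod (L_coeff A a l) \<le> diag_norm"
proof -
  have "ennreal (cmod (L_coeff A a l)) \<le> ennreal diag_norm"
    using norm_diag_infsum_le[of l "\<lambda>k. cis (of_int k * a)"]
    by (simp add: L_coeff_altdef nn_integral_diag_sup)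
  then show ?thesis by simp
qed

text \<open>Weierstrass test with majorant c_k; continuity provides the measurability in a.\<close>

lemma continuous_L_coeff: "continuous_on UNIV (\<lambda>a. L_coeff A a l)"
  unfolding L_coeff_altdef
proof (rule uniform_limit_theorem)
  show "uniform_limit UNIV (\<lambda>X a. \<Sum>k\<in>X. A l (l - k) * cis (of_int k * a))
     (\<lambda>a. \<Sum>\<^sub>\<infinity>k. A l (l - k) * cis (of_int k * a)) (finite_subsets_at_top UNIV)"
    by (rule Weierstrass_m_test_general[where M = diag_sup])
       (simp_all add: norm_mult norm_matrix_le diag_sup_summable)
  show "\<forall>\<^sub>F X in finite_subsets_at_top UNIV. continuous_on UNIV (\<lambda>a. \<Sum>k\<in>X. A l (l - k) * cis (of_int k * a))"
    by (intro always_eventually allI continuous_intros)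
qed simp

lemma norm_fourier_coeff_le: "cmod (fourier_coeff f k) \<le> norm f"
proof -
  have "(cmod (fourier_coeff f k))\<^sup>2 \<le> (norm f)\<^sup>2"
    using finite_sum_le_has_sum[OF parseval_has_sum[of f], of "{k}"] by simp
  then show ?thesis by (rule power2_le_imp_le) simp
qed

lemma operator_approx_L_coeff:
  "(\<integral>\<^sup>+l. ennreal ((cmod (fourier_coeff (W g) l - L_coeff A a l * fourier_coeff g l))\<^sup>2) \<partial>count_space UNIV)
   \<le> ennreal diag_norm * (\<integral>\<^sup>+k. ennreal (diag_sup k) *
        ennreal ((norm (modulate k g - cis (of_int k * a) *\<^sub>c g))\<^sup>2) \<partial>count_space UNIV)"
proof -
  define h where "h k = modulate k g - cis (of_int k * a) *\<^sub>c g" for k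
  have eq: "fourier_coeff (W g) l - L_coeff A a l * fourier_coeff g l = (\<Sum>\<^sub>\<infinity>k. A l (l - k) * fourier_coeff (h k) l)" for l
  proof -
    have s1: "(\<lambda>k. A l (l - k) * fourier_coeff g (l - k)) summable_on UNIV"
      by (rule diag_summable[OF norm_fourier_coeff_le])
    have s2: "(\<lambda>k. A l (l - k) * cis (of_int k * a)) summable_on UNIV"
      by (rule diag_summable[of _ 1]) simp
    have "(\<Sum>\<^sub>\<infinity>k. A l (l - k) * fourier_coeff (h k) l)
        = (\<Sum>\<^sub>\<infinity>k. A l (l - k) * fourier_coeff g (l - k) + (- fourier_coeff g l) * (A l (l - k) * cis (of_int k * a)))"
      by (intro infsum_cong)
         (simp add: h_def fourier_coeff_diff fourier_coeff_modulate fourier_coeff_cscale algebra_simps)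
    also have "\<dots> = fourier_coeff (W g) l + (\<Sum>\<^sub>\<infinity>k. (- fourier_coeff g l) * (A l (l - k) * cis (of_int k * a)))"
      unfolding fourier_coeff_operator by (intro infsum_add s1 summable_on_cmult_right s2)
    also have "\<dots> = fourier_coeff (W g) l - L_coeff A a l * fourier_coeff g l"
      unfolding infsum_cmult_right' L_coeff_altdef by simp
    finally show ?thesis by simp
  qed
  have "(\<integral>\<^sup>+l. ennreal ((cmod (fourier_coeff (W g) l - L_coeff A a l * fourier_coeff g l))\<^sup>2) \<partial>count_space UNIV)
    \<le> (\<integral>\<^sup>+l. ennreal diag_norm * (\<integral>\<^sup>+k. ennreal (diag_sup k) * ennreal ((cmod (fourier_coeff (h k) l))\<^sup>2) \<partial>count_space UNIV) \<partial>count_space UNIV)"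
    unfolding eq by (intro nn_integral_mono norm_diag_infsum_sq_le)
  also have "\<dots> = ennreal diag_norm * (\<integral>\<^sup>+l. \<integral>\<^sup>+k. ennreal (diag_sup k) * ennreal ((cmod (fourier_coeff (h k) l))\<^sup>2) \<partial>count_space UNIV \<partial>count_space UNIV)"
    by (intro nn_integral_cmult) simp
  \<comment> \<open>Tonelli: with k fixed, summing the squares over l is Parseval for
    \<open>h k\<close>.\<close>
  also have "(\<integral>\<^sup>+l. \<integral>\<^sup>+k. ennreal (diag_sup k) * ennreal ((cmod (fourier_coeff (h k) l))\<^sup>2) \<partial>count_space UNIV \<partial>count_space UNIV)
     = (\<integral>\<^sup>+k. \<integral>\<^sup>+l. ennreal (diag_sup k) * ennreal ((cmod (fourier_coeff (h k) l))\<^sup>2) \<partial>count_space UNIV \<partial>count_space UNIV)"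
    by (rule nn_integral_count_space_nn_integral) auto
  also have "\<dots> = (\<integral>\<^sup>+k. ennreal (diag_sup k) * ennreal ((norm (h k))\<^sup>2) \<partial>count_space UNIV)"
    by (simp add: nn_integral_cmult parseval)
  finally show ?thesis unfolding h_def .
qed

text \<open>The same weighted Cauchy-Schwarz and Tonelli argument as for
  \<open>operator_approx_L_coeff\<close>, with S_k f in place of (S_k - e^{ika}) f and the norm of
  S_k f equal to that of f.\<close>

lemma norm_operator_le: "norm (W f) \<le> diag_norm * norm f"
proof -
  have "ennreal ((norm (W f))\<^sup>2) = (\<integral>\<^sup>+l. ennreal ((cmod (fourier_coeff (W f) l))\<^sup>2) \<partial>count_space UNIV)"
    by (rule parseval[symmetric])
  also have "\<dots> \<le> (\<integral>\<^sup>+l. ennreal diag_norm * (\<integral>\<^sup>+k. ennreal (diag_sup k) * ennreal ((cmod (fourier_coeff (modulate k f) l))\<^sup>2) \<partial>count_space UNIV) \<partial>count_space UNIV)"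
    unfolding fourier_coeff_operator fourier_coeff_modulate by (intro nn_integral_mono norm_diag_infsum_sq_le)
  also have "\<dots> = ennreal diag_norm * (\<integral>\<^sup>+l. \<integral>\<^sup>+k. ennreal (diag_sup k) * ennreal ((cmod (fourier_coeff (modulate k f) l))\<^sup>2) \<partial>count_space UNIV \<partial>count_space UNIV)"
    by (intro nn_integral_cmult) simp
  also have "(\<integral>\<^sup>+l. \<integral>\<^sup>+k. ennreal (diag_sup k) * ennreal ((cmod (fourier_coeff (modulate k f) l))\<^sup>2) \<partial>count_space UNIV \<partial>count_space UNIV)
     = (\<integral>\<^sup>+k. \<integral>\<^sup>+l. ennreal (diag_sup k) * ennreal ((cmod (fourier_coeff (modulate k f) l))\<^sup>2) \<partial>count_space UNIV \<partial>count_space UNIV)"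
    by (rule nn_integral_count_space_nn_integral) auto
  also have "\<dots> = (\<integral>\<^sup>+k. ennreal (diag_sup k) * ennreal ((norm f)\<^sup>2) \<partial>count_space UNIV)"
    by (simp add: nn_integral_cmult parseval norm_modulate)
  also have "\<dots> = ennreal diag_norm * ennreal ((norm f)\<^sup>2)"
    by (simp add: nn_integral_multc nn_integral_diag_sup)
  also have "ennreal diag_norm * (ennreal diag_norm * ennreal ((norm f)\<^sup>2)) = ennreal ((diag_norm * norm f)\<^sup>2)"
    by (simp add: power_mult_distrib power2_eq_square mult.assoc flip: ennreal_mult)
  finally have "(norm (W f))\<^sup>2 \<le> (diag_norm * norm f)\<^sup>2" by simp
  then show ?thesis by (rule power2_le_imp_le) simp
qed

lemma bounded_linear_operator: "bounded_linear W"
proof (rule bounded_linear_intro[where K = diag_norm])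
  have s: "(\<lambda>k. A l (l - k) * fourier_coeff g (l - k)) summable_on UNIV" for g l
    by (rule diag_summable[OF norm_fourier_coeff_le])
  show "W (f + g) = W f + W g" for f g
    by (rule fourier_coeff_inject)
       (simp add: fourier_coeff_add fourier_coeff_operator distrib_left infsum_add s)
  show "W (r *\<^sub>R f) = r *\<^sub>R W f" for r f
    by (rule fourier_coeff_inject)
       (simp add: fourier_coeff_scaleR fourier_coeff_operator infsum_scaleR_right)
  show "norm (W f) \<le> norm f * diag_norm" for f
    using norm_operator_le[of f] by (simp add: mult.commute)
qed

end

section \<open>Means over integer intervals\<close>

definition mean_square :: "(int \<Rightarrow> complex) \<Rightarrow> int set \<Rightarrow> ennreal"
  where "mean_square w I = ennreal (1 / real (card I) * (\<Sum>l\<in>I. (cmod (w l))\<^sup>2))"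

definition interval_sup :: "nat \<Rightarrow> (int \<Rightarrow> complex) \<Rightarrow> ennreal"
  where "interval_sup N w = (SUP I\<in>{I. (\<exists>n m. n \<le> m \<and> I = {n..m}) \<and> N \<le> card I}. mean_square w I)"

text \<open>Only blocks of exactly N integers, half-open so that consecutive ones can be
  concatenated.\<close>

definition block_sup :: "nat \<Rightarrow> (int \<Rightarrow> complex) \<Rightarrow> ennreal"
  where "block_sup N w = (SUP n. mean_square w {n..<n + int N})"

lemma decseq_interval_sup: "decseq (\<lambda>N. interval_sup N w)"
  unfolding interval_sup_def by (intro decseq_SucI SUP_subset_mono) auto

lemma rho_eq_INF: "rho w = (INF N. interval_sup N w)"
proof -
  have "rho w = lim (\<lambda>N. interval_sup N w)"
    unfolding rho_def interval_sup_def mean_square_def ..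
  also have "\<dots> = (INF N. interval_sup N w)"
    by (intro limI LIMSEQ_INF decseq_interval_sup)
  finally show ?thesis .
qed

lemma block_sup_le_interval_sup:
  assumes "N > 0" shows "block_sup N w \<le> interval_sup N w"
  unfolding block_sup_def interval_sup_def
proof (rule SUP_mono)
  fix n :: int
  have "{n..<n + int N} = {n..n + int N - 1}" by auto
  then show "\<exists>I\<in>{I. (\<exists>n m. n \<le> m \<and> I = {n..m}) \<and> N \<le> card I}. mean_square w {n..<n + int N} \<le> mean_square w I"
    using assms by (intro bexI[of _ "{n..<n + int N}"]) (auto intro!: exI[of _ n] exI[of _ "n + int N - 1"])
qed

lemma sum_block_le:
  assumes "N > 0" shows "(\<Sum>l\<in>{n..<n + int N}. ennreal ((cmod (w l))\<^sup>2)) \<le> of_nat N * block_sup N w"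
proof -
  have "(\<Sum>l\<in>{n..<n + int N}. ennreal ((cmod (w l))\<^sup>2)) = of_nat N * mean_square w {n..<n + int N}"
    using assms by (simp add: mean_square_def sum_nonneg ennreal_of_nat_eq_real_of_nat flip: ennreal_mult)
  also have "\<dots> \<le> of_nat N * block_sup N w"
    unfolding block_sup_def by (intro mult_left_mono SUP_upper) auto
  finally show ?thesis .
qed

lemma sum_blocks_le:
  assumes "N > 0"
  shows "(\<Sum>l\<in>{n..<n + int (q * N)}. ennreal ((cmod (w l))\<^sup>2)) \<le> of_nat (q * N) * block_sup N w"
proof (induction q)
  case (Suc q)
  have "{n..<n + int (Suc q * N)} = {n..<n + int (q * N)} \<union> {n + int (q * N)..<n + int (q * N) + int N}"
    using ivl_disj_un_two(3)[of n "n + int (q * N)" "n + int (q * N) + int N"] by (simp add: algebra_simps)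
  then have "(\<Sum>l\<in>{n..<n + int (Suc q * N)}. ennreal ((cmod (w l))\<^sup>2)) =
     (\<Sum>l\<in>{n..<n + int (q * N)}. ennreal ((cmod (w l))\<^sup>2)) + (\<Sum>l\<in>{n + int (q * N)..<n + int (q * N) + int N}. ennreal ((cmod (w l))\<^sup>2))"
    by (simp only:) (rule sum.union_disjoint, auto)
  also have "\<dots> \<le> of_nat (q * N) * block_sup N w + of_nat N * block_sup N w"
    by (intro add_mono Suc.IH sum_block_le assms)
  also have "\<dots> = of_nat (Suc q * N) * block_sup N w"
    by (simp add: distrib_right add.commute)
  finally show ?case .
qed simp

text \<open>Covering an interval by consecutive blocks of length \<open>N\<close> overshoots by at most \<open>N\<close> points.\<close>

lemma interval_sup_le:
  assumes N: "N > 0" and Q: "Q > 0"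
  shows "interval_sup Q w \<le> ennreal (1 + real N / real Q) * block_sup N w"
  unfolding interval_sup_def
proof (rule SUP_least)
  fix I assume "I \<in> {I. (\<exists>n m::int. n \<le> m \<and> I = {n..m}) \<and> Q \<le> card I}"
  then obtain n m :: int where I: "n \<le> m" "I = {n..m}" "Q \<le> card I" by auto
  define q where "q = card I div N + 1"
  have c: "int (card I) = m - n + 1" using I by simp
  have q1: "card I \<le> q * N" "q * N \<le> card I + N"
    using N dividend_less_times_div[of N "card I"] by (auto simp: q_def distrib_right mult.commute)
  have "m < n + int (q * N)" using c q1(1) by linarith
  then have "I \<subseteq> {n..<n + int (q * N)}" using I by auto
  then have "(\<Sum>l\<in>I. ennreal ((cmod (w l))\<^sup>2)) \<le> (\<Sum>l\<in>{n..<n + int (q * N)}. ennreal ((cmod (w l))\<^sup>2))"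
    by (intro sum_mono2) auto
  also have "\<dots> \<le> of_nat (q * N) * block_sup N w" by (rule sum_blocks_le[OF N])
  finally have le: "ennreal (\<Sum>l\<in>I. (cmod (w l))\<^sup>2) \<le> of_nat (q * N) * block_sup N w" by simp
  have cp: "card I > 0" using I Q by linarith
  have "mean_square w I = ennreal (1 / real (card I)) * ennreal (\<Sum>l\<in>I. (cmod (w l))\<^sup>2)"
    unfolding mean_square_def by (rule ennreal_mult) (auto intro: sum_nonneg)
  also have "\<dots> \<le> ennreal (1 / real (card I)) * (of_nat (q * N) * block_sup N w)"
    by (intro mult_left_mono le) simp
  also have "\<dots> = ennreal (real (q * N) / real (card I)) * block_sup N w"
    by (simp add: ennreal_of_nat_eq_real_of_nat mult.assoc[symmetric] flip: ennreal_mult of_nat_mult)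
  also have "\<dots> \<le> ennreal (1 + real N / real Q) * block_sup N w"
  proof (intro mult_right_mono ennreal_leI)
    have "real (q * N) \<le> real (card I) + real N" using q1(2) by (metis of_nat_add of_nat_le_iff)
    then have "real (q * N) / real (card I) \<le> (real (card I) + real N) / real (card I)"
      by (intro divide_right_mono) auto
    also have "\<dots> = 1 + real N / real (card I)" using cp by (simp add: add_divide_distrib)
    also have "\<dots> \<le> 1 + real N / real Q"
      using I(3) Q by (intro add_left_mono divide_left_mono) auto
    finally show "real (q * N) / real (card I) \<le> 1 + real N / real Q" .
  qed simp
  finally show "mean_square w I \<le> ennreal (1 + real N / real Q) * block_sup N w" .
qed

text \<open>N stays fixed while Q tends to infinity. With \<open>block_sup_le_interval_sup\<close>
  this traps \<open>block_sup N w\<close> between \<open>rho w\<close> and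
  \<open>interval_sup N w\<close>, so the block suprema converge to \<open>rho w\<close> and the
  operator estimates may be proved for blocks of a fixed length.\<close>

lemma rho_le_block_sup:
  assumes "N > 0" shows "rho w \<le> block_sup N w"
proof (rule LIMSEQ_le_const)
  have "(\<lambda>Q. ennreal (1 + real N / real Q) * block_sup N w) \<longlonglongrightarrow> ennreal (1 + 0) * block_sup N w"
    by (intro tendsto_mult_ennreal tendsto_ennrealI tendsto_add tendsto_const lim_const_over_n) auto
  then show "(\<lambda>Q. ennreal (1 + real N / real Q) * block_sup N w) \<longlonglongrightarrow> block_sup N w" by simp
  have "rho w \<le> ennreal (1 + real N / real Q) * block_sup N w" if "Q \<ge> 1" for Q
  proof -
    have "rho w \<le> interval_sup Q w" unfolding rho_eq_INF by (rule INF_lower) simp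
    also have "\<dots> \<le> ennreal (1 + real N / real Q) * block_sup N w"
      using assms that by (intro interval_sup_le) auto
    finally show ?thesis .
  qed
  then show "\<exists>M. \<forall>Q\<ge>M. rho w \<le> ennreal (1 + real N / real Q) * block_sup N w" by blast
qed

text \<open>From 2pq \<le> \<eta> p^2 + q^2/\<eta>. The large factor 1 + 1/\<eta> always falls on a
  term that tends to 0 while \<eta> is fixed.\<close>

lemma norm_sq_le_weighted:
  fixes x y :: "'a::real_normed_vector"
  assumes "0 < \<eta>"
  shows "(norm x)\<^sup>2 \<le> (1 + \<eta>) * (norm y)\<^sup>2 + (1 + 1 / \<eta>) * (norm (x - y))\<^sup>2"
proof -
  let ?p = "norm y" and ?q = "norm (x - y)"
  have "norm x \<le> ?p + ?q" using norm_triangle_ineq[of y "x - y"] by simp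
  then have "(norm x)\<^sup>2 \<le> (?p + ?q)\<^sup>2" by (intro power_mono) auto
  also have "(?p + ?q)\<^sup>2 = ?p\<^sup>2 + ?q\<^sup>2 + 2 * ?p * ?q" by (rule power2_sum)
  also have "2 * ?p * ?q \<le> \<eta> * ?p\<^sup>2 + ?q\<^sup>2 / \<eta>"
  proof -
    have "0 \<le> (\<eta> * ?p - ?q)\<^sup>2 / \<eta>" using assms by simp
    also have "\<dots> = \<eta> * ?p\<^sup>2 + ?q\<^sup>2 / \<eta> - 2 * ?p * ?q"
      using assms by (simp add: power2_eq_square field_simps)
    finally show ?thesis by simp
  qed
  finally show ?thesis by (simp add: algebra_simps)
qed

lemma ennreal_norm_sq_le_weighted:
  fixes x y :: "'a::real_normed_vector"
  assumes "0 < \<eta>"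
  shows "ennreal ((norm x)\<^sup>2) \<le> ennreal (1 + \<eta>) * ennreal ((norm y)\<^sup>2) + ennreal (1 + 1 / \<eta>) * ennreal ((norm (x - y))\<^sup>2)"
  using ennreal_leI[OF norm_sq_le_weighted[OF assms, of x y]] assms
  by (simp add: ennreal_plus ennreal_mult)

lemma nn_integral_shift_int:
  "(\<integral>\<^sup>+l. f (l + k) \<partial>count_space UNIV) = (\<integral>\<^sup>+l. f l \<partial>count_space (UNIV :: int set))"
  by (rule nn_integral_bij_count_space) (rule bij_betw_byWitness[where f' = "\<lambda>l. l - k"], auto)

text \<open>Moving the shift from v to w, each v(l) gets multiplied by the sum of |w|^2 over the
  block that starts at l.\<close>

lemma sum_shift_le_block_sup:
  assumes "N > 0"
  shows "(\<Sum>k<N. \<integral>\<^sup>+l. ennreal ((cmod (w l))\<^sup>2) * v (l - int k) \<partial>count_space UNIV)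
    \<le> of_nat N * block_sup N w * (\<integral>\<^sup>+l. v l \<partial>count_space UNIV)"
proof -
  have "(\<Sum>k<N. \<integral>\<^sup>+l. ennreal ((cmod (w l))\<^sup>2) * v (l - int k) \<partial>count_space UNIV)
    = (\<Sum>k<N. \<integral>\<^sup>+l. ennreal ((cmod (w (l + int k)))\<^sup>2) * v l \<partial>count_space UNIV)"
  proof (intro sum.cong refl)
    fix k
    show "(\<integral>\<^sup>+l. ennreal ((cmod (w l))\<^sup>2) * v (l - int k) \<partial>count_space UNIV)
      = (\<integral>\<^sup>+l. ennreal ((cmod (w (l + int k)))\<^sup>2) * v l \<partial>count_space UNIV)"
      using nn_integral_shift_int[of "\<lambda>l. ennreal ((cmod (w l))\<^sup>2) * v (l - int k)" "int k"] by simp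
  qed
  also have "\<dots> = (\<integral>\<^sup>+l. (\<Sum>k<N. ennreal ((cmod (w (l + int k)))\<^sup>2) * v l) \<partial>count_space UNIV)"
    by (rule nn_integral_sum[symmetric]) simp
  also have "\<dots> \<le> (\<integral>\<^sup>+l. of_nat N * block_sup N w * v l \<partial>count_space UNIV)"
  proof (intro nn_integral_mono)
    fix l :: int
    have "(\<Sum>k<N. ennreal ((cmod (w (l + int k)))\<^sup>2)) = (\<Sum>j\<in>{l..<l + int N}. ennreal ((cmod (w j))\<^sup>2))"
      by (rule sum.reindex_bij_witness[where i = "\<lambda>j. nat (j - l)" and j = "\<lambda>k. l + int k"]) auto
    then show "(\<Sum>k<N. ennreal ((cmod (w (l + int k)))\<^sup>2) * v l) \<le> of_nat N * block_sup N w * v l"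
      unfolding sum_distrib_right[symmetric] using sum_block_le[OF assms, where w=w and n=l] by (simp add: mult_right_mono)
  qed
  also have "\<dots> = of_nat N * block_sup N w * (\<integral>\<^sup>+l. v l \<partial>count_space UNIV)"
    by (rule nn_integral_cmult) simp
  finally show ?thesis .
qed

lemma norm_cis_diff_le: "cmod (cis s - cis t) \<le> \<bar>s - t\<bar>"
proof -
  have "cis s - cis t = cis t * (exp (\<i> * of_real (s - t)) - 1)"
    by (simp add: cis_conv_exp right_diff_distrib flip: exp_add)
  then have "cmod (cis s - cis t) = cmod (exp (\<i> * of_real (s - t)) - 1)"
    by (simp add: norm_mult)
  also have "\<dots> = 2 * \<bar>sin ((s - t) / 2)\<bar>"
    using dist_exp_i_1[of "s - t"] by (simp add: mult.commute)
  also have "\<dots> \<le> 2 * \<bar>(s - t) / 2\<bar>"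
    by (intro mult_left_mono abs_sin_x_le_abs_x) simp
  finally show ?thesis by simp
qed

section \<open>Upper bound: partitions into short arcs\<close>

lemma ennreal_onorm_sq_le:
  assumes T: "bounded_linear T"
    and Q: "\<And>f. ennreal ((norm (T f))\<^sup>2) \<le> Q * ennreal ((norm f)\<^sup>2)"
  shows "ennreal ((onorm T)\<^sup>2) \<le> Q"
proof (cases "Q = \<infinity>")
  case False
  then obtain q where q: "0 \<le> q" "Q = ennreal q" by (cases Q) auto
  have "norm (T f) \<le> sqrt q * norm f" for f
  proof -
    have "(norm (T f))\<^sup>2 \<le> q * (norm f)\<^sup>2"
      using Q[of f] q by (simp flip: ennreal_mult)
    also have "\<dots> = (sqrt q * norm f)\<^sup>2" using q by (simp add: power_mult_distrib)
    finally show ?thesis by (rule power2_le_imp_le) (use q in simp)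
  qed
  then have "onorm T \<le> sqrt q" using q by (intro onorm_bound) auto
  then have "(onorm T)\<^sup>2 \<le> (sqrt q)\<^sup>2" using onorm_pos_le[OF T] by (intro power_mono)
  then show ?thesis using q by (simp add: ennreal_leI)
qed simp

text \<open>Dominated convergence in the form shared by both error terms, \<open>arc_error\<close>
  and \<open>trial_error\<close>, where the weights are the c_k.\<close>

lemma tendsto_nn_integral_weight_zero:
  assumes c: "(\<integral>\<^sup>+k. c k \<partial>count_space UNIV) < \<infinity>"
    and b: "\<And>n k. 0 \<le> b n k" "\<And>n k. b n k \<le> (B :: real)"
    and lim: "\<And>k. (\<lambda>n. b n k) \<longlonglongrightarrow> 0"
  shows "(\<lambda>n. \<integral>\<^sup>+k. c k * ennreal (b n k) \<partial>count_space UNIV) \<longlonglongrightarrow> 0"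
proof -
  have B: "0 \<le> B" using b(1)[of 0] b(2)[of 0] order_trans by blast
  \<comment> \<open>Multiplication by a constant is continuous at 0 in \<open>ennreal\<close> only
    if the constant is finite.\<close>
  have ctop: "c k < top" for k
  proof -
    have "c k = (\<integral>\<^sup>+j. c k * indicator {k} j \<partial>count_space UNIV)"
      by simp
    also have "\<dots> \<le> (\<integral>\<^sup>+j. c j \<partial>count_space UNIV)"
      by (intro nn_integral_mono) (auto simp: indicator_def)
    finally show ?thesis using c by auto
  qed
  have "(\<lambda>n. \<integral>\<^sup>+k. c k * ennreal (b n k) \<partial>count_space UNIV) \<longlonglongrightarrow> (\<integral>\<^sup>+k. c k * 0 \<partial>count_space UNIV)"
  proof (rule nn_integral_dominated_convergence[where w = "\<lambda>k. c k * ennreal B"])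
    show "AE k in count_space UNIV. c k * ennreal (b n k) \<le> c k * ennreal B" for n
      by (simp add: AE_count_space mult_left_mono ennreal_leI b(2))
    show "(\<integral>\<^sup>+k. c k * ennreal B \<partial>count_space UNIV) < \<infinity>"
      using c by (simp add: nn_integral_multc ennreal_mult_less_top)
    have "(\<lambda>n. c k * ennreal (b n k)) \<longlonglongrightarrow> c k * ennreal 0" for k
      by (intro ennreal_tendsto_cmult ctop tendsto_ennrealI lim)
    then show "AE k in count_space UNIV. (\<lambda>n. c k * ennreal (b n k)) \<longlonglongrightarrow> c k * 0"
      by (simp add: AE_count_space)
  qed auto
  then show ?thesis by simp
qed

text \<open>The factor is a square because each of the two bounds for the norm uses the weighted
  inequality twice.\<close>

lemma ennreal_le_of_le_mult_power2:
  assumes "\<And>\<eta>. 0 < \<eta> \<Longrightarrow> x \<le> ennreal ((1 + \<eta>)\<^sup>2) * y"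
  shows "x \<le> y"
proof (rule LIMSEQ_le_const)
  have *: "(\<lambda>n. (1 + inverse (real (Suc n)))\<^sup>2) \<longlonglongrightarrow> (1 + 0)\<^sup>2"
    by (intro tendsto_intros LIMSEQ_inverse_real_of_nat)
  have "(\<lambda>n. ennreal ((1 + inverse (real (Suc n)))\<^sup>2) * y) \<longlonglongrightarrow> ennreal ((1 + 0)\<^sup>2) * y"
    by (intro tendsto_mult_ennreal tendsto_const tendsto_ennrealI *) auto
  then show "(\<lambda>n. ennreal ((1 + inverse (real (Suc n)))\<^sup>2) * y) \<longlonglongrightarrow> y" by simp
  show "\<exists>N. \<forall>n\<ge>N. x \<le> ennreal ((1 + inverse (real (Suc n)))\<^sup>2) * y"
    using assms by (simp del: of_nat_Suc)
qed

section \<open>The partition into m equal half-open arcs\<close>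

definition circle_arc :: "nat \<Rightarrow> nat \<Rightarrow> real set"
  where "circle_arc m j = {real j * (2 * pi / real m)..<(real j + 1) * (2 * pi / real m)}"

lemma circle_arc_subset:
  assumes "j < m" shows "circle_arc m j \<subseteq> {0..<2 * pi}"
proof -
  have "(real j + 1) * (2 * pi / real m) \<le> real m * (2 * pi / real m)"
    using assms by (intro mult_right_mono) auto
  then show ?thesis using assms unfolding circle_arc_def by (auto intro: order_trans[rotated])
qed

lemma circle_arc_sets: "j < m \<Longrightarrow> circle_arc m j \<in> sets circle"
  using circle_arc_subset by (simp add: sets_circle_iff) (simp add: circle_arc_def)

lemma mem_circle_arc_iff:
  assumes "0 < m" shows "x \<in> circle_arc m j \<longleftrightarrow> \<lfloor>x / (2 * pi / real m)\<rfloor> = int j"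
  using assms unfolding circle_arc_def by (simp add: floor_eq_iff field_simps)

lemma UN_circle_arc:
  assumes "0 < m" shows "(\<Union>j<m. circle_arc m j) = {0..<2 * pi}"
proof (intro equalityI subsetI)
  fix x assume x: "x \<in> {0..<2 * pi}"
  define j where "j = nat \<lfloor>x / (2 * pi / real m)\<rfloor>"
  have "0 \<le> x / (2 * pi / real m)" using x by simp
  then have j: "int j = \<lfloor>x / (2 * pi / real m)\<rfloor>" by (simp add: j_def)
  have "x / (2 * pi / real m) < real m" using x assms by (simp add: field_simps)
  then have "j < m" using j by linarith
  moreover have "x \<in> circle_arc m j" by (simp only: mem_circle_arc_iff[OF assms] j)
  ultimately show "x \<in> (\<Union>j<m. circle_arc m j)" by blast
qed (use circle_arc_subset in blast)

lemma measurable_partition_arcs: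
  assumes "0 < m" shows "measurable_partition (circle_arc m ` {..<m})"
  unfolding measurable_partition_def
proof (intro conjI ballI impI)
  show "circle_arc m ` {..<m} \<subseteq> sets circle" using circle_arc_sets by auto
  show "measure circle (space circle - \<Union> (circle_arc m ` {..<m})) = 0"
    using UN_circle_arc[OF assms] by simp
  fix X Y assume "X \<in> circle_arc m ` {..<m}" "Y \<in> circle_arc m ` {..<m}" "X \<noteq> Y"
  then have "X \<inter> Y = {}" using assms by (auto simp: mem_circle_arc_iff)
  then show "measure circle (X \<inter> Y) = 0" by simp
qed simp

lemma mu_norm_sq_le:
  assumes "measurable_partition P" shows "(mu_norm W)\<^sup>2 \<le> partition_sum P W"
proof -
  have nn: "0 \<le> partition_sum P W" for P unfolding partition_sum_def by (intro sum_nonneg) auto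
  have bdd: "bdd_below ((\<lambda>P. sqrt (partition_sum P W)) ` {P. measurable_partition P})"
    by (rule bdd_belowI[of _ 0]) (use nn in auto)
  have "mu_norm W \<le> sqrt (partition_sum P W)"
    unfolding mu_norm_def by (rule cINF_lower[OF bdd]) (use assms in simp)
  moreover have "0 \<le> mu_norm W"
    unfolding mu_norm_def by (rule cINF_greatest) (use assms nn in auto)
  ultimately have "(mu_norm W)\<^sup>2 \<le> (sqrt (partition_sum P W))\<^sup>2" by (intro power_mono)
  then show ?thesis using nn by simp
qed

context diagonal_operator
begin

section \<open>Measurability in a and the upper bound for the norm\<close>

lemma borel_measurable_mean_square [measurable]:
  "(\<lambda>a. mean_square (L_coeff A a) I) \<in> borel_measurable borel"
proof -
  have [measurable]: "(\<lambda>a. L_coeff A a l) \<in> borel_measurable borel" for l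
    by (rule borel_measurable_continuous_onI[OF continuous_L_coeff])
  show ?thesis unfolding mean_square_def by measurable
qed

lemma borel_measurable_block_sup [measurable]:
  "(\<lambda>a. block_sup N (L_coeff A a)) \<in> borel_measurable borel"
  unfolding block_sup_def by measurable

lemma borel_measurable_interval_sup [measurable]:
  "(\<lambda>a. interval_sup N (L_coeff A a)) \<in> borel_measurable borel"
proof -
  have "countable (range (\<lambda>(n, m). {n..m::int}))" by simp
  then have "countable {I. (\<exists>n m::int. n \<le> m \<and> I = {n..m}) \<and> N \<le> card I}"
    by (rule countable_subset[rotated]) auto
  then show ?thesis unfolding interval_sup_def by (rule borel_measurable_SUP) simp
qed

lemma borel_measurable_rho [measurable]:
  "(\<lambda>a. rho (L_coeff A a)) \<in> borel_measurable borel"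
  unfolding rho_eq_INF by measurable

lemma mean_square_L_coeff_le: "mean_square (L_coeff A a) I \<le> ennreal (diag_norm\<^sup>2)"
proof (cases "card I = 0")
  case False
  have "(\<Sum>l\<in>I. (cmod (L_coeff A a l))\<^sup>2) \<le> real (card I) * diag_norm\<^sup>2"
    by (rule sum_bounded_above) (intro power_mono norm_L_coeff_le, simp)
  then have "1 / real (card I) * (\<Sum>l\<in>I. (cmod (L_coeff A a l))\<^sup>2) \<le> diag_norm\<^sup>2"
    using False by (simp add: field_simps)
  then show ?thesis unfolding mean_square_def by (rule ennreal_leI)
qed (simp add: mean_square_def)

text \<open>Up to an error controlled by \<open>N \<delta>\<close>, the coefficients of \<open>g\<close> do not change in modulus under
  shifts by less than \<open>N\<close>; averaging over these shifts replaces \<open>|w\<^sub>l|\<^sup>2\<close> by its block means.\<close>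

lemma multiplier_le_block_sup:
  assumes N: "0 < N" and \<eta>: "0 < \<eta>" and \<delta>: "0 \<le> \<delta>"
    and g: "\<And>k. norm (modulate k g - cis (of_int k * a) *\<^sub>c g) \<le> \<bar>of_int k\<bar> * \<delta> * r"
    and gr: "norm g \<le> r"
  shows "(\<integral>\<^sup>+l. ennreal ((cmod (L_coeff A a l * fourier_coeff g l))\<^sup>2) \<partial>count_space UNIV)
    \<le> (ennreal (1 + \<eta>) * block_sup N (L_coeff A a) + ennreal ((1 + 1 / \<eta>) * (diag_norm * (real N * \<delta>))\<^sup>2)) * ennreal (r\<^sup>2)"
proof -
  define w where "w = L_coeff A a"
  define u where "u l = ennreal ((cmod (w l))\<^sup>2)" for l
  define v where "v l = ennreal ((cmod (fourier_coeff g l))\<^sup>2)" for l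
  have r: "0 \<le> r" using gr norm_ge_zero[of g] by linarith
  have v: "(\<integral>\<^sup>+l. v l \<partial>count_space UNIV) \<le> ennreal (r\<^sup>2)"
    unfolding v_def parseval by (intro ennreal_leI power_mono gr) simp
  define J where "J = (\<integral>\<^sup>+l. u l * v l \<partial>count_space UNIV)"
  define e where "e = ennreal ((1 + 1 / \<eta>) * (diag_norm * (real N * \<delta>))\<^sup>2) * ennreal (r\<^sup>2)"
  have step: "J \<le> ennreal (1 + \<eta>) * (\<integral>\<^sup>+l. u l * v (l - int k) \<partial>count_space UNIV) + e" if k: "k < N" for k
  proof -
    define z where "z = cis (of_int (int k) * a)"
    define h where "h = modulate (int k) g - z *\<^sub>c g"
    have "u l * v l \<le> ennreal (1 + \<eta>) * (u l * v (l - int k))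
        + ennreal (1 + 1 / \<eta>) * (ennreal (diag_norm\<^sup>2) * ennreal ((cmod (fourier_coeff h l))\<^sup>2))" for l
    proof -
      \<comment> \<open>Since |z| = 1, comparing z g_l with g_{l-k} compares the squared moduli at l
        and l - k; the difference of the two numbers is, up to sign, the coefficient of h.\<close>
      have "v l = ennreal ((cmod (z * fourier_coeff g l))\<^sup>2)"
        by (simp add: v_def z_def norm_mult)
      also have "\<dots> \<le> ennreal (1 + \<eta>) * v (l - int k) + ennreal (1 + 1 / \<eta>) * ennreal ((cmod (fourier_coeff h l))\<^sup>2)"
        using ennreal_norm_sq_le_weighted[OF \<eta>, of "z * fourier_coeff g l" "fourier_coeff g (l - int k)"]
        by (simp add: v_def h_def fourier_coeff_diff fourier_coeff_modulate fourier_coeff_cscale norm_minus_commute)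
      finally have "u l * v l \<le> u l * (ennreal (1 + \<eta>) * v (l - int k) + ennreal (1 + 1 / \<eta>) * ennreal ((cmod (fourier_coeff h l))\<^sup>2))"
        by (rule mult_left_mono) simp
      also have "\<dots> = ennreal (1 + \<eta>) * (u l * v (l - int k)) + ennreal (1 + 1 / \<eta>) * (u l * ennreal ((cmod (fourier_coeff h l))\<^sup>2))"
        by (simp add: distrib_left ac_simps)
      also have "\<dots> \<le> ennreal (1 + \<eta>) * (u l * v (l - int k))
        + ennreal (1 + 1 / \<eta>) * (ennreal (diag_norm\<^sup>2) * ennreal ((cmod (fourier_coeff h l))\<^sup>2))"
        unfolding u_def w_def
        by (intro add_left_mono mult_left_mono mult_right_mono ennreal_leI power_mono norm_L_coeff_le) auto
      finally show ?thesis .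
    qed
    then have "J \<le> (\<integral>\<^sup>+l. ennreal (1 + \<eta>) * (u l * v (l - int k))
        + ennreal (1 + 1 / \<eta>) * (ennreal (diag_norm\<^sup>2) * ennreal ((cmod (fourier_coeff h l))\<^sup>2)) \<partial>count_space UNIV)"
      unfolding J_def by (intro nn_integral_mono)
    also have "\<dots> = ennreal (1 + \<eta>) * (\<integral>\<^sup>+l. u l * v (l - int k) \<partial>count_space UNIV)
        + ennreal (1 + 1 / \<eta>) * (ennreal (diag_norm\<^sup>2) * ennreal ((norm h)\<^sup>2))"
      by (simp add: nn_integral_add nn_integral_cmult parseval)
    also have "\<dots> \<le> ennreal (1 + \<eta>) * (\<integral>\<^sup>+l. u l * v (l - int k) \<partial>count_space UNIV) + e"
    proof (rule add_left_mono)
      have "norm h \<le> real k * \<delta> * r" using g[of "int k"] by (simp add: h_def z_def)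
      also have "\<dots> \<le> real N * \<delta> * r" using k \<delta> r by (intro mult_right_mono) auto
      finally have "(norm h)\<^sup>2 \<le> (real N * \<delta> * r)\<^sup>2" by (intro power_mono) auto
      then have "(1 + 1 / \<eta>) * (diag_norm\<^sup>2 * (norm h)\<^sup>2) \<le> (1 + 1 / \<eta>) * (diag_norm\<^sup>2 * (real N * \<delta> * r)\<^sup>2)"
        using \<eta> by (intro mult_left_mono) auto
      then have "ennreal ((1 + 1 / \<eta>) * (diag_norm\<^sup>2 * (norm h)\<^sup>2)) \<le> ennreal ((1 + 1 / \<eta>) * (diag_norm * (real N * \<delta>))\<^sup>2 * r\<^sup>2)"
        by (intro ennreal_leI) (simp add: power_mult_distrib ac_simps)
      then show "ennreal (1 + 1 / \<eta>) * (ennreal (diag_norm\<^sup>2) * ennreal ((norm h)\<^sup>2)) \<le> e"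
        using \<eta> by (simp add: e_def del: ennreal_plus flip: ennreal_mult)
    qed
    finally show ?thesis .
  qed
  have "of_nat N * J = (\<Sum>k<N. J)" by simp
  also have "\<dots> \<le> (\<Sum>k<N. ennreal (1 + \<eta>) * (\<integral>\<^sup>+l. u l * v (l - int k) \<partial>count_space UNIV) + e)"
    by (intro sum_mono step) simp
  also have "\<dots> = ennreal (1 + \<eta>) * (\<Sum>k<N. \<integral>\<^sup>+l. u l * v (l - int k) \<partial>count_space UNIV) + of_nat N * e"
    by (simp add: sum.distrib sum_distrib_left)
  also have "\<dots> \<le> ennreal (1 + \<eta>) * (of_nat N * block_sup N w * (\<integral>\<^sup>+l. v l \<partial>count_space UNIV)) + of_nat N * e"
    unfolding u_def by (intro add_right_mono mult_left_mono sum_shift_le_block_sup N) simp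
  also have "\<dots> \<le> ennreal (1 + \<eta>) * (of_nat N * block_sup N w * ennreal (r\<^sup>2)) + of_nat N * e"
    by (intro add_right_mono mult_left_mono v) auto
  also have "\<dots> = of_nat N * (ennreal (1 + \<eta>) * block_sup N w * ennreal (r\<^sup>2) + e)"
    by (simp add: distrib_left ac_simps)
  finally have "J \<le> ennreal (1 + \<eta>) * block_sup N w * ennreal (r\<^sup>2) + e"
    using N by (subst (asm) ennreal_mult_le_mult_iff) auto
  then show ?thesis
    by (simp add: J_def u_def v_def w_def e_def norm_mult power_mult_distrib distrib_right ennreal_mult)
qed

text \<open>For x within \<delta> of a the multiplier e^{ikx} - e^{ika} is at most |k| \<delta>, and
  at most 2. The second bound is kept since the sum of k^2 c_k may diverge.\<close>

definition arc_error :: "real \<Rightarrow> ennreal"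
  where "arc_error \<delta> = ennreal diag_norm *
    (\<integral>\<^sup>+k. ennreal (diag_sup k) * ennreal ((min 2 (\<bar>of_int k\<bar> * \<delta>))\<^sup>2) \<partial>count_space UNIV)"

lemma norm_operator_proj_sq_le:
  assumes Y: "Y \<in> sets circle" "\<And>x. x \<in> Y \<Longrightarrow> \<bar>x - a\<bar> \<le> \<delta>" and \<delta>: "0 \<le> \<delta>"
    and N: "0 < N" and \<eta>: "0 < \<eta>"
  shows "ennreal ((norm (W (proj Y f)))\<^sup>2) \<le>
    (ennreal (1 + \<eta>) * (ennreal (1 + \<eta>) * block_sup N (L_coeff A a)
        + ennreal ((1 + 1 / \<eta>) * (diag_norm * (real N * \<delta>))\<^sup>2))
      + ennreal (1 + 1 / \<eta>) * arc_error \<delta>) * ennreal ((norm f)\<^sup>2)"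
proof -
  define g where "g = proj Y f"
  have h: "(norm (modulate k g - cis (of_int k * a) *\<^sub>c g))\<^sup>2 \<le> (min 2 (\<bar>of_int k\<bar> * \<delta>))\<^sup>2 * (norm f)\<^sup>2" for k
    unfolding g_def
  proof (rule norm_modulate_proj_diff_le[OF Y(1)])
    fix x assume "x \<in> Y"
    have "cmod (cis (of_int k * x) - cis (of_int k * a)) \<le> \<bar>of_int k * x - of_int k * a\<bar>"
      by (rule norm_cis_diff_le)
    also have "\<dots> = \<bar>of_int k\<bar> * \<bar>x - a\<bar>" by (simp add: abs_mult flip: right_diff_distrib)
    also have "\<dots> \<le> \<bar>of_int k\<bar> * \<delta>" using Y(2)[OF \<open>x \<in> Y\<close>] by (rule mult_left_mono) simp
    finally show "cmod (cis (of_int k * x) - cis (of_int k * a)) \<le> min 2 (\<bar>of_int k\<bar> * \<delta>)"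
      using norm_triangle_ineq4[of "cis (of_int k * x)" "cis (of_int k * a)"] by simp
  qed
  have h': "norm (modulate k g - cis (of_int k * a) *\<^sub>c g) \<le> \<bar>of_int k\<bar> * \<delta> * norm f" for k
  proof (rule power2_le_imp_le)
    have "(min 2 (\<bar>real_of_int k\<bar> * \<delta>))\<^sup>2 * (norm f)\<^sup>2 \<le> (\<bar>real_of_int k\<bar> * \<delta>)\<^sup>2 * (norm f)\<^sup>2"
      using \<delta> by (intro mult_right_mono power_mono) auto
    then show "(norm (modulate k g - cis (of_int k * a) *\<^sub>c g))\<^sup>2 \<le> (\<bar>of_int k\<bar> * \<delta> * norm f)\<^sup>2"
      using h[of k] by (simp add: power_mult_distrib)
  qed (use \<delta> in simp)
  have "ennreal ((norm (W g))\<^sup>2) = (\<integral>\<^sup>+l. ennreal ((cmod (fourier_coeff (W g) l))\<^sup>2) \<partial>count_space UNIV)"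
    by (rule parseval[symmetric])
  also have "\<dots> \<le> (\<integral>\<^sup>+l. ennreal (1 + \<eta>) * ennreal ((cmod (L_coeff A a l * fourier_coeff g l))\<^sup>2)
     + ennreal (1 + 1 / \<eta>) * ennreal ((cmod (fourier_coeff (W g) l - L_coeff A a l * fourier_coeff g l))\<^sup>2) \<partial>count_space UNIV)"
    by (intro nn_integral_mono ennreal_norm_sq_le_weighted \<eta>)
  also have "\<dots> = ennreal (1 + \<eta>) * (\<integral>\<^sup>+l. ennreal ((cmod (L_coeff A a l * fourier_coeff g l))\<^sup>2) \<partial>count_space UNIV)
     + ennreal (1 + 1 / \<eta>) * (\<integral>\<^sup>+l. ennreal ((cmod (fourier_coeff (W g) l - L_coeff A a l * fourier_coeff g l))\<^sup>2) \<partial>count_space UNIV)"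
    by (simp add: nn_integral_add nn_integral_cmult)
  also have "\<dots> \<le> ennreal (1 + \<eta>) * ((ennreal (1 + \<eta>) * block_sup N (L_coeff A a)
        + ennreal ((1 + 1 / \<eta>) * (diag_norm * (real N * \<delta>))\<^sup>2)) * ennreal ((norm f)\<^sup>2))
     + ennreal (1 + 1 / \<eta>) * (arc_error \<delta> * ennreal ((norm f)\<^sup>2))"
  proof (intro add_mono mult_left_mono)
    show "(\<integral>\<^sup>+l. ennreal ((cmod (L_coeff A a l * fourier_coeff g l))\<^sup>2) \<partial>count_space UNIV)
      \<le> (ennreal (1 + \<eta>) * block_sup N (L_coeff A a)
        + ennreal ((1 + 1 / \<eta>) * (diag_norm * (real N * \<delta>))\<^sup>2)) * ennreal ((norm f)\<^sup>2)"
      by (rule multiplier_le_block_sup[OF N \<eta> \<delta> h']) (simp add: g_def norm_proj_le[OF Y(1)])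
    have "(\<integral>\<^sup>+l. ennreal ((cmod (fourier_coeff (W g) l - L_coeff A a l * fourier_coeff g l))\<^sup>2) \<partial>count_space UNIV)
      \<le> ennreal diag_norm * (\<integral>\<^sup>+k. ennreal (diag_sup k) *
        ennreal ((norm (modulate k g - cis (of_int k * a) *\<^sub>c g))\<^sup>2) \<partial>count_space UNIV)"
      by (rule operator_approx_L_coeff)
    also have "\<dots> \<le> ennreal diag_norm * (\<integral>\<^sup>+k. ennreal (diag_sup k) *
        ennreal ((min 2 (\<bar>of_int k\<bar> * \<delta>))\<^sup>2 * (norm f)\<^sup>2) \<partial>count_space UNIV)"
      by (intro mult_left_mono nn_integral_mono ennreal_leI h) auto
    also have "\<dots> = arc_error \<delta> * ennreal ((norm f)\<^sup>2)"
      by (simp add: arc_error_def ennreal_mult mult.assoc[symmetric] nn_integral_multc)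
    finally show "(\<integral>\<^sup>+l. ennreal ((cmod (fourier_coeff (W g) l - L_coeff A a l * fourier_coeff g l))\<^sup>2) \<partial>count_space UNIV)
      \<le> arc_error \<delta> * ennreal ((norm f)\<^sup>2)" .
  qed auto
  finally show ?thesis by (simp add: g_def distrib_right mult.assoc)
qed

lemma bounded_linear_operator_proj: "Y \<in> sets circle \<Longrightarrow> bounded_linear (W \<circ> proj Y)"
  unfolding o_def by (rule bounded_linear_compose[OF bounded_linear_operator bounded_linear_proj])

lemma tendsto_arc_error: "(\<lambda>m. arc_error (2 * pi / real m)) \<longlonglongrightarrow> 0"
proof -
  have "(\<lambda>m. \<integral>\<^sup>+k. ennreal (diag_sup k) * ennreal ((min 2 (\<bar>real_of_int k\<bar> * (2 * pi / real m)))\<^sup>2) \<partial>count_space UNIV) \<longlonglongrightarrow> 0"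
  proof (rule tendsto_nn_integral_weight_zero[where B = 4])
    show "(\<integral>\<^sup>+k. ennreal (diag_sup k) \<partial>count_space UNIV) < \<infinity>" by (simp add: nn_integral_diag_sup)
    show "(min 2 (\<bar>real_of_int k\<bar> * (2 * pi / real m)))\<^sup>2 \<le> 4" for k m
      using power_mono[of "min 2 (\<bar>real_of_int k\<bar> * (2 * pi / real m))" 2 2] by simp
    have "(\<lambda>m. (min 2 (\<bar>real_of_int k\<bar> * (2 * pi / real m)))\<^sup>2) \<longlonglongrightarrow> (min 2 (\<bar>real_of_int k\<bar> * 0))\<^sup>2" for k
      by (intro tendsto_intros lim_const_over_n)
    then show "(\<lambda>m. (min 2 (\<bar>real_of_int k\<bar> * (2 * pi / real m)))\<^sup>2) \<longlonglongrightarrow> 0" for k by simp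
  qed simp
  from ennreal_tendsto_cmult[OF _ this, of "ennreal diag_norm"] show ?thesis
    by (simp add: arc_error_def)
qed

text \<open>The squared norm of W on an arc is at most Q(a) for every a in that arc, not just at a
  chosen centre; hence its product with the measure of the arc is at most the integral of Q over the
  arc, and the arcs add up to the circle.\<close>

lemma mu_norm_le_block_sup_arcs:
  assumes m: "0 < m" and N: "0 < N" and \<eta>: "0 < \<eta>"
  shows "ennreal ((mu_norm W)\<^sup>2) \<le> ennreal ((1 + \<eta>)\<^sup>2) * (\<integral>\<^sup>+a. block_sup N (L_coeff A a) \<partial>circle)
    + (ennreal ((1 + \<eta>) * ((1 + 1 / \<eta>) * (diag_norm * (real N * (2 * pi / real m)))\<^sup>2))
       + ennreal (1 + 1 / \<eta>) * arc_error (2 * pi / real m))"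
proof -
  define \<delta> where "\<delta> = 2 * pi / real m"
  define e where "e = ennreal ((1 + \<eta>) * ((1 + 1 / \<eta>) * (diag_norm * (real N * \<delta>))\<^sup>2))
       + ennreal (1 + 1 / \<eta>) * arc_error \<delta>"
  define Q where "Q a = ennreal ((1 + \<eta>)\<^sup>2) * block_sup N (L_coeff A a) + e" for a
  have \<delta>: "0 \<le> \<delta>" by (simp add: \<delta>_def)
  have [measurable]: "(\<lambda>a. block_sup N (L_coeff A a)) \<in> borel_measurable circle"
    by (rule borel_measurable_circleI) simp
  have Qm [measurable]: "Q \<in> borel_measurable circle"
    unfolding Q_def by measurable
  have on: "ennreal ((onorm (W \<circ> proj (circle_arc m j)))\<^sup>2) \<le> Q a" if j: "j < m" and a: "a \<in> circle_arc m j" for j a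
  proof (rule ennreal_onorm_sq_le[OF bounded_linear_operator_proj[OF circle_arc_sets[OF j]]])
    fix f
    have d: "\<bar>x - a\<bar> \<le> \<delta>" if "x \<in> circle_arc m j" for x
    proof -
      have "(real j + 1) * (2 * pi / real m) = real j * (2 * pi / real m) + \<delta>"
        by (simp add: \<delta>_def distrib_right add_divide_distrib)
      then show ?thesis using that a unfolding circle_arc_def by auto
    qed
    have "ennreal (1 + \<eta>) * (ennreal (1 + \<eta>) * block_sup N (L_coeff A a)
        + ennreal ((1 + 1 / \<eta>) * (diag_norm * (real N * \<delta>))\<^sup>2)) + ennreal (1 + 1 / \<eta>) * arc_error \<delta> = Q a"
    proof -
      have "ennreal ((1 + \<eta>)\<^sup>2) = ennreal (1 + \<eta>) * ennreal (1 + \<eta>)"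
        using \<eta> by (simp add: power2_eq_square ennreal_mult del: ennreal_plus)
      moreover have "ennreal ((1 + \<eta>) * x) = ennreal (1 + \<eta>) * ennreal x" if "0 \<le> x" for x
        using \<eta> that by (simp add: ennreal_mult del: ennreal_plus)
      ultimately show ?thesis
        using \<eta> unfolding Q_def e_def
        by (simp add: distrib_left[of "ennreal (1 + \<eta>)"] mult.assoc add.assoc del: ennreal_plus)
    qed
    then show "ennreal ((norm ((W \<circ> proj (circle_arc m j)) f))\<^sup>2) \<le> Q a * ennreal ((norm f)\<^sup>2)"
      using norm_operator_proj_sq_le[OF circle_arc_sets[OF j] d \<delta> N \<eta>, of f] by (simp add: o_def)
  qed
  have "ennreal ((mu_norm W)\<^sup>2) \<le> ennreal (partition_sum (circle_arc m ` {..<m}) W)"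
    by (intro ennreal_leI mu_norm_sq_le measurable_partition_arcs m)
  \<comment> \<open>A partition is a set, so its sum runs over an image; passing to the index set
    can only add nonnegative terms.\<close>
  also have "\<dots> \<le> ennreal (\<Sum>j<m. measure circle (circle_arc m j) * (onorm (W \<circ> proj (circle_arc m j)))\<^sup>2)"
    unfolding partition_sum_def
    using sum_image_le[of "{..<m}" "\<lambda>Y. measure circle Y * (onorm (W \<circ> proj Y))\<^sup>2" "circle_arc m"]
    by (intro ennreal_leI) (simp add: o_def)
  also have "\<dots> = (\<Sum>j<m. emeasure circle (circle_arc m j) * ennreal ((onorm (W \<circ> proj (circle_arc m j)))\<^sup>2))"
    by (simp add: circle.emeasure_eq_measure flip: ennreal_mult sum_ennreal)
  also have "\<dots> \<le> (\<Sum>j<m. \<integral>\<^sup>+a. Q a * indicator (circle_arc m j) a \<partial>circle)"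
  proof (rule sum_mono)
    fix j assume "j \<in> {..<m}"
    then have j: "j < m" by simp
    have "emeasure circle (circle_arc m j) * ennreal ((onorm (W \<circ> proj (circle_arc m j)))\<^sup>2)
      = (\<integral>\<^sup>+a. ennreal ((onorm (W \<circ> proj (circle_arc m j)))\<^sup>2) * indicator (circle_arc m j) a \<partial>circle)"
      using circle_arc_sets[OF j] by (subst nn_integral_cmult_indicator) (auto simp: mult.commute)
    also have "\<dots> \<le> (\<integral>\<^sup>+a. Q a * indicator (circle_arc m j) a \<partial>circle)"
      using on[OF j] by (intro nn_integral_mono) (auto simp: indicator_def)
    finally show "emeasure circle (circle_arc m j) * ennreal ((onorm (W \<circ> proj (circle_arc m j)))\<^sup>2)
      \<le> (\<integral>\<^sup>+a. Q a * indicator (circle_arc m j) a \<partial>circle)" .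
  qed
  also have "\<dots> = (\<integral>\<^sup>+a. (\<Sum>j<m. Q a * indicator (circle_arc m j) a) \<partial>circle)"
    using circle_arc_sets by (intro nn_integral_sum[symmetric]) auto
  also have "\<dots> \<le> (\<integral>\<^sup>+a. Q a \<partial>circle)"
  proof (rule nn_integral_mono)
    fix a
    have "(\<Sum>j<m. indicator (circle_arc m j) a :: ennreal) \<le> 1"
    proof -
      have "(\<Sum>j<m. indicator (circle_arc m j) a :: ennreal) = of_nat (card {j \<in> {..<m}. a \<in> circle_arc m j})"
        unfolding indicator_def of_bool_def by (subst sum.If_cases) (auto intro!: arg_cong[where f = card])
      also have "card {j \<in> {..<m}. a \<in> circle_arc m j} \<le> Suc 0"
        using m by (subst card_le_Suc0_iff_eq) (auto simp: mem_circle_arc_iff)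
      then have "of_nat (card {j \<in> {..<m}. a \<in> circle_arc m j}) \<le> (of_nat (Suc 0) :: ennreal)"
        by (simp only: of_nat_le_iff)
      finally show ?thesis by simp
    qed
    then show "(\<Sum>j<m. Q a * indicator (circle_arc m j) a) \<le> Q a"
      unfolding sum_distrib_left[symmetric] using mult_left_mono[of _ 1 "Q a"] by simp
  qed
  also have "\<dots> = ennreal ((1 + \<eta>)\<^sup>2) * (\<integral>\<^sup>+a. block_sup N (L_coeff A a) \<partial>circle) + e"
    unfolding Q_def using emeasure_circle_space
    by (simp add: nn_integral_add nn_integral_cmult)
  finally show ?thesis unfolding e_def \<delta>_def .
qed

text \<open>The number m of arcs tends to infinity with N and \<eta> fixed, then \<eta> tends to
  0.\<close>

lemma mu_norm_le_block_sup:
  assumes N: "0 < N"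
  shows "ennreal ((mu_norm W)\<^sup>2) \<le> (\<integral>\<^sup>+a. block_sup N (L_coeff A a) \<partial>circle)"
proof (rule ennreal_le_of_le_mult_power2)
  fix \<eta> :: real assume \<eta>: "0 < \<eta>"
  let ?I = "ennreal ((1 + \<eta>)\<^sup>2) * (\<integral>\<^sup>+a. block_sup N (L_coeff A a) \<partial>circle)"
  have r: "(\<lambda>m. (1 + \<eta>) * ((1 + 1 / \<eta>) * (diag_norm * (real N * (2 * pi / real m)))\<^sup>2))
     \<longlonglongrightarrow> (1 + \<eta>) * ((1 + 1 / \<eta>) * (diag_norm * (real N * 0))\<^sup>2)"
    by (intro tendsto_intros lim_const_over_n)
  have "(\<lambda>m. ?I + (ennreal ((1 + \<eta>) * ((1 + 1 / \<eta>) * (diag_norm * (real N * (2 * pi / real m)))\<^sup>2))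
       + ennreal (1 + 1 / \<eta>) * arc_error (2 * pi / real m))) \<longlonglongrightarrow>
     ?I + (ennreal ((1 + \<eta>) * ((1 + 1 / \<eta>) * (diag_norm * (real N * 0))\<^sup>2)) + ennreal (1 + 1 / \<eta>) * 0)"
    by (intro tendsto_add tendsto_const tendsto_ennrealI[OF r] ennreal_tendsto_cmult tendsto_arc_error) simp
  then have "(\<lambda>m. ?I + (ennreal ((1 + \<eta>) * ((1 + 1 / \<eta>) * (diag_norm * (real N * (2 * pi / real m)))\<^sup>2))
       + ennreal (1 + 1 / \<eta>) * arc_error (2 * pi / real m))) \<longlonglongrightarrow> ?I" by simp
  then show "ennreal ((mu_norm W)\<^sup>2) \<le> ?I"
    by (rule LIMSEQ_le_const) (use mu_norm_le_block_sup_arcs[OF _ N \<eta>] in \<open>auto intro!: exI[of _ 1]\<close>)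
qed

text \<open>The limit in N is taken for \<open>interval_sup\<close>, which decreases in N. Monotone
  convergence from above needs one finite integral, supplied by the uniform bound
  \<open>diag_norm\<close> on the |w_l(a)|.\<close>

lemma mu_norm_le_rho: "ennreal ((mu_norm W)\<^sup>2) \<le> (\<integral>\<^sup>+a. rho (L_coeff A a) \<partial>circle)"
proof -
  have [measurable]: "(\<lambda>a. interval_sup N (L_coeff A a)) \<in> borel_measurable circle" for N
    by (rule borel_measurable_circleI) simp
  have "(\<integral>\<^sup>+a. interval_sup 0 (L_coeff A a) \<partial>circle) \<le> (\<integral>\<^sup>+a. ennreal (diag_norm\<^sup>2) \<partial>circle)"
    unfolding interval_sup_def by (intro nn_integral_mono SUP_least mean_square_L_coeff_le)
  also have "\<dots> < \<infinity>" using emeasure_circle_space by simp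
  finally have fin: "(\<integral>\<^sup>+a. interval_sup 0 (L_coeff A a) \<partial>circle) < \<infinity>" .
  have "(\<integral>\<^sup>+a. rho (L_coeff A a) \<partial>circle) = (INF N. \<integral>\<^sup>+a. interval_sup N (L_coeff A a) \<partial>circle)"
    unfolding rho_eq_INF
    by (rule nn_integral_monotone_convergence_INF_AE'[where f = "\<lambda>N a. interval_sup N (L_coeff A a)", OF _ _ fin])
       (auto intro!: AE_I2 decseqD[OF decseq_interval_sup])
  moreover have "ennreal ((mu_norm W)\<^sup>2) \<le> (\<integral>\<^sup>+a. interval_sup N (L_coeff A a) \<partial>circle)" for N
  proof -
    \<comment> \<open>\<open>Suc N\<close> keeps the block nonempty; the mean over the empty block
      is 0 by the convention 1/0 = 0.\<close>
    have "ennreal ((mu_norm W)\<^sup>2) \<le> (\<integral>\<^sup>+a. block_sup (Suc N) (L_coeff A a) \<partial>circle)"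
      by (rule mu_norm_le_block_sup) simp
    also have "\<dots> \<le> (\<integral>\<^sup>+a. interval_sup N (L_coeff A a) \<partial>circle)"
      by (intro nn_integral_mono order_trans[OF block_sup_le_interval_sup decseqD[OF decseq_interval_sup]]) auto
    finally show ?thesis .
  qed
  ultimately show ?thesis by (simp add: le_INF_iff)
qed

end

section \<open>Fejer kernels as trial functions\<close>

lemma abs_l2_sum:
  assumes "finite G" "\<And>i. i \<in> G \<Longrightarrow> square_integrable (f i)"
  shows "square_integrable (\<lambda>x. \<Sum>i\<in>G. f i x) \<and> (\<Sum>i\<in>G. abs_l2 (f i)) = abs_l2 (\<lambda>x. \<Sum>i\<in>G. f i x)"
  using assms
proof (induction G)
  case empty
  then show ?case by (simp add: abs_l2_zero square_integrable_def)
next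
  case (insert i G)
  then show ?case by (auto simp: square_integrable_add abs_l2_add)
qed

definition fejer :: "nat \<Rightarrow> real \<Rightarrow> real"
  where "fejer N t = (cmod (\<Sum>j<N. cis (real j * t)))\<^sup>2 / real N"

definition trial :: "nat \<Rightarrow> real \<Rightarrow> int \<Rightarrow> l2"
  where "trial N a n = (\<Sum>l\<in>{n..<n + int N}. (cis (- (of_int l * a)) / of_real (sqrt (real N))) *\<^sub>c fourier_basis l)"

lemma fourier_coeff_trial:
  "fourier_coeff (trial N a n) l =
    (if l \<in> {n..<n + int N} then cis (- (of_int l * a)) / of_real (sqrt (real N)) else 0)"
  unfolding trial_def fourier_coeff_sum fourier_coeff_basis by (rule sum.delta) simp

lemma norm_cis_div_sqrt_sq: "(cmod (cis t / of_real (sqrt (real N))))\<^sup>2 = 1 / real N"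
  by (simp add: norm_divide power_divide)

lemma norm_trial:
  assumes "0 < N" shows "norm (trial N a n) = 1"
proof -
  have "ennreal ((norm (trial N a n))\<^sup>2) = (\<integral>\<^sup>+l. ennreal ((cmod (fourier_coeff (trial N a n) l))\<^sup>2) \<partial>count_space UNIV)"
    by (rule parseval[symmetric])
  also have "\<dots> = (\<Sum>l\<in>{n..<n + int N}. ennreal ((cmod (fourier_coeff (trial N a n) l))\<^sup>2))"
    by (rule nn_integral_count_space') (auto simp: fourier_coeff_trial)
  also have "\<dots> = (\<Sum>l\<in>{n..<n + int N}. ennreal (1 / real N))"
    by (intro sum.cong) (auto simp only: fourier_coeff_trial if_True norm_cis_div_sqrt_sq)
  also have "\<dots> = 1" using assms by (simp add: ennreal_of_nat_eq_real_of_nat flip: ennreal_mult)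
  finally have "ennreal ((norm (trial N a n))\<^sup>2) = ennreal 1" by simp
  then have "(norm (trial N a n))\<^sup>2 = 1" by (subst (asm) ennreal_inj) auto
  then show ?thesis by (simp add: power2_eq_1_iff) (metis norm_ge_zero not_one_le_zero neg_0_le_iff_le)
qed

text \<open>The phases e^{-ila} are chosen so that S_k F and e^{ika} F have equal coefficients
  wherever the block and its shift by k overlap. The rest is at most 2|k| coefficients of squared
  modulus 1/N; the bound 4 is the triangle inequality for two unit vectors.\<close>

lemma norm_modulate_trial_diff_sq_le:
  assumes N: "0 < N"
  shows "(norm (modulate k (trial N a n) - cis (of_int k * a) *\<^sub>c trial N a n))\<^sup>2 \<le> min 4 (2 * \<bar>of_int k\<bar> / real N)"
proof -
  define h where "h = modulate k (trial N a n) - cis (of_int k * a) *\<^sub>c trial N a n"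
  \<comment> \<open>The gaps between the old and new left ends and between the old and new right
    ends. They contain the symmetric difference for either sign of k, also when the two blocks are
    disjoint.\<close>
  define D where "D = {min n (n + k)..<max n (n + k)} \<union> {min (n + int N) (n + int N + k)..<max (n + int N) (n + int N + k)}"
  have h: "(cmod (fourier_coeff h l))\<^sup>2 \<le> (if l \<in> D then 1 / real N else 0)" for l
  proof -
    define z where "z = cis (of_int k * a - of_int l * a) / of_real (sqrt (real N))"
    have "fourier_coeff h l = (if l - k \<in> {n..<n + int N} then z else 0) - (if l \<in> {n..<n + int N} then z else 0)"
      by (auto simp: h_def z_def fourier_coeff_diff fourier_coeff_modulate fourier_coeff_cscale fourier_coeff_trial
          cis_mult algebra_simps)
    moreover have "(cmod z)\<^sup>2 = 1 / real N" unfolding z_def by (rule norm_cis_div_sqrt_sq)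
    moreover have "l \<in> D" if "(l - k \<in> {n..<n + int N}) \<noteq> (l \<in> {n..<n + int N})"
      using that unfolding D_def by auto
    ultimately show ?thesis by auto
  qed
  have "finite D" by (simp add: D_def)
  have "card D \<le> nat \<bar>k\<bar> + nat \<bar>k\<bar>"
    unfolding D_def by (rule order_trans[OF card_Un_le]) (auto simp: min_def max_def)
  then have cD: "real (card D) \<le> 2 * \<bar>real_of_int k\<bar>" by linarith
  have "ennreal ((norm h)\<^sup>2) = (\<integral>\<^sup>+l. ennreal ((cmod (fourier_coeff h l))\<^sup>2) \<partial>count_space UNIV)"
    by (rule parseval[symmetric])
  also have "\<dots> \<le> (\<integral>\<^sup>+l. ennreal (if l \<in> D then 1 / real N else 0) \<partial>count_space UNIV)"
    by (intro nn_integral_mono ennreal_leI h)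
  also have "\<dots> = (\<Sum>l\<in>D. ennreal (if l \<in> D then 1 / real N else 0))"
    by (rule nn_integral_count_space') (use \<open>finite D\<close> in auto)
  also have "\<dots> = ennreal (real (card D) / real N)"
    by (simp add: ennreal_of_nat_eq_real_of_nat flip: ennreal_mult)
  finally have "(norm h)\<^sup>2 \<le> real (card D) / real N" by simp
  also have "\<dots> \<le> 2 * \<bar>of_int k\<bar> / real N" using cD by (intro divide_right_mono) auto
  finally have "(norm h)\<^sup>2 \<le> 2 * \<bar>of_int k\<bar> / real N" .
  moreover have "(norm h)\<^sup>2 \<le> 4"
  proof -
    have "norm h \<le> 2"
      unfolding h_def using norm_triangle_ineq4[of "modulate k (trial N a n)" "cis (of_int k * a) *\<^sub>c trial N a n"] N
      by (simp add: norm_modulate norm_cscale norm_trial)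
    then show ?thesis using power_mono[of "norm h" 2 2] by simp
  qed
  ultimately show ?thesis by (simp add: h_def)
qed

lemma trial_eq_abs_l2:
  "square_integrable (\<lambda>x. \<Sum>l\<in>{n..<n + int N}. (cis (- (of_int l * a)) / of_real (sqrt (real N))) * cis (of_int l * x)) \<and>
   trial N a n = abs_l2 (\<lambda>x. \<Sum>l\<in>{n..<n + int N}. (cis (- (of_int l * a)) / of_real (sqrt (real N))) * cis (of_int l * x))"
  unfolding trial_def fourier_basis_abs
  using abs_l2_sum[of "{n..<n + int N}" "\<lambda>l x. (cis (- (of_int l * a)) / of_real (sqrt (real N))) * cis (of_int l * x)"]
  by (simp add: abs_l2_cscale square_integrable_cis square_integrable_cmult del: times_divide_eq_left)

text \<open>The starting point n enters only through the unimodular factor e^{in(x-a)}; this is why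
  the mass of the trial function on any set is the same for all blocks of length N.\<close>

lemma norm_trial_fun_sq:
  "(cmod (\<Sum>l\<in>{n..<n + int N}. (cis (- (of_int l * a)) / of_real (sqrt (real N))) * cis (of_int l * x)))\<^sup>2 = fejer N (x - a)"
proof -
  have "(\<Sum>l\<in>{n..<n + int N}. (cis (- (of_int l * a)) / of_real (sqrt (real N))) * cis (of_int l * x))
     = (\<Sum>j<N. cis (of_int n * (x - a)) / of_real (sqrt (real N)) * cis (real j * (x - a)))"
    by (rule sum.reindex_bij_witness[where j = "\<lambda>l. nat (l - n)" and i = "\<lambda>j. n + int j"])
       (auto simp: cis_mult algebra_simps)
  also have "\<dots> = cis (of_int n * (x - a)) / of_real (sqrt (real N)) * (\<Sum>j<N. cis (real j * (x - a)))"
    by (rule sum_distrib_left[symmetric])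
  finally show ?thesis
    by (simp only: norm_mult power_mult_distrib norm_cis_div_sqrt_sq fejer_def) simp
qed

lemma norm_proj_trial_sq:
  assumes Y: "Y \<in> sets circle"
  shows "(norm (proj Y (trial N a n)))\<^sup>2 = (\<integral>x. indicator Y x * fejer N (x - a) \<partial>circle)"
proof -
  define g where "g x = (\<Sum>l\<in>{n..<n + int N}. (cis (- (of_int l * a)) / of_real (sqrt (real N))) * cis (of_int l * x))" for x
  have g: "square_integrable g" "trial N a n = abs_l2 g"
    using trial_eq_abs_l2[where n=n and N=N and a=a] unfolding g_def by auto
  have "(cmod (indicator Y x *\<^sub>R g x))\<^sup>2 = indicator Y x * fejer N (x - a)" for x
    unfolding g_def norm_trial_fun_sq[where n=n and N=N and a=a and x=x, symmetric] by (simp add: indicator_def)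
  then show ?thesis
    unfolding g(2) proj_abs_l2[OF Y g(1)] norm_abs_l2[OF square_integrable_indicator_scaleR[OF Y g(1)]] by simp
qed

text \<open>Expanding |S|^2 as S times its conjugate separates the variables x and a, which are then
  integrated one after the other.\<close>

lemma fejer_expand:
  "fejer N (x - a) = (\<Sum>i<N. \<Sum>j<N. Re (cis (of_int (int i - int j) * x) * cnj (cis (of_int (int i - int j) * a)))) / real N"
proof -
  define S where "S = (\<Sum>j<N. cis (real j * (x - a)))"
  have "(cmod S)\<^sup>2 = Re (S * cnj S)" using complex_norm_square[of S] by (metis Re_complex_of_real)
  also have "S * cnj S = (\<Sum>i<N. \<Sum>j<N. cis (real i * (x - a)) * cnj (cis (real j * (x - a))))"
    unfolding S_def cnj_sum sum_product ..
  also have "\<dots> = (\<Sum>i<N. \<Sum>j<N. cis (of_int (int i - int j) * x) * cnj (cis (of_int (int i - int j) * a)))"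
    by (intro sum.cong refl) (simp add: cis_mult cis_cnj algebra_simps)
  finally show ?thesis unfolding fejer_def S_def by (simp only: Re_sum)
qed

text \<open>Integration against e^{ikx}, so this is the complex conjugate of the k-th Fourier
  coefficient of the indicator.\<close>

definition indicator_fourier :: "real set \<Rightarrow> int \<Rightarrow> complex"
  where "indicator_fourier Y k = (\<integral>x. indicator Y x *\<^sub>R cis (of_int k * x) \<partial>circle)"

lemma integrable_indicator_cis:
  "Y \<in> sets circle \<Longrightarrow> integrable circle (\<lambda>x. indicator Y x *\<^sub>R cis (of_int k * x))"
  using integrable_mult_indicator[OF _ integrable_circle_cis] by simp

lemma integral_Re_indicator_cis:
  assumes Y: "Y \<in> sets circle"
  shows "integrable circle (\<lambda>x. indicator Y x * Re (z * cis (of_int k * x)))"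
    "(\<integral>x. indicator Y x * Re (z * cis (of_int k * x)) \<partial>circle) = Re (z * indicator_fourier Y k)"
proof -
  have eq: "indicator Y x * Re (z * cis (of_int k * x)) = Re (z * (indicator Y x *\<^sub>R cis (of_int k * x)))" for x
    by (simp add: indicator_def)
  have i: "integrable circle (\<lambda>x. z * (indicator Y x *\<^sub>R cis (of_int k * x)))"
    by (intro integrable_mult_right integrable_indicator_cis Y)
  show "integrable circle (\<lambda>x. indicator Y x * Re (z * cis (of_int k * x)))"
    unfolding eq by (rule integrable_Re[OF i])
  show "(\<integral>x. indicator Y x * Re (z * cis (of_int k * x)) \<partial>circle) = Re (z * indicator_fourier Y k)"
    unfolding eq integral_Re[OF i] indicator_fourier_def integral_mult_right_zero ..
qed

lemma integral_indicator_fejer: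
  assumes Y: "Y \<in> sets circle"
  shows "(\<integral>x. indicator Y x * fejer N (x - a) \<partial>circle) =
    (\<Sum>i<N. \<Sum>j<N. Re (cnj (indicator_fourier Y (int i - int j)) * cis (of_int (int i - int j) * a))) / real N"
proof -
  have "(\<integral>x. indicator Y x * fejer N (x - a) \<partial>circle) =
    (\<integral>x. (\<Sum>i<N. \<Sum>j<N. indicator Y x * Re (cnj (cis (of_int (int i - int j) * a)) * cis (of_int (int i - int j) * x))) / real N \<partial>circle)"
    unfolding fejer_expand by (simp only: times_divide_eq_right sum_distrib_left mult.commute[of "cis (of_int _ * _)" "cnj _"])
  also have "\<dots> = (\<Sum>i<N. \<Sum>j<N. Re (cnj (cis (of_int (int i - int j) * a)) * indicator_fourier Y (int i - int j))) / real N"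
    unfolding integral_divide_zero
    by (subst Bochner_Integration.integral_sum, intro Bochner_Integration.integrable_sum integral_Re_indicator_cis Y,
        subst Bochner_Integration.integral_sum, intro integral_Re_indicator_cis Y, simp only: integral_Re_indicator_cis[OF Y])
  also have "\<dots> = (\<Sum>i<N. \<Sum>j<N. Re (cnj (indicator_fourier Y (int i - int j)) * cis (of_int (int i - int j) * a))) / real N"
    by (intro arg_cong[where f = "\<lambda>x. x / real N"] sum.cong refl) simp
  finally show ?thesis .
qed

text \<open>Integration over x \<in> Y gives the conjugate of one coefficient and integration over a
  in the same set Y gives the coefficient itself, hence squared moduli.\<close>

lemma integral_integral_indicator_fejer:
  assumes Y: "Y \<in> sets circle"
  shows "integrable circle (\<lambda>a. indicator Y a * (\<integral>x. indicator Y x * fejer N (x - a) \<partial>circle))"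
   and "(\<integral>a. indicator Y a * (\<integral>x. indicator Y x * fejer N (x - a) \<partial>circle) \<partial>circle) =
    (\<Sum>i<N. \<Sum>j<N. (cmod (indicator_fourier Y (int i - int j)))\<^sup>2) / real N"
proof -
  have eq: "indicator Y a * (\<integral>x. indicator Y x * fejer N (x - a) \<partial>circle) =
    (\<Sum>i<N. \<Sum>j<N. indicator Y a * Re (cnj (indicator_fourier Y (int i - int j)) * cis (of_int (int i - int j) * a))) / real N" for a
    unfolding integral_indicator_fejer[OF Y] by (simp only: times_divide_eq_right sum_distrib_left)
  show "integrable circle (\<lambda>a. indicator Y a * (\<integral>x. indicator Y x * fejer N (x - a) \<partial>circle))"
    unfolding eq
    by (intro integrable_divide_zero Bochner_Integration.integrable_sum integral_Re_indicator_cis Y)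
  have "(\<integral>a. (\<Sum>i<N. \<Sum>j<N. indicator Y a * Re (cnj (indicator_fourier Y (int i - int j)) * cis (of_int (int i - int j) * a))) / real N \<partial>circle)
     = (\<Sum>i<N. \<Sum>j<N. Re (cnj (indicator_fourier Y (int i - int j)) * indicator_fourier Y (int i - int j))) / real N"
    unfolding integral_divide_zero
    by (subst Bochner_Integration.integral_sum, intro Bochner_Integration.integrable_sum integral_Re_indicator_cis Y,
        subst Bochner_Integration.integral_sum, intro integral_Re_indicator_cis Y, simp only: integral_Re_indicator_cis[OF Y])
  then show "(\<integral>a. indicator Y a * (\<integral>x. indicator Y x * fejer N (x - a) \<partial>circle) \<partial>circle) =
    (\<Sum>i<N. \<Sum>j<N. (cmod (indicator_fourier Y (int i - int j)))\<^sup>2) / real N"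
    unfolding eq by (simp only: Re_cnj_mult_self)
qed

lemma indicator_fourier_has_sum:
  assumes Y: "Y \<in> sets circle"
  shows "((\<lambda>k. (cmod (indicator_fourier Y k))\<^sup>2) has_sum measure circle Y) UNIV"
proof -
  define f where "f = abs_l2 (\<lambda>x. of_real (indicator Y x))"
  note sq = square_integrable_of_real_indicator[OF Y]
  have c: "f \<bullet> (c *\<^sub>c fourier_basis k) = Re (cnj c * cnj (indicator_fourier Y k))" for c k
  proof -
    have "f \<bullet> (c *\<^sub>c fourier_basis k) = (\<integral>x. of_real (indicator Y x) \<bullet> (c * cis (of_int k * x)) \<partial>circle)"
      unfolding f_def by (simp add: fourier_basis_abs abs_l2_cscale inner_abs_l2 sq square_integrable_cis square_integrable_cmult)
    also have "\<dots> = (\<integral>x. indicator Y x * Re (c * cis (of_int k * x)) \<partial>circle)"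
      by (simp add: inner_complex_def)
    also have "\<dots> = Re (c * indicator_fourier Y k)" by (rule integral_Re_indicator_cis[OF Y])
    finally show ?thesis by simp
  qed
  have "fourier_coeff f k = cnj (indicator_fourier Y k)" for k
    using c[of 1 k] c[of \<i> k] by (simp add: fourier_coeff_def complex_eq_iff)
  then have "(cmod (fourier_coeff f k))\<^sup>2 = (cmod (indicator_fourier Y k))\<^sup>2" for k by simp
  moreover have "(norm f)\<^sup>2 = measure circle Y"
  proof -
    have "(norm f)\<^sup>2 = (\<integral>x. (cmod (of_real (indicator Y x)))\<^sup>2 \<partial>circle)"
      unfolding f_def by (rule norm_abs_l2[OF sq])
    also have "\<dots> = (\<integral>x. indicator Y x \<partial>circle)"
      by (intro Bochner_Integration.integral_cong) (auto simp: indicator_def)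
    also have "\<dots> = measure circle Y"
      using sets.sets_into_space[OF Y] by (simp add: Int_absorb2)
    finally show ?thesis .
  qed
  ultimately show ?thesis using parseval_has_sum[of f] by simp
qed

text \<open>For L \<le> i < N - L and |k| \<le> L the index j = i - k lies in {0..<N}, so each of
  these N - 2L rows of the grid contains every difference in G.\<close>

lemma double_sum_diff_ge:
  fixes v :: "int \<Rightarrow> real"
  assumes v: "\<And>k. 0 \<le> v k" and G: "finite G" "G \<subseteq> {- int L..int L}" and N: "2 * L \<le> N"
  shows "(real N - 2 * real L) * sum v G \<le> (\<Sum>i<N. \<Sum>j<N. v (int i - int j))"
proof -
  have inner: "sum v G \<le> (\<Sum>j<N. v (int i - int j))" if "i \<in> {L..<N - L}" for i
  proof -
    have inj: "inj_on (\<lambda>k. nat (int i - k)) G"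
    proof (rule inj_onI)
      fix k k' assume k: "k \<in> G" "k' \<in> G" "nat (int i - k) = nat (int i - k')"
      then have "k \<le> int i" "k' \<le> int i" using G(2) that by auto
      then show "k = k'" using k(3) by simp
    qed
    have "sum v G = (\<Sum>k\<in>G. v (int i - int (nat (int i - k))))"
    proof (rule sum.cong)
      fix k assume "k \<in> G"
      then have "k \<le> int i" using G(2) that by auto
      then show "v k = v (int i - int (nat (int i - k)))" by simp
    qed simp
    also have "\<dots> = (\<Sum>j\<in>(\<lambda>k. nat (int i - k)) ` G. v (int i - int j))"
      by (simp add: sum.reindex[OF inj])
    also have "\<dots> \<le> (\<Sum>j<N. v (int i - int j))"
    proof (rule sum_mono2)
      show "(\<lambda>k. nat (int i - k)) ` G \<subseteq> {..<N}"
      proof (rule image_subsetI)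
        fix k assume "k \<in> G"
        then have "- int L \<le> k" using G(2) by auto
        then show "nat (int i - k) \<in> {..<N}" using that by auto
      qed
    qed (use v in auto)
    finally show ?thesis .
  qed
  have "(real N - 2 * real L) * sum v G = (\<Sum>i\<in>{L..<N - L}. sum v G)"
    using N by (simp add: of_nat_diff)
  also have "\<dots> \<le> (\<Sum>i\<in>{L..<N - L}. \<Sum>j<N. v (int i - int j))"
    by (intro sum_mono inner)
  also have "\<dots> \<le> (\<Sum>i<N. \<Sum>j<N. v (int i - int j))"
    by (rule sum_mono2) (auto intro: sum_nonneg v)
  finally show ?thesis .
qed

text \<open>Sorted by k = i - j, the expression is the Cesaro mean with weights 1 - |k|/N, which
  tends to s. Only the lower estimate is proved; the opposite one comes from the mass outside Y
  being nonnegative.\<close>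

lemma eventually_double_sum_diff_ge:
  fixes v :: "int \<Rightarrow> real"
  assumes v: "\<And>k. 0 \<le> v k" and s: "(v has_sum s) UNIV" and e: "0 < e"
  shows "\<forall>\<^sub>F N in sequentially. s - e \<le> (\<Sum>i<N. \<Sum>j<N. v (int i - int j)) / real N"
proof -
  have "\<forall>\<^sub>F G in finite_subsets_at_top UNIV. dist (sum v G) s < e / 2"
    using s e unfolding has_sum_def by (intro tendstoD) auto
  then obtain G where G: "finite G" "dist (sum v G) s < e / 2"
    unfolding eventually_finite_subsets_at_top by blast
  \<comment> \<open>Inserting 0 keeps the maximum defined when G is empty.\<close>
  define L where "L = nat (Max (insert 0 (abs ` G)))"
  have "\<bar>k\<bar> \<le> int L" if "k \<in> G" for k
    using Max_ge[of "insert 0 (abs ` G)" "\<bar>k\<bar>"] G(1) that by (simp add: L_def)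
  then have GL: "G \<subseteq> {- int L..int L}" by force
  have "(\<lambda>N. (1 - 2 * real L / real N) * sum v G) \<longlonglongrightarrow> (1 - 0) * sum v G"
    by (intro tendsto_intros lim_const_over_n)
  moreover have "sum v G - e / 2 < (1 - 0) * sum v G" using e by simp
  ultimately have "\<forall>\<^sub>F N in sequentially. sum v G - e / 2 < (1 - 2 * real L / real N) * sum v G"
    by (rule order_tendstoD)
  then show ?thesis using eventually_gt_at_top[of 0] eventually_ge_at_top[of "2 * L"]
  proof eventually_elim
    case (elim N)
    have "(1 - 2 * real L / real N) * sum v G = (real N - 2 * real L) * sum v G / real N"
      using elim(2) by (simp add: field_simps)
    also have "\<dots> \<le> (\<Sum>i<N. \<Sum>j<N. v (int i - int j)) / real N"
      by (intro divide_right_mono double_sum_diff_ge v G GL elim) simp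
    finally show ?case using elim(1) G(2) unfolding dist_real_def by linarith
  qed
qed

text \<open>The Fejer kernel centred at a typical point of \<open>Y\<close> asymptotically puts all its mass on \<open>Y\<close>;
  this averaged form of the Lebesgue density theorem is Parseval's identity for the indicator of \<open>Y\<close>.\<close>

lemma tendsto_integral_proj_compl_trial:
  assumes Y: "Y \<in> sets circle"
  shows "(\<lambda>N. \<integral>\<^sup>+a. ennreal ((norm (proj (space circle - Y) (trial N a 0)))\<^sup>2) * indicator Y a \<partial>circle) \<longlonglongrightarrow> 0"
proof -
  define E where "E N = measure circle Y - (\<Sum>i<N. \<Sum>j<N. (cmod (indicator_fourier Y (int i - int j)))\<^sup>2) / real N" for N
  define H where "H N a = (\<integral>x. indicator Y x * fejer N (x - a) \<partial>circle)" for N a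
  have compl: "(norm (proj (space circle - Y) (trial N a 0)))\<^sup>2 = 1 - H N a" if "0 < N" for N a
    using norm_proj_compl_sq[OF Y, of "trial N a 0"] norm_trial[OF that, of a 0] norm_proj_trial_sq[OF Y, of N a 0]
    by (simp add: H_def)
  have H1: "0 \<le> 1 - H N a" if "0 < N" for N a
    using compl[OF that, of a] by (metis zero_le_power2)
  have int: "integrable circle (\<lambda>a. indicator Y a * (1 - H N a))"
       "(\<integral>a. indicator Y a * (1 - H N a) \<partial>circle) = E N" for N
  proof -
    have iY: "integrable circle (\<lambda>a. indicator Y a :: real)"
      using Y circle.emeasure_finite[of Y] sets.sets_into_space[OF Y]
      by (simp add: integrable_indicator_iff Int_absorb2 less_top[symmetric])
    have mY: "(\<integral>a. indicator Y a \<partial>circle) = measure circle Y"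
      using sets.sets_into_space[OF Y] by (simp add: Int_absorb2)
    have eq: "indicator Y a * (1 - H N a) = indicator Y a - indicator Y a * H N a" for a
      by (simp add: right_diff_distrib)
    show "integrable circle (\<lambda>a. indicator Y a * (1 - H N a))"
      unfolding eq unfolding H_def by (intro Bochner_Integration.integrable_diff iY integral_integral_indicator_fejer Y)
    show "(\<integral>a. indicator Y a * (1 - H N a) \<partial>circle) = E N"
      unfolding eq unfolding H_def E_def
      by (subst Bochner_Integration.integral_diff, intro iY, intro integral_integral_indicator_fejer Y)
         (simp only: mY integral_integral_indicator_fejer[OF Y])
  qed
  have nn: "(\<integral>\<^sup>+a. ennreal ((norm (proj (space circle - Y) (trial N a 0)))\<^sup>2) * indicator Y a \<partial>circle) = ennreal (E N)"
    if "0 < N" for N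
  proof -
    have "(\<integral>\<^sup>+a. ennreal ((norm (proj (space circle - Y) (trial N a 0)))\<^sup>2) * indicator Y a \<partial>circle)
      = (\<integral>\<^sup>+a. ennreal (indicator Y a * (1 - H N a)) \<partial>circle)"
      unfolding compl[OF that] by (intro nn_integral_cong) (auto simp: indicator_def)
    also have "\<dots> = ennreal (E N)"
      using nn_integral_eq_integral[OF int(1)[of N]] int(2)[of N] H1[OF that] by (simp add: indicator_def)
    finally show ?thesis .
  qed
  have "E \<longlonglongrightarrow> 0"
  proof (rule order_tendstoI)
    fix e :: real assume "e < 0"
    have "0 \<le> E N" if "0 < N" for N
      unfolding int(2)[symmetric] using H1[OF that] by (intro integral_nonneg_AE) auto
    then have "e < E N" if "0 < N" for N
      using that \<open>e < 0\<close> less_le_trans by blast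
    then show "\<forall>\<^sub>F N in sequentially. e < E N"
      by (intro eventually_mono[OF eventually_gt_at_top[of 0]])
  next
    fix e :: real assume "0 < e"
    then have "\<forall>\<^sub>F N in sequentially. measure circle Y - e / 2 \<le> (\<Sum>i<N. \<Sum>j<N. (cmod (indicator_fourier Y (int i - int j)))\<^sup>2) / real N"
      by (intro eventually_double_sum_diff_ge indicator_fourier_has_sum Y) auto
    then show "\<forall>\<^sub>F N in sequentially. E N < e"
      using \<open>0 < e\<close> by (auto simp: E_def elim!: eventually_mono)
  qed
  then have "(\<lambda>N. ennreal (E N)) \<longlonglongrightarrow> ennreal 0" by (rule tendsto_ennrealI)
  then have "(\<lambda>N. ennreal (E N)) \<longlonglongrightarrow> 0" by simp
  then show ?thesis
    by (rule Lim_transform_eventually)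
       (rule eventually_mono[OF eventually_gt_at_top[of 0]], rule nn[symmetric])
qed

section \<open>Lower bound: arbitrary partitions\<close>

context diagonal_operator
begin

definition trial_error :: "nat \<Rightarrow> ennreal"
  where "trial_error N = ennreal diag_norm *
    (\<integral>\<^sup>+k. ennreal (diag_sup k) * ennreal (min 4 (2 * \<bar>of_int k\<bar> / real N)) \<partial>count_space UNIV)"

lemma tendsto_trial_error: "trial_error \<longlonglongrightarrow> 0"
proof -
  have "(\<lambda>N. \<integral>\<^sup>+k. ennreal (diag_sup k) * ennreal (min 4 (2 * \<bar>real_of_int k\<bar> / real N)) \<partial>count_space UNIV) \<longlonglongrightarrow> 0"
  proof (rule tendsto_nn_integral_weight_zero[where B = 4])
    show "(\<integral>\<^sup>+k. ennreal (diag_sup k) \<partial>count_space UNIV) < \<infinity>" by (simp add: nn_integral_diag_sup)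
    have "(\<lambda>N. min 4 (2 * \<bar>real_of_int k\<bar> / real N)) \<longlonglongrightarrow> min 4 0" for k
      by (intro tendsto_intros lim_const_over_n)
    then show "(\<lambda>N. min 4 (2 * \<bar>real_of_int k\<bar> / real N)) \<longlonglongrightarrow> 0" for k by simp
  qed simp_all
  from ennreal_tendsto_cmult[OF _ this, of "ennreal diag_norm"] show ?thesis
    by (simp add: trial_error_def[abs_def])
qed

text \<open>The coefficients of the trial function have squared modulus 1/N on the block, so the
  block mean is exactly the squared norm of the multiplier w(a) applied to it; replacing the
  multiplier by W costs \<open>trial_error\<close>.\<close>

lemma mean_square_le_trial:
  assumes N: "0 < N" and \<eta>: "0 < \<eta>"
  shows "mean_square (L_coeff A a) {n..<n + int N}
    \<le> ennreal (1 + \<eta>) * ennreal ((norm (W (trial N a n)))\<^sup>2) + ennreal (1 + 1 / \<eta>) * trial_error N"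
proof -
  define F where "F = trial N a n"
  define w where "w = L_coeff A a"
  have "mean_square w {n..<n + int N} = ennreal (\<Sum>l\<in>{n..<n + int N}. (cmod (w l))\<^sup>2 * (1 / real N))"
    unfolding mean_square_def by (simp add: sum_distrib_left mult.commute)
  also have "\<dots> = (\<Sum>l\<in>{n..<n + int N}. ennreal ((cmod (w l * fourier_coeff F l))\<^sup>2))"
    unfolding F_def norm_mult power_mult_distrib fourier_coeff_trial
    by (subst sum_ennreal[symmetric]) (auto simp: norm_cis_div_sqrt_sq intro!: sum.cong)
  also have "\<dots> = (\<integral>\<^sup>+l. ennreal ((cmod (w l * fourier_coeff F l))\<^sup>2) \<partial>count_space UNIV)"
    by (rule nn_integral_count_space'[symmetric]) (auto simp: F_def fourier_coeff_trial)
  also have "\<dots> \<le> (\<integral>\<^sup>+l. ennreal (1 + \<eta>) * ennreal ((cmod (fourier_coeff (W F) l))\<^sup>2)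
      + ennreal (1 + 1 / \<eta>) * ennreal ((cmod (fourier_coeff (W F) l - w l * fourier_coeff F l))\<^sup>2) \<partial>count_space UNIV)"
    using ennreal_norm_sq_le_weighted[OF \<eta>, of "w l * fourier_coeff F l" "fourier_coeff (W F) l" for l]
    by (intro nn_integral_mono) (simp add: norm_minus_commute)
  also have "\<dots> = ennreal (1 + \<eta>) * ennreal ((norm (W F))\<^sup>2) + ennreal (1 + 1 / \<eta>) *
      (\<integral>\<^sup>+l. ennreal ((cmod (fourier_coeff (W F) l - w l * fourier_coeff F l))\<^sup>2) \<partial>count_space UNIV)"
    by (simp add: nn_integral_add nn_integral_cmult parseval)
  also have "\<dots> \<le> ennreal (1 + \<eta>) * ennreal ((norm (W F))\<^sup>2) + ennreal (1 + 1 / \<eta>) * trial_error N"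
  proof (intro add_left_mono mult_left_mono)
    have "(\<integral>\<^sup>+l. ennreal ((cmod (fourier_coeff (W F) l - w l * fourier_coeff F l))\<^sup>2) \<partial>count_space UNIV)
      \<le> ennreal diag_norm * (\<integral>\<^sup>+k. ennreal (diag_sup k) *
        ennreal ((norm (modulate k F - cis (of_int k * a) *\<^sub>c F))\<^sup>2) \<partial>count_space UNIV)"
      unfolding w_def by (rule operator_approx_L_coeff)
    also have "\<dots> \<le> trial_error N"
      unfolding trial_error_def F_def
      by (intro mult_left_mono nn_integral_mono ennreal_leI norm_modulate_trial_diff_sq_le N) auto
    finally show "(\<integral>\<^sup>+l. ennreal ((cmod (fourier_coeff (W F) l - w l * fourier_coeff F l))\<^sup>2) \<partial>count_space UNIV) \<le> trial_error N" .
  qed simp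
  finally show ?thesis unfolding w_def F_def .
qed

text \<open>The trial function is split into its parts on Y and off Y. The mass off Y is stated for
  the block starting at 0, which makes the bound uniform in n.\<close>

lemma norm_operator_trial_sq_le:
  assumes Y: "Y \<in> sets circle" and N: "0 < N" and \<eta>: "0 < \<eta>"
  shows "ennreal ((norm (W (trial N a n)))\<^sup>2) \<le> ennreal (1 + \<eta>) * ennreal ((onorm (W \<circ> proj Y))\<^sup>2)
     + ennreal ((1 + 1 / \<eta>) * diag_norm\<^sup>2) * ennreal ((norm (proj (space circle - Y) (trial N a 0)))\<^sup>2)"
proof -
  interpret bounded_linear W by (rule bounded_linear_operator)
  define F where "F = trial N a n"
  define Z where "Z = space circle - Y"
  have "norm (W (proj Y F)) \<le> onorm (W \<circ> proj Y) * norm F"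
    using onorm[OF bounded_linear_operator_proj[OF Y], of F] by simp
  then have 1: "(norm (W (proj Y F)))\<^sup>2 \<le> (onorm (W \<circ> proj Y))\<^sup>2"
    unfolding F_def norm_trial[OF N] by (intro power_mono) auto
  have "(norm (proj Y (trial N a n)))\<^sup>2 = (norm (proj Y (trial N a 0)))\<^sup>2"
    unfolding norm_proj_trial_sq[OF Y] ..
  then have Z: "(norm (proj Z F))\<^sup>2 = (norm (proj Z (trial N a 0)))\<^sup>2"
    using norm_proj_compl_sq[OF Y, of F] norm_proj_compl_sq[OF Y, of "trial N a 0"]
    unfolding Z_def F_def norm_trial[OF N] by linarith
  have "(norm (W (proj Z F)))\<^sup>2 \<le> (diag_norm * norm (proj Z F))\<^sup>2"
    by (intro power_mono norm_operator_le) simp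
  then have 2: "(norm (W (proj Z F)))\<^sup>2 \<le> diag_norm\<^sup>2 * (norm (proj Z (trial N a 0)))\<^sup>2"
    unfolding power_mult_distrib Z .
  have "W F - W (proj Y F) = W (proj Z F)"
    using proj_add_compl[OF Y, of F] unfolding Z_def by (metis add add_diff_cancel_left')
  then have "(norm (W F))\<^sup>2 \<le> (1 + \<eta>) * (norm (W (proj Y F)))\<^sup>2 + (1 + 1 / \<eta>) * (norm (W (proj Z F)))\<^sup>2"
    using norm_sq_le_weighted[OF \<eta>, of "W F" "W (proj Y F)"] by simp
  also have "\<dots> \<le> (1 + \<eta>) * (onorm (W \<circ> proj Y))\<^sup>2 + (1 + 1 / \<eta>) * (diag_norm\<^sup>2 * (norm (proj Z (trial N a 0)))\<^sup>2)"
    using \<eta> by (intro add_mono mult_left_mono 1 2) auto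
  finally have "ennreal ((norm (W F))\<^sup>2) \<le> ennreal ((1 + \<eta>) * (onorm (W \<circ> proj Y))\<^sup>2 + (1 + 1 / \<eta>) * diag_norm\<^sup>2 * (norm (proj Z (trial N a 0)))\<^sup>2)"
    by (intro ennreal_leI) (simp add: mult.assoc)
  also have "\<dots> = ennreal (1 + \<eta>) * ennreal ((onorm (W \<circ> proj Y))\<^sup>2) + ennreal ((1 + 1 / \<eta>) * diag_norm\<^sup>2) * ennreal ((norm (proj Z (trial N a 0)))\<^sup>2)"
    using \<eta> by (subst ennreal_plus) (auto simp: ennreal_mult[symmetric] simp del: ennreal_plus)
  finally show ?thesis unfolding F_def Z_def .
qed

text \<open>The pointwise bound on \<open>rho\<close> holds for every N; it is integrated over Y, N
  tends to infinity, and \<eta> tends to 0 last.\<close>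

lemma integral_rho_le_onorm:
  assumes Y: "Y \<in> sets circle"
  shows "(\<integral>\<^sup>+a. rho (L_coeff A a) * indicator Y a \<partial>circle) \<le> ennreal (measure circle Y * (onorm (W \<circ> proj Y))\<^sup>2)"
proof (rule ennreal_le_of_le_mult_power2)
  fix \<eta> :: real assume \<eta>: "0 < \<eta>"
  define M where "M = (onorm (W \<circ> proj Y))\<^sup>2"
  define P where "P N a = ennreal ((norm (proj (space circle - Y) (trial N a 0)))\<^sup>2)" for N a
  define c where "c = ennreal (1 + \<eta>) * ennreal ((1 + 1 / \<eta>) * diag_norm\<^sup>2)"
  have P_eq: "P N a = ennreal (1 - (\<integral>x. indicator Y x * fejer N (x - a) \<partial>circle))" if "0 < N" for N a
  proof -
    have "(norm (proj (space circle - Y) (trial N a 0)))\<^sup>2 = 1 - (\<integral>x. indicator Y x * fejer N (x - a) \<partial>circle)"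
      using norm_proj_compl_sq[OF Y, of "trial N a 0"]
      unfolding norm_proj_trial_sq[OF Y] norm_trial[OF that] power_one by linarith
    then show ?thesis unfolding P_def by (rule arg_cong)
  qed
  \<comment> \<open>Measurability in a is not visible from the norm in \<open>l2\<close>; it is read
    off from the formula through the Fejer kernel.\<close>
  have Pm: "(\<lambda>a. P N a * indicator Y a) \<in> borel_measurable circle" if "0 < N" for N
  proof -
    have "(\<lambda>a. ennreal (indicator Y a - indicator Y a * (\<integral>x. indicator Y x * fejer N (x - a) \<partial>circle))) \<in> borel_measurable circle"
      using Y borel_measurable_integrable[OF integral_integral_indicator_fejer(1)[OF Y, of N]] by measurable
    also have "(\<lambda>a. ennreal (indicator Y a - indicator Y a * (\<integral>x. indicator Y x * fejer N (x - a) \<partial>circle))) = (\<lambda>a. P N a * indicator Y a)"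
      unfolding P_eq[OF that] by (auto simp: indicator_def)
    finally show ?thesis .
  qed
  have pw: "rho (L_coeff A a) \<le> ennreal ((1 + \<eta>)\<^sup>2) * ennreal M + c * P N a + ennreal (1 + 1 / \<eta>) * trial_error N"
    if N: "0 < N" for N a
  proof -
    have "rho (L_coeff A a) \<le> block_sup N (L_coeff A a)" by (rule rho_le_block_sup[OF N])
    also have "\<dots> \<le> ennreal ((1 + \<eta>)\<^sup>2) * ennreal M + c * P N a + ennreal (1 + 1 / \<eta>) * trial_error N"
      unfolding block_sup_def
    proof (rule SUP_least)
      fix n
      have sq: "ennreal ((1 + \<eta>)\<^sup>2) = ennreal (1 + \<eta>) * ennreal (1 + \<eta>)"
        using \<eta> by (simp add: power2_eq_square ennreal_mult del: ennreal_plus)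
      have "mean_square (L_coeff A a) {n..<n + int N}
        \<le> ennreal (1 + \<eta>) * ennreal ((norm (W (trial N a n)))\<^sup>2) + ennreal (1 + 1 / \<eta>) * trial_error N"
        by (rule mean_square_le_trial[OF N \<eta>])
      also have "\<dots> \<le> ennreal (1 + \<eta>) * (ennreal (1 + \<eta>) * ennreal M + ennreal ((1 + 1 / \<eta>) * diag_norm\<^sup>2) * P N a)
          + ennreal (1 + 1 / \<eta>) * trial_error N"
        unfolding M_def P_def by (intro add_right_mono mult_left_mono norm_operator_trial_sq_le[OF Y N \<eta>]) simp
      also have "\<dots> = ennreal ((1 + \<eta>)\<^sup>2) * ennreal M + c * P N a + ennreal (1 + 1 / \<eta>) * trial_error N"
        unfolding sq c_def by (simp only: distrib_left mult.assoc)
      finally show "mean_square (L_coeff A a) {n..<n + int N}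
        \<le> ennreal ((1 + \<eta>)\<^sup>2) * ennreal M + c * P N a + ennreal (1 + 1 / \<eta>) * trial_error N" .
    qed
    finally show ?thesis .
  qed
  define B where "B N = ennreal ((1 + \<eta>)\<^sup>2) * ennreal (measure circle Y * M)
     + c * (\<integral>\<^sup>+a. P N a * indicator Y a \<partial>circle) + ennreal (1 + 1 / \<eta>) * trial_error N" for N
  have "(\<integral>\<^sup>+a. rho (L_coeff A a) * indicator Y a \<partial>circle) \<le> B N" if N: "0 < N" for N
  proof -
    \<comment> \<open>The last error term is constant in a and is integrated over the whole circle,
      which has mass 1.\<close>
    have "(\<integral>\<^sup>+a. rho (L_coeff A a) * indicator Y a \<partial>circle)
      \<le> (\<integral>\<^sup>+a. ennreal ((1 + \<eta>)\<^sup>2) * ennreal M * indicator Y a + c * (P N a * indicator Y a)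
          + ennreal (1 + 1 / \<eta>) * trial_error N \<partial>circle)"
      using pw[OF N] by (intro nn_integral_mono) (auto simp: indicator_def)
    also have "\<dots> = ennreal ((1 + \<eta>)\<^sup>2) * ennreal M * emeasure circle Y
        + c * (\<integral>\<^sup>+a. P N a * indicator Y a \<partial>circle) + ennreal (1 + 1 / \<eta>) * trial_error N"
      using Y Pm[OF N] emeasure_circle_space by (simp add: nn_integral_add nn_integral_cmult)
    also have "\<dots> = B N"
      by (simp add: B_def circle.emeasure_eq_measure M_def mult.assoc ennreal_mult mult.commute[of "measure circle Y"])
    finally show ?thesis .
  qed
  moreover have "B \<longlonglongrightarrow> ennreal ((1 + \<eta>)\<^sup>2) * ennreal (measure circle Y * M) + c * 0 + ennreal (1 + 1 / \<eta>) * 0"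
    unfolding B_def P_def using tendsto_integral_proj_compl_trial[OF Y] tendsto_trial_error
    by (intro tendsto_add tendsto_const ennreal_tendsto_cmult) (auto simp: c_def ennreal_mult_less_top simp del: ennreal_plus)
  then have "B \<longlonglongrightarrow> ennreal ((1 + \<eta>)\<^sup>2) * ennreal (measure circle Y * M)" by simp
  ultimately show "(\<integral>\<^sup>+a. rho (L_coeff A a) * indicator Y a \<partial>circle)
      \<le> ennreal ((1 + \<eta>)\<^sup>2) * ennreal (measure circle Y * (onorm (W \<circ> proj Y))\<^sup>2)"
    unfolding M_def by (intro LIMSEQ_le_const) (auto intro!: exI[of _ 1])
qed

text \<open>Almost every a lies in some member of P, so there \<open>rho\<close> is at most the sum
  of its restrictions; each restriction is bounded by its term of the partition sum.\<close>

lemma rho_le_partition_sum: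
  assumes P: "measurable_partition P"
  shows "(\<integral>\<^sup>+a. rho (L_coeff A a) \<partial>circle) \<le> ennreal (partition_sum P W)"
proof -
  have P1: "finite P" "\<And>Y. Y \<in> P \<Longrightarrow> Y \<in> sets circle" and P2: "measure circle (space circle - \<Union>P) = 0"
    using P unfolding measurable_partition_def by auto
  have [measurable]: "(\<lambda>a. rho (L_coeff A a)) \<in> borel_measurable circle"
    by (rule borel_measurable_circleI) simp
  have U: "space circle - \<Union>P \<in> null_sets circle"
    using P1 P2 sets.top[of circle] by (intro null_setsI) (auto simp: circle.emeasure_eq_measure intro!: sets.Diff sets.finite_Union)
  have "(\<integral>\<^sup>+a. rho (L_coeff A a) \<partial>circle) \<le> (\<integral>\<^sup>+a. (\<Sum>Y\<in>P. rho (L_coeff A a) * indicator Y a) \<partial>circle)"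
  proof (rule nn_integral_mono_AE, rule AE_I'[OF U], safe)
    fix a assume a: "a \<in> space circle" "\<not> rho (L_coeff A a) \<le> (\<Sum>Y\<in>P. rho (L_coeff A a) * indicator Y a)"
    fix Y assume Y: "a \<in> Y" "Y \<in> P"
    have "rho (L_coeff A a) * indicator Y a \<le> (\<Sum>Y\<in>P. rho (L_coeff A a) * indicator Y a)"
      using P1(1) Y(2) by (intro member_le_sum) auto
    then show False using a Y by simp
  qed
  also have "\<dots> = (\<Sum>Y\<in>P. \<integral>\<^sup>+a. rho (L_coeff A a) * indicator Y a \<partial>circle)"
    using P1 by (intro nn_integral_sum) auto
  also have "\<dots> \<le> (\<Sum>Y\<in>P. ennreal (measure circle Y * (onorm (W \<circ> proj Y))\<^sup>2))"
    using P1(2) by (intro sum_mono integral_rho_le_onorm)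
  also have "\<dots> = ennreal (partition_sum P W)"
    unfolding partition_sum_def by (intro sum_ennreal) simp
  finally show ?thesis .
qed

lemma rho_le_mu_norm: "(\<integral>\<^sup>+a. rho (L_coeff A a) \<partial>circle) \<le> ennreal ((mu_norm W)\<^sup>2)"
proof -
  define R where "R = (\<integral>\<^sup>+a. rho (L_coeff A a) \<partial>circle)"
  \<comment> \<open>The whole circle as a single arc: it shows that the integral is finite and that
    the infimum is over a nonempty set.\<close>
  have ex: "measurable_partition (circle_arc 1 ` {..<1})" by (rule measurable_partition_arcs) simp
  then have "R < \<infinity>" using rho_le_partition_sum[OF ex] unfolding R_def by (simp add: le_less_trans)
  then obtain r where r: "0 \<le> r" "R = ennreal r" by (cases R) auto
  have "sqrt r \<le> sqrt (partition_sum P W)" if "measurable_partition P" for P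
  proof -
    have "0 \<le> partition_sum P W" unfolding partition_sum_def by (intro sum_nonneg) auto
    then show ?thesis
      using rho_le_partition_sum[OF that] r unfolding R_def[symmetric] by simp
  qed
  then have "sqrt r \<le> mu_norm W"
    unfolding mu_norm_def using ex by (intro cINF_greatest) auto
  then have "(sqrt r)\<^sup>2 \<le> (mu_norm W)\<^sup>2" using r by (intro power_mono) auto
  then show ?thesis using r unfolding R_def[symmetric] by (simp add: ennreal_leI)
qed

end

theorem proposition7p1:
  fixes W :: "l2 \<Rightarrow> l2" and A :: "int \<Rightarrow> int \<Rightarrow> complex"
  assumes "has_matrix W A"
    and "diagonal_type A"
  shows "ennreal ((mu_norm W)\<^sup>2) =
    ennreal (1 / (2 * pi)) * (\<integral>\<^sup>+a\<in>{0..<2 * pi}. rho (L_coeff A a) \<partial>lborel)"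
proof -
  interpret diagonal_operator W A using assms by unfold_locales
  have "ennreal ((mu_norm W)\<^sup>2) = (\<integral>\<^sup>+a. rho (L_coeff A a) \<partial>circle)"
    using mu_norm_le_rho rho_le_mu_norm by (rule antisym)
  then show ?thesis by (simp add: nn_integral_circle)
qed

end
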